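(* Let $K$ be a formally real partial differential field with pairwise commuting derivations $\partial_1,\dots,\partial_m$ and real closed field of constants $\mathcal{C}_K$, and consider an integrable differential system $$\partial_j Y=A_j Y,\qquad 1\le j\le m, \qquad (S)$$ where each $A_j$ is an $(r\times r)$-matrix with entries in $K$. Let $L_1$, $L_2$ be two formally real Picard--Vessiot extensions of $K$ for $(S)$. Suppose that $L_1$ and $L_2$ have orderings which induce the same ordering on $K$. Then $L_1$ and $L_2$ are $K$-differentially isomorphic.
   Context: A partial differential field is a field endowed with a finite set of pairwise commuting derivations $\partial_1,\dots,\partial_m$; its field of constants is the subfield of elements on which all $\partial_j$ vanish. A differential field extension $L/K$ is a field extension with $L$ equipped with pairwise commuting derivations extending those of $K$. Two such extensions are $K$-differentially isomorphic if there is a field isomorphism between them which fixes $K$ and commutes with the derivations. The system $(S)$ is integrable if $\partial_j A_i+A_iA_j=\partial_i A_j+A_jA_i$ for $1\le i,j\le m$. A fundamental matrix for $(S)$ with entries in a differential field extension $L$ of $K$ is $M\in\mathrm{GL}_r(L)$ with $\partial_j M=A_jM$, $1\le j\le m$. A Picard--Vessiot extension of $K$ for $(S)$ is a differential field extension $L/K$ such that there is a fundamental matrix $Z$ for $(S)$ with entries in $L$, $L$ is generated as a field over $K$ by the entries of $Z$, and the field of constants of $L$ equals that of $K$. It is called formally real if $L$ is a formally real field. A field is formally real if it can be ordered (equivalently, $-1$ is not a sum of squares in it). A real closed field is a formally real field with no nontrivial formally real algebraic extension. An ordering on a field is a total order $\le$ such that $x\le y\Rightarrow x+z\le y+z$,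 and $0\le x,\,0\le y\Rightarrow 0\le xy$. *)

theory Defs
  imports
    "HOL-Algebra.Algebraic_Closure_Type"
    "HOL-Algebra.Generated_Fields"
    "Jordan_Normal_Form.Matrix"
begin

text \<open>
  Fields are types of class \<open>field\<close>, and an extension \<open>L/K\<close> is an embedding
  \<open>e :: 'k \<Rightarrow> 'l\<close>. Subfields (such as the field of constants) are sets, using the
  \<open>HOL-Algebra\<close> notions \<^const>\<open>subfield\<close> and \<^const>\<open>generate_field\<close> relative to
  \<^const>\<open>ring_of_type_algebra\<close>, the whole field type viewed as a ring record.
\<close>

section \<open>Orderings, formally real and real closed fields\<close>

text \<open>The pair \<open>(x, y)\<close> belongs to the relation \<open>R\<close> iff \<open>x \<le> y\<close>.\<close>

definition field_ordering_on :: "'a::field set \<Rightarrow> 'a rel \<Rightarrow> bool" where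
  "field_ordering_on F R \<longleftrightarrow>
     linear_order_on F R \<and>
     (\<forall>x\<in>F. \<forall>y\<in>F. \<forall>z\<in>F. (x, y) \<in> R \<longrightarrow> (x + z, y + z) \<in> R) \<and>
     (\<forall>x\<in>F. \<forall>y\<in>F. (0, x) \<in> R \<longrightarrow> (0, y) \<in> R \<longrightarrow> (0, x * y) \<in> R)"

definition formally_real_on :: "'a::field set \<Rightarrow> bool" where
  "formally_real_on F \<longleftrightarrow>
     subfield F ring_of_type_algebra \<and> (\<exists>R. field_ordering_on F R)"

definition algebraic_extension_of :: "'a::field set \<Rightarrow> 'a set \<Rightarrow> bool" where
  "algebraic_extension_of C F \<longleftrightarrow>
     subfield C ring_of_type_algebra \<and> subfield F ring_of_type_algebra \<and> C \<subseteq> F \<and>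
     (\<forall>x\<in>F. \<exists>p. p \<noteq> 0 \<and> (\<forall>i. coeff p i \<in> C) \<and> poly p x = 0)"

text \<open>
  HOL cannot quantify over all extension fields of \<open>C\<close>, which would range over all types.
  The algebraic extensions are therefore taken inside the algebraic closure
  \<^typ>\<open>'a alg_closure\<close> of the ambient field \<^typ>\<open>'a\<close>, embedded by \<^const>\<open>to_ac\<close>.
  This loses none: that field is algebraically closed and contains \<open>C\<close>, so every
  algebraic extension of \<open>C\<close> is \<open>C\<close>-isomorphic to one of its subfields.
\<close>

definition real_closed_on :: "'a::field set \<Rightarrow> bool" where
  "real_closed_on C \<longleftrightarrow>
     formally_real_on C \<and>
     (\<forall>F :: 'a alg_closure set.
        algebraic_extension_of (to_ac ` C) F \<and> formally_real_on F \<longrightarrow> F = to_ac ` C)"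

section \<open>Partial differential fields\<close>

text \<open>The derivations of a partial differential field are \<open>D 1, \<dots>, D m\<close>; values of \<open>D\<close> at other indices are irrelevant.\<close>

definition derivation :: "('a::field \<Rightarrow> 'a) \<Rightarrow> bool" where
  "derivation d \<longleftrightarrow>
     (\<forall>x y. d (x + y) = d x + d y) \<and> (\<forall>x y. d (x * y) = d x * y + x * d y)"

definition differential_field :: "nat \<Rightarrow> (nat \<Rightarrow> 'a::field \<Rightarrow> 'a) \<Rightarrow> bool" where
  "differential_field m D \<longleftrightarrow>
     (\<forall>j\<in>{1..m}. derivation (D j)) \<and>
     (\<forall>i\<in>{1..m}. \<forall>j\<in>{1..m}. \<forall>x. D i (D j x) = D j (D i x))"

definition constants :: "nat \<Rightarrow> (nat \<Rightarrow> 'a::field \<Rightarrow> 'a) \<Rightarrow> 'a set" where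
  "constants m D = {x. \<forall>j\<in>{1..m}. D j x = 0}"

definition differential_hom ::
  "nat \<Rightarrow> (nat \<Rightarrow> 'a::field \<Rightarrow> 'a) \<Rightarrow> (nat \<Rightarrow> 'b::field \<Rightarrow> 'b) \<Rightarrow> ('a \<Rightarrow> 'b) \<Rightarrow> bool" where
  "differential_hom m DK DL e \<longleftrightarrow>
     field_hom e \<and> (\<forall>j\<in>{1..m}. \<forall>x. e (DK j x) = DL j (e x))"

definition differential_extension ::
  "nat \<Rightarrow> (nat \<Rightarrow> 'k::field \<Rightarrow> 'k) \<Rightarrow> (nat \<Rightarrow> 'l::field \<Rightarrow> 'l) \<Rightarrow> ('k \<Rightarrow> 'l) \<Rightarrow> bool" where
  "differential_extension m DK DL e \<longleftrightarrow>
     differential_field m DK \<and> differential_field m DL \<and> differential_hom m DK DL e"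

definition differentially_isomorphic ::
  "nat \<Rightarrow> (nat \<Rightarrow> 'a::field \<Rightarrow> 'a) \<Rightarrow> ('k::field \<Rightarrow> 'a) \<Rightarrow>
   (nat \<Rightarrow> 'b::field \<Rightarrow> 'b) \<Rightarrow> ('k \<Rightarrow> 'b) \<Rightarrow> bool" where
  "differentially_isomorphic m D1 e1 D2 e2 \<longleftrightarrow>
     (\<exists>\<phi>. differential_hom m D1 D2 \<phi> \<and> bij \<phi> \<and> (\<forall>x. \<phi> (e1 x) = e2 x))"

section \<open>Integrable systems and Picard--Vessiot extensions\<close>

definition integrable_system ::
  "nat \<Rightarrow> (nat \<Rightarrow> 'k::field \<Rightarrow> 'k) \<Rightarrow> nat \<Rightarrow> (nat \<Rightarrow> 'k mat) \<Rightarrow> bool" where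
  "integrable_system m D r A \<longleftrightarrow>
     (\<forall>j\<in>{1..m}. A j \<in> carrier_mat r r) \<and>
     (\<forall>i\<in>{1..m}. \<forall>j\<in>{1..m}.
        map_mat (D j) (A i) + A i * A j = map_mat (D i) (A j) + A j * A i)"

definition fundamental_matrix ::
  "nat \<Rightarrow> (nat \<Rightarrow> 'l::field \<Rightarrow> 'l) \<Rightarrow> ('k::field \<Rightarrow> 'l) \<Rightarrow> nat \<Rightarrow> (nat \<Rightarrow> 'k mat) \<Rightarrow>
   'l mat \<Rightarrow> bool" where
  "fundamental_matrix m DL e r A Z \<longleftrightarrow>
     Z \<in> carrier_mat r r \<and> invertible_mat Z \<and>
     (\<forall>j\<in>{1..m}. map_mat (DL j) Z = map_mat e (A j) * Z)"

definition picard_vessiot ::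
  "nat \<Rightarrow> (nat \<Rightarrow> 'k::field \<Rightarrow> 'k) \<Rightarrow> nat \<Rightarrow> (nat \<Rightarrow> 'k mat) \<Rightarrow>
   (nat \<Rightarrow> 'l::field \<Rightarrow> 'l) \<Rightarrow> ('k \<Rightarrow> 'l) \<Rightarrow> bool" where
  "picard_vessiot m DK r A DL e \<longleftrightarrow>
     differential_extension m DK DL e \<and>
     (\<exists>Z. fundamental_matrix m DL e r A Z \<and>
          generate_field ring_of_type_algebra (range e \<union> elements_mat Z) = UNIV) \<and>
     constants m DL = e ` constants m DK"

end

theory Submission
  imports Defs "HOL-Library.Function_Algebras" "HOL-Library.Multiset"
begin

text \<open>
  Let \<open>Z1\<close> and \<open>Z2\<close> be fundamental matrices generating the two extensions, and let \<open>C\<close> be the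
  field of constants of \<open>K\<close>. If \<open>M\<close> is an invertible matrix over \<open>C\<close> such that \<open>Z1 M\<close> and
  \<open>Z2\<close> satisfy the same polynomial relations over \<open>K\<close>, then \<open>Z1 M \<mapsto> Z2\<close> defines a
  \<open>K\<close>-isomorphism, and it commutes with the derivations because \<open>Z1 M\<close> and \<open>Z2\<close> solve the same
  system (\<open>same_relations_isomorphic\<close>). The problem is to find \<open>M\<close>.

  The condition on \<open>M\<close> is algebraic over \<open>C\<close>. Put \<open>X = Z1 Y\<close> with an indeterminate constant
  matrix \<open>Y\<close>. The relations of \<open>Z2\<close>, read as polynomials in \<open>Y\<close> over the first extension, span
  a space that is stable under differentiating the coefficients, and such a space is spanned by
  polynomials with constant coefficients: a vector of minimal support with an entry \<open>1\<close> is
  killed by the derivations (\<open>spanned_by_constants\<close>). So \<open>Z1 M\<close> satisfies the relations of \<open>Z2\<close>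
  if and only if \<open>M\<close> satisfies certain polynomial equations over \<open>C\<close>, of which finitely many
  suffice by Hilbert's basis theorem (\<open>finitely_many_equations\<close>); these involve finitely many
  relations of \<open>Z2\<close>.

  The orderings serve to solve these equations in \<open>C\<close>, by Tarski's transfer principle
  (\<open>transfer_principle\<close>): a system of polynomial conditions over an ordered field that has a
  solution in one real closed extension has one in every other that induces the same ordering.
  The matrix \<open>Z2\<close> is a solution of its relations in a real closure of the second extension.
  Both extensions induce the same ordering on \<open>K\<close>, so there is a solution \<open>X\<close> in a real
  closure of the first one, and \<open>Y = Z1\<^sup>-\<^sup>1 X\<close> solves the equations over \<open>C\<close> there. As
  \<open>C\<close> is real closed, its ordering is unique, and a second transfer yields a solution \<open>M\<close>
  in \<open>C\<close> (\<open>constant_specialization\<close>).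

  This gives one inclusion between the relations. Exchanging the extensions gives a constant
  matrix \<open>N\<close> such that \<open>Z2 N\<close> satisfies the relations of \<open>Z1\<close>. Hence \<open>Z2 \<mapsto> Z2 (N M)\<close> is an
  endomorphism of the algebra generated by \<open>Z2\<close>. It is linear in the generators and invertible
  on them, and a dimension count shows that it is injective, whence equality of the relations
  (\<open>relations_preserved_reflected\<close>).

  The transfer principle rests on the elimination of one variable in the manner of Cohen and
  Hoermander: the signs of a polynomial at the roots of others are those of its remainders, and
  its roots between them are located by its derivative. This uses nothing about real closed
  fields but the intermediate value property for polynomials, which follows from the maximality
  of the ordering by the argument of Artin and Schreier (\<open>maximal_cone_ivt\<close>).
\<close>

section \<open>Subfields and polynomials over them\<close>

text \<open>
  A subfield is a plain set here, since most of the subfields below vary; \<open>subfield_iff_subfld\<close>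
  relates the notion to that of the algebra library.
\<close>

locale subfld =
  fixes F :: "'a::field set"
  assumes one_mem: "1 \<in> F"
    and add_mem: "\<And>x y. x \<in> F \<Longrightarrow> y \<in> F \<Longrightarrow> x + y \<in> F"
    and uminus_mem: "\<And>x. x \<in> F \<Longrightarrow> - x \<in> F"
    and mult_mem: "\<And>x y. x \<in> F \<Longrightarrow> y \<in> F \<Longrightarrow> x * y \<in> F"
    and inverse_mem: "\<And>x. x \<in> F \<Longrightarrow> inverse x \<in> F"
begin

lemma zero_mem: "0 \<in> F"
  using add_mem[OF one_mem uminus_mem[OF one_mem]] by simp

lemma diff_mem: "x \<in> F \<Longrightarrow> y \<in> F \<Longrightarrow> x - y \<in> F"
  using add_mem[of x "- y"] uminus_mem[of y] by simp

lemma divide_mem: "x \<in> F \<Longrightarrow> y \<in> F \<Longrightarrow> x / y \<in> F"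
  using mult_mem[of x "inverse y"] inverse_mem[of y] by (simp add: field_class.field_divide_inverse)

lemma power_mem: "x \<in> F \<Longrightarrow> x ^ n \<in> F"
  by (induction n) (auto intro: one_mem mult_mem)

lemma sum_mem: "(\<And>i. i \<in> I \<Longrightarrow> f i \<in> F) \<Longrightarrow> sum f I \<in> F"
  by (induction I rule: infinite_finite_induct) (auto intro: zero_mem add_mem)

lemma of_nat_mem: "of_nat n \<in> F"
  by (induction n) (auto intro: zero_mem add_mem one_mem)

lemmas mem = zero_mem one_mem add_mem uminus_mem mult_mem inverse_mem diff_mem divide_mem
  power_mem of_nat_mem

definition polys :: "'a poly set" where
  "polys = {p. \<forall>i. coeff p i \<in> F}"

lemma coeff_mem: "p \<in> polys \<Longrightarrow> coeff p i \<in> F"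
  by (simp add: polys_def)

lemma pCons_polys_iff: "pCons c p \<in> polys \<longleftrightarrow> c \<in> F \<and> p \<in> polys"
  by (auto simp: polys_def coeff_pCons split: nat.splits)

lemma zero_polys: "0 \<in> polys"
  by (simp add: polys_def zero_mem)

lemma one_polys: "1 \<in> polys"
  by (simp add: one_pCons pCons_polys_iff zero_polys one_mem)

lemma add_polys: "p \<in> polys \<Longrightarrow> q \<in> polys \<Longrightarrow> p + q \<in> polys"
  by (simp add: polys_def add_mem)

lemma uminus_polys: "p \<in> polys \<Longrightarrow> - p \<in> polys"
  by (simp add: polys_def uminus_mem)

lemma diff_polys: "p \<in> polys \<Longrightarrow> q \<in> polys \<Longrightarrow> p - q \<in> polys"
  by (simp add: polys_def diff_mem)

lemma smult_polys: "c \<in> F \<Longrightarrow> p \<in> polys \<Longrightarrow> smult c p \<in> polys"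
  by (simp add: polys_def mult_mem)

lemma mult_polys: "p \<in> polys \<Longrightarrow> q \<in> polys \<Longrightarrow> p * q \<in> polys"
  by (auto simp: polys_def coeff_mult intro!: sum_mem mult_mem)

lemma power_polys: "p \<in> polys \<Longrightarrow> p ^ n \<in> polys"
  by (induction n) (auto intro: one_polys mult_polys)

lemma monom_polys: "c \<in> F \<Longrightarrow> monom c n \<in> polys"
  by (simp add: polys_def coeff_monom zero_mem)

lemma pderiv_polys: "p \<in> polys \<Longrightarrow> pderiv p \<in> polys"
  by (auto simp: polys_def coeff_pderiv intro!: mult_mem of_nat_mem add_mem one_mem)

lemma poly_mem: "p \<in> polys \<Longrightarrow> x \<in> F \<Longrightarrow> poly p x \<in> F"
  by (induction p) (auto simp: pCons_polys_iff zero_mem intro: add_mem mult_mem)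

lemma synthetic_div_polys: "p \<in> polys \<Longrightarrow> c \<in> F \<Longrightarrow> synthetic_div p c \<in> polys"
  by (induction p) (auto simp: pCons_polys_iff zero_polys simp del: synthetic_div_pCons simp: synthetic_div_pCons intro!: poly_mem)

lemmas polys_mem = zero_polys one_polys add_polys uminus_polys diff_polys smult_polys mult_polys
  power_polys monom_polys pderiv_polys

lemma root_factor:
  assumes "p \<in> polys" "c \<in> F" "poly p c = 0"
  obtains q where "q \<in> polys" "p = [:- c, 1:] * q"
proof
  show "synthetic_div p c \<in> polys" using assms by (intro synthetic_div_polys)
  show "p = [:- c, 1:] * synthetic_div p c"
    using synthetic_div_correct'[of c p] assms(3) by simp
qed

text \<open>
  Division with remainder has to be repeated because quotient and remainder must have their
  coefficients in \<open>F\<close> again.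
\<close>

lemma division:
  assumes "f \<in> polys" "f \<noteq> 0"
  shows "p \<in> polys \<Longrightarrow>
    \<exists>q r. q \<in> polys \<and> r \<in> polys \<and> p = f * q + r \<and> (r = 0 \<or> Polynomial.degree r < Polynomial.degree f)"
proof (induction "Polynomial.degree p" arbitrary: p rule: less_induct)
  case less
  show ?case
  proof (cases "p = 0 \<or> Polynomial.degree p < Polynomial.degree f")
    case True
    then show ?thesis using less.prems zero_polys
      by (intro exI[of _ 0] exI[of _ p]) auto
  next
    case False
    define c where "c = Polynomial.lead_coeff p / Polynomial.lead_coeff f"
    define k where "k = Polynomial.degree p - Polynomial.degree f"
    define p' where "p' = p - monom c k * f"
    have c: "c \<in> F" unfolding c_def using less.prems assms by (auto intro: divide_mem coeff_mem)
    have c0: "c \<noteq> 0" unfolding c_def using False assms by simp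
    have p': "p' \<in> polys" unfolding p'_def using c assms less.prems by (intro polys_mem)
    have deg: "Polynomial.degree (monom c k * f) = Polynomial.degree p"
      using c0 assms False by (simp add: degree_mult_eq degree_monom_eq k_def)
    have lc: "coeff (monom c k * f) (Polynomial.degree p) = Polynomial.lead_coeff p"
      using False assms by (simp add: coeff_monom_mult k_def c_def)
    have "Polynomial.degree p' < Polynomial.degree p" if "p' \<noteq> 0"
    proof -
      note that
      moreover have "Polynomial.degree p' \<le> Polynomial.degree p"
        unfolding p'_def using deg by (metis degree_diff_le order_refl)
      moreover have "coeff p' (Polynomial.degree p) = 0" unfolding p'_def using lc by simp
      ultimately show "Polynomial.degree p' < Polynomial.degree p"
        by (metis le_neq_implies_less leading_coeff_0_iff)
    qed
    then obtain q r where qr: "q \<in> polys" "r \<in> polys" "p' = f * q + r"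
        "r = 0 \<or> Polynomial.degree r < Polynomial.degree f"
      using less.hyps[OF _ p'] zero_polys by (cases "p' = 0") auto
    show ?thesis
      using qr c by (intro exI[of _ "q + monom c k"] exI[of _ r])
        (auto simp: p'_def algebra_simps intro: polys_mem)
  qed
qed

end

section \<open>Positive cones\<close>

definition cone_field :: "'a::field set \<Rightarrow> 'a set" where
  "cone_field P = {x. x = 0 \<or> x \<in> P \<or> - x \<in> P}"

text \<open>
  An ordering is given by its set of strictly positive elements. This set determines the
  ordered field as well, so that extensions of ordered fields within one ambient field are
  inclusions of cones, to which Zorn's lemma applies.
\<close>

locale pos_cone =
  fixes P :: "'a::field set"
  assumes one_pos: "1 \<in> P"
    and zero_not_pos: "0 \<notin> P"
    and add_pos: "\<And>x y. x \<in> P \<Longrightarrow> y \<in> P \<Longrightarrow> x + y \<in> P"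
    and mult_pos: "\<And>x y. x \<in> P \<Longrightarrow> y \<in> P \<Longrightarrow> x * y \<in> P"
    and inverse_pos: "\<And>x. x \<in> P \<Longrightarrow> inverse x \<in> P"
    and comparable: "\<And>x y. x \<in> P \<Longrightarrow> y \<in> P \<Longrightarrow> x = y \<or> x - y \<in> P \<or> y - x \<in> P"
begin

abbreviation "F \<equiv> cone_field P"

lemma pos_mem: "x \<in> P \<Longrightarrow> x \<in> F"
  by (simp add: cone_field_def)

lemma not_both: "x \<in> P \<Longrightarrow> - x \<in> P \<Longrightarrow> False"
  using add_pos[of x "- x"] zero_not_pos by simp

lemma add_F: assumes "x \<in> F" "y \<in> F" shows "x + y \<in> F"
proof -
  have 1: "u + v \<in> F" if "u \<in> P" "- v \<in> P" for u v
  proof -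
    have "- (u + v) \<in> P" if "- v - u \<in> P"
      using that by (metis minus_add_distrib add_uminus_conv_diff add.commute)
    then show ?thesis using comparable[OF that] unfolding cone_field_def
      by auto
  qed
  have 2: "u + v \<in> F" if "- u \<in> P" "- v \<in> P" for u v
    using add_pos[OF that] by (auto simp: cone_field_def add.commute)
  show ?thesis
    using assms 1 2 1[of y x] add_pos unfolding cone_field_def by (auto simp: add.commute)
qed

lemma mult_F: assumes "x \<in> F" "y \<in> F" shows "x * y \<in> F"
  using assms mult_pos[of x y] mult_pos[of "-x" y] mult_pos[of x "-y"] mult_pos[of "-x" "-y"]
  unfolding cone_field_def by auto

sublocale subfld F
proof
  show "1 \<in> F" by (rule pos_mem[OF one_pos])
  show "x + y \<in> F" if "x \<in> F" "y \<in> F" for x y using that by (rule add_F)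
  show "x * y \<in> F" if "x \<in> F" "y \<in> F" for x y using that by (rule mult_F)
  show "- x \<in> F" if "x \<in> F" for x using that by (auto simp: cone_field_def)
  show "inverse x \<in> F" if "x \<in> F" for x
    using that inverse_pos[of x] inverse_pos[of "- x"] by (auto simp: cone_field_def)
qed

lemma trichotomy: "x \<in> F \<Longrightarrow> x = 0 \<or> x \<in> P \<or> - x \<in> P"
  by (simp add: cone_field_def)

lemma square_pos: "x \<in> F \<Longrightarrow> x \<noteq> 0 \<Longrightarrow> x * x \<in> P"
  using mult_pos[of x x] mult_pos[of "-x" "-x"] by (auto simp: cone_field_def)

lemma of_nat_pos: "n > 0 \<Longrightarrow> of_nat n \<in> P"
proof (induction n)
  case (Suc n)
  then show ?case using add_pos[of 1 "of_nat n"] one_pos by (cases n) auto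
qed simp

lemma divide_pos: "x \<in> P \<Longrightarrow> y \<in> P \<Longrightarrow> x / y \<in> P"
  using mult_pos[of x "inverse y"] inverse_pos by (simp add: field_class.field_divide_inverse)

end

text \<open>
  A maximal extension \<open>T\<close> contains \<open>x\<close> or \<open>- x\<close> for every nonzero \<open>x\<close>. If \<open>- x\<close> is not in \<open>T\<close>,
  consider the elements \<open>t + x t'\<close>: they are closed under products because \<open>x\<^sup>2 \<in> T\<close>, and none
  is \<open>0\<close> because \<open>- x = t / t' = t t' (1 / t')\<^sup>2\<close> would lie in \<open>T\<close>. So \<open>x\<close> can be adjoined.
\<close>

lemma preordering_extends:
  assumes "subfld E" and "T \<subseteq> E"
    and add: "\<And>x y. x \<in> T \<Longrightarrow> y \<in> T \<Longrightarrow> x + y \<in> T"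
    and mult: "\<And>x y. x \<in> T \<Longrightarrow> y \<in> T \<Longrightarrow> x * y \<in> T"
    and sq: "\<And>x. x \<in> E \<Longrightarrow> x \<noteq> 0 \<Longrightarrow> x * x \<in> T"
    and zero: "0 \<notin> T"
  obtains P where "T \<subseteq> P" "pos_cone P" "cone_field P = E"
proof -
  interpret E: subfld E by fact
  define AA where "AA = {S. T \<subseteq> S \<and> S \<subseteq> E \<and> (\<forall>x\<in>S. \<forall>y\<in>S. x + y \<in> S \<and> x * y \<in> S) \<and> 0 \<notin> S}"
  have "\<exists>M\<in>AA. \<forall>Y\<in>AA. M \<subseteq> Y \<longrightarrow> Y = M"
  proof (rule subset_Zorn_nonempty)
    have "T \<in> AA" unfolding AA_def using \<open>T \<subseteq> E\<close> add mult zero by blast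
    then show "AA \<noteq> {}" by blast
  next
    fix CC assume C: "CC \<noteq> {}" "subset.chain AA CC"
    have sub: "CC \<subseteq> AA" using C(2) unfolding subset_chain_def by blast
    have tot: "S \<subseteq> Y \<or> Y \<subseteq> S" if "S \<in> CC" "Y \<in> CC" for S Y
      using C(2) that unfolding subset_chain_def by blast
    have "x + y \<in> \<Union>CC \<and> x * y \<in> \<Union>CC" if xy: "x \<in> \<Union>CC" "y \<in> \<Union>CC" for x y
    proof -
      obtain Z where "Z \<in> CC" "x \<in> Z" "y \<in> Z" using xy tot by blast
      then show ?thesis using sub unfolding AA_def by blast
    qed
    then show "\<Union>CC \<in> AA" using C(1) sub unfolding AA_def by blast
  qed
  then obtain M where M: "M \<in> AA" and max: "\<And>Y. Y \<in> AA \<Longrightarrow> M \<subseteq> Y \<Longrightarrow> Y = M" by blast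
  have TM: "T \<subseteq> M" and ME: "M \<subseteq> E" and M0: "0 \<notin> M"
    and Madd: "\<And>x y. x \<in> M \<Longrightarrow> y \<in> M \<Longrightarrow> x + y \<in> M"
    and Mmult: "\<And>x y. x \<in> M \<Longrightarrow> y \<in> M \<Longrightarrow> x * y \<in> M"
    using M by (auto simp: AA_def)
  have Msq: "x * x \<in> M" if "x \<in> E" "x \<noteq> 0" for x using sq[OF that] TM by blast
  have M1: "1 \<in> M" using Msq[of 1] E.one_mem by simp
  have Minv: "inverse x \<in> M" if "x \<in> M" for x
  proof -
    have x: "x \<noteq> 0" "x \<in> E" using that M0 ME by auto
    have "x * (inverse x * inverse x) \<in> M"
      using x that by (intro Mmult Msq E.inverse_mem) auto
    moreover have "x * (inverse x * inverse x) = inverse x" using x by simp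
    ultimately show ?thesis by simp
  qed
  have tri: "x \<in> M \<or> - x \<in> M" if x: "x \<in> E" "x \<noteq> 0" for x
  proof (rule disjCI)
    assume nx: "- x \<notin> M"
    define N where "N = insert 0 M"
    have Nadd: "s + t \<in> N" and Nmult: "s * t \<in> N" if "s \<in> N" "t \<in> N" for s t
      using that Madd Mmult by (auto simp: N_def)
    have Nsum0: "s = 0 \<and> t = 0" if "s \<in> N" "t \<in> N" "s + t = 0" for s t
      using that Madd[of s t] M0 by (auto simp: N_def)
    have Nx: "x * x \<in> N" using Msq x by (simp add: N_def)
    have key: "s = 0 \<and> t = 0" if st: "s \<in> N" "t \<in> N" "s + x * t = 0" for s t
    proof (cases "s = 0 \<or> t = 0")
      case True then show ?thesis using st(3) x by auto
    next
      case False
      then have "s \<in> M" "t \<in> M" using st by (auto simp: N_def)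
      have "- x = s * inverse t" 
      proof -
        have "- (x * t) = s" using st(3) by (simp add: add_eq_0_iff)
        then have "s * inverse t = - x * (t * inverse t)" by (simp add: mult.assoc[symmetric])
        then show ?thesis using False by simp
      qed
      moreover have "s * inverse t \<in> M" using \<open>s \<in> M\<close> \<open>t \<in> M\<close> by (intro Mmult Minv)
      ultimately show ?thesis using nx by simp
    qed
    define Y where "Y = {s + x * t | s t. s \<in> N \<and> t \<in> N \<and> (s \<noteq> 0 \<or> t \<noteq> 0)}"
    have inY: "s + x * t \<in> Y" if "s \<in> N" "t \<in> N" "s \<noteq> 0 \<or> t \<noteq> 0" for s t
      using that unfolding Y_def by blast
    have NE: "N \<subseteq> E" using ME E.zero_mem by (auto simp: N_def)
    have Y0: "0 \<notin> Y"
    proof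
      assume "0 \<in> Y"
      then obtain s t where "0 = s + x * t" "s \<in> N" "t \<in> N" "s \<noteq> 0 \<or> t \<noteq> 0"
        unfolding Y_def by blast
      then show False using key[of s t] by simp
    qed
    have MY: "M \<subseteq> Y"
    proof
      fix t assume "t \<in> M"
      then show "t \<in> Y" using inY[of t 0] M0 by (auto simp: N_def)
    qed
    have YE: "Y \<subseteq> E" using NE x by (auto simp: Y_def intro!: E.add_mem E.mult_mem)
    have Yadd: "u + v \<in> Y" if "u \<in> Y" "v \<in> Y" for u v
    proof -
      obtain s t where 1: "u = s + x * t" "s \<in> N" "t \<in> N" "s \<noteq> 0 \<or> t \<noteq> 0"
        using \<open>u \<in> Y\<close> unfolding Y_def by auto
      obtain s' t' where 2: "v = s' + x * t'" "s' \<in> N" "t' \<in> N"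
        using \<open>v \<in> Y\<close> unfolding Y_def by auto
      note st = 1 2
      have "(s + s') + x * (t + t') \<in> Y"
        using st Nsum0[of s s'] Nsum0[of t t'] Nadd by (intro inY) auto
      moreover have "(s + s') + x * (t + t') = u + v" using st by (simp add: algebra_simps)
      ultimately show ?thesis by simp
    qed
    have Ymult: "u * v \<in> Y" if "u \<in> Y" "v \<in> Y" for u v
    proof -
      obtain s t where 1: "u = s + x * t" "s \<in> N" "t \<in> N"
        using \<open>u \<in> Y\<close> unfolding Y_def by auto
      obtain s' t' where 2: "v = s' + x * t'" "s' \<in> N" "t' \<in> N"
        using \<open>v \<in> Y\<close> unfolding Y_def by auto
      note st = 1 2
      have nz: "u \<noteq> 0" "v \<noteq> 0" using that Y0 by auto
      have eq: "(s * s' + x * x * (t * t')) + x * (s * t' + t * s') = u * v"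
        using st by (simp add: algebra_simps)
      have "(s * s' + x * x * (t * t')) + x * (s * t' + t * s') \<in> Y"
      proof (rule inY)
        show "s * s' + x * x * (t * t') \<in> N"
          using st by (intro Nadd Nmult[OF Nx] Nmult[of s] Nmult[of t])
        show "s * t' + t * s' \<in> N" using st by (intro Nadd Nmult)
        have "u * v \<noteq> 0" using nz by simp
        then show "s * s' + x * x * (t * t') \<noteq> 0 \<or> s * t' + t * s' \<noteq> 0"
          unfolding eq[symmetric] by auto
      qed
      then show ?thesis using eq by simp
    qed
    have "Y \<in> AA" using TM MY YE Yadd Ymult Y0 by (auto simp: AA_def)
    then have "Y = M" using max MY by blast
    moreover have "x \<in> Y" using inY[of 0 1] M1 by (auto simp: N_def)
    ultimately show "x \<in> M" by simp
  qed
  have "pos_cone M"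
  proof
    show "x = y \<or> x - y \<in> M \<or> y - x \<in> M" if "x \<in> M" "y \<in> M" for x y
      using tri[of "x - y"] that ME E.diff_mem[of x y] by auto
  qed (use M1 M0 Madd Mmult Minv in auto)
  moreover have "cone_field M = E"
  proof
    show "cone_field M \<subseteq> E"
      using ME E.zero_mem E.uminus_mem by (fastforce simp: cone_field_def)
    show "E \<subseteq> cone_field M" using tri by (auto simp: cone_field_def)
  qed
  ultimately show thesis using that TM by blast
qed

section \<open>Maximal cones have the intermediate value property\<close>

text \<open>
  Gaussian elimination, in place of a dimension theory over a field that is only a set.
\<close>

lemma (in subfld) linear_dependence:
  fixes A :: "nat \<Rightarrow> nat \<Rightarrow> 'a"
  assumes "\<And>i j. A i j \<in> F"
  shows "\<exists>c. (\<forall>j. c j \<in> F) \<and> (\<exists>j\<le>n. c j \<noteq> 0) \<and> (\<forall>i<n. (\<Sum>j\<le>n. A i j * c j) = 0)"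
  using assms
proof (induction n arbitrary: A)
  case 0
  show ?case by (intro exI[of _ "\<lambda>_. 1"]) (auto intro: one_mem)
next
  case (Suc n)
  show ?case
  proof (cases "\<exists>i\<le>n. A i (Suc n) \<noteq> 0")
    case False
    then have "(\<Sum>j\<le>Suc n. A i j * (if j = Suc n then 1 else 0)) = 0" if "i < Suc n" for i
      using that by (intro sum.neutral) auto
    then show ?thesis
      by (intro exI[of _ "\<lambda>j. if j = Suc n then 1 else 0"]) (auto intro: zero_mem one_mem)
  next
    case True
    then obtain k where k: "k \<le> n" "A k (Suc n) \<noteq> 0" by blast
    \<comment> \<open>Move row \<open>k\<close> to the end and eliminate the last unknown from the others.\<close>
    define s where "s i = (if i = k then n else if i = n then k else i)" for i :: nat
    define B where "B i j = A (s i) j - A (s i) (Suc n) / A k (Suc n) * A k j" for i j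
    have B: "B i j \<in> F" for i j unfolding B_def using Suc.prems by (intro mem)
    obtain c where c: "\<And>j. c j \<in> F" "\<exists>j\<le>n. c j \<noteq> 0" "\<And>i. i < n \<Longrightarrow> (\<Sum>j\<le>n. B i j * c j) = 0"
      using Suc.IH[of B] B by blast
    define d where "d = - (\<Sum>j\<le>n. A k j * c j) / A k (Suc n)"
    have d: "d \<in> F" unfolding d_def using Suc.prems c by (intro mem sum_mem)
    define c' where "c' j = (if j = Suc n then d else c j)" for j
    have sum: "(\<Sum>j\<le>Suc n. A i j * c' j) = (\<Sum>j\<le>n. A i j * c j) + A i (Suc n) * d" for i
      by (simp add: c'_def)
    have rowk: "(\<Sum>j\<le>Suc n. A k j * c' j) = 0"
      using k by (simp only: sum d_def) simp
    have "(\<Sum>j\<le>Suc n. A i j * c' j) = 0" if i: "i < Suc n" for i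
    proof (cases "i = k")
      case True then show ?thesis using rowk by simp
    next
      case False
      have "s i < n \<or> i < n" and ss: "s (s i) = i" and "s i < n"
        using i False k by (auto simp: s_def split: if_splits)
      then have "0 = (\<Sum>j\<le>n. B (s i) j * c j)" using c by simp
      also have "\<dots> = (\<Sum>j\<le>n. A i j * c j) - A i (Suc n) / A k (Suc n) * (\<Sum>j\<le>n. A k j * c j)"
        by (simp add: B_def ss algebra_simps sum_subtractf sum_distrib_left)
      also have "\<dots> = (\<Sum>j\<le>Suc n. A i j * c' j)"
        unfolding sum d_def by simp
      finally show ?thesis by simp
    qed
    moreover have "\<exists>j\<le>Suc n. c' j \<noteq> 0"
    proof -
      obtain j where "j \<le> n" "c j \<noteq> 0" using c(2) by blast
      then show ?thesis by (intro exI[of _ j]) (auto simp: c'_def)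
    qed
    moreover have "\<And>j. c' j \<in> F" by (simp add: c'_def c d)
    ultimately show ?thesis by blast
  qed
qed

text \<open>
  Only extensions generated by one algebraic element are excluded: this suffices for the
  intermediate value property.
\<close>

definition maximal_cone :: "'a::field set \<Rightarrow> bool" where
  "maximal_cone P \<longleftrightarrow> (\<forall>\<alpha> p P'. p \<in> subfld.polys (cone_field P) \<and> p \<noteq> 0 \<and> poly p \<alpha> = 0 \<and>
     pos_cone P' \<and> P \<subseteq> P' \<and> cone_field P' = {poly f \<alpha> | f. f \<in> subfld.polys (cone_field P)}
     \<longrightarrow> P' = P)"

text \<open>
  Real closed fields enter all that follows only through the intermediate value property.
\<close>

locale real_closed_cone = pos_cone +
  assumes ivt: "\<And>p a b. p \<in> polys \<Longrightarrow> a \<in> F \<Longrightarrow> b \<in> F \<Longrightarrow> b - a \<in> P \<Longrightarrow>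
    - (poly p a * poly p b) \<in> P \<Longrightarrow> \<exists>c\<in>F. c - a \<in> P \<and> b - c \<in> P \<and> poly p c = 0"

text \<open>
  Without a notion of irreducibility over \<open>F\<close>, the polynomial \<open>p\<close> is taken of least degree
  among those vanishing at \<open>\<alpha>\<close>. Inverses come from Euclid's algorithm.
\<close>

lemma (in subfld) adjoin_root:
  fixes \<alpha> :: 'a
  assumes p: "p \<in> polys" "p \<noteq> 0" "poly p \<alpha> = 0"
    and min: "\<And>f. f \<in> polys \<Longrightarrow> f \<noteq> 0 \<Longrightarrow> poly f \<alpha> = 0 \<Longrightarrow> Polynomial.degree p \<le> Polynomial.degree f"
  shows "subfld {poly f \<alpha> | f. f \<in> polys}"
    and "\<And>f. f \<in> polys \<Longrightarrow> \<exists>g\<in>polys. poly g \<alpha> = poly f \<alpha> \<and> (g = 0 \<or> Polynomial.degree g < Polynomial.degree p)"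
    and "\<And>f. f \<in> polys \<Longrightarrow> poly f \<alpha> = 0 \<Longrightarrow> \<exists>h\<in>polys. f = p * h"
proof -
  show red: "\<exists>g\<in>polys. poly g \<alpha> = poly f \<alpha> \<and> (g = 0 \<or> Polynomial.degree g < Polynomial.degree p)"
    if "f \<in> polys" for f
    using division[OF p(1,2) that] p(3) by force
  show "\<exists>h\<in>polys. f = p * h" if f: "f \<in> polys" "poly f \<alpha> = 0" for f
  proof -
    obtain q r where qr: "q \<in> polys" "r \<in> polys" "f = p * q + r" "r = 0 \<or> Polynomial.degree r < Polynomial.degree p"
      using division[OF p(1,2) f(1)] by blast
    then have "poly r \<alpha> = 0" using f p by simp
    then have "r = 0" using min[of r] qr by fastforce
    then show ?thesis using qr by auto
  qed
  have inv: "\<exists>g\<in>polys. poly g \<alpha> * poly f \<alpha> = 1"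
    if "f \<in> polys" "f \<noteq> 0" "Polynomial.degree f < Polynomial.degree p" for f
    using that
  proof (induction "Polynomial.degree f" arbitrary: f rule: less_induct)
    case less
    have fa: "poly f \<alpha> \<noteq> 0" using min[of f] less.prems by fastforce
    show ?case
    proof (cases "Polynomial.degree f = 0")
      case True
      then obtain c where c: "f = [:c:]" using degree_eq_zeroE by blast
      then show ?thesis using less.prems fa zero_polys
        by (intro bexI[of _ "[:inverse c:]"]) (auto simp: pCons_polys_iff intro: inverse_mem)
    next
      case False
      obtain q r where qr: "q \<in> polys" "r \<in> polys" "p = f * q + r" "r = 0 \<or> Polynomial.degree r < Polynomial.degree f"
        using division[OF less.prems(1,2) p(1)] by blast
      have q0: "q \<noteq> 0" using qr less.prems by auto
      have r0: "r \<noteq> 0"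
      proof
        assume "r = 0"
        then have pq: "p = f * q" using qr by simp
        then have "Polynomial.degree q < Polynomial.degree p"
          using False less.prems q0 by (simp add: degree_mult_eq)
        moreover have "poly q \<alpha> = 0" using p(3) fa pq by simp
        ultimately show False using min[of q] q0 qr by simp
      qed
      then obtain g where g: "g \<in> polys" "poly g \<alpha> * poly r \<alpha> = 1"
        using less.hyps[of r] qr less.prems by auto
      have "poly r \<alpha> = - poly q \<alpha> * poly f \<alpha>" using p(3) qr(3) by (simp add: add_eq_0_iff mult.commute)
      then have "poly (- q * g) \<alpha> * poly f \<alpha> = 1" using g by (simp add: algebra_simps)
      then show ?thesis using g qr by (intro bexI[of _ "- q * g"]) (auto intro!: mult_polys uminus_polys)
    qed
  qed
  show "subfld {poly f \<alpha> | f. f \<in> polys}"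
  proof
    show "1 \<in> {poly f \<alpha> | f. f \<in> polys}" using one_polys by (intro CollectI exI[of _ 1]) auto
    fix x assume "x \<in> {poly f \<alpha> | f. f \<in> polys}"
    then obtain f where f: "f \<in> polys" "x = poly f \<alpha>" by blast
    show "- x \<in> {poly f \<alpha> | f. f \<in> polys}"
      using f by (intro CollectI exI[of _ "- f"]) (auto intro: uminus_polys)
    show "inverse x \<in> {poly f \<alpha> | f. f \<in> polys}"
    proof (cases "x = 0")
      case True then show ?thesis using zero_polys by (intro CollectI exI[of _ 0]) auto
    next
      case False
      obtain g where g: "g \<in> polys" "poly g \<alpha> = poly f \<alpha>" "g = 0 \<or> Polynomial.degree g < Polynomial.degree p"
        using red[OF f(1)] by blast
      then have "g \<noteq> 0" using False f by auto
      then obtain h where "h \<in> polys" "poly h \<alpha> * poly g \<alpha> = 1" using inv[of g] g by blast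
      then have "poly h \<alpha> = inverse x" using f g by (metis inverse_unique mult.commute)
      then show ?thesis using \<open>h \<in> polys\<close> by (intro CollectI exI[of _ h]) auto
    qed
    fix y assume "y \<in> {poly f \<alpha> | f. f \<in> polys}"
    then obtain g where g: "g \<in> polys" "y = poly g \<alpha>" by blast
    show "x + y \<in> {poly f \<alpha> | f. f \<in> polys}"
      using f g by (intro CollectI exI[of _ "f + g"]) (auto intro: add_polys)
    show "x * y \<in> {poly f \<alpha> | f. f \<in> polys}"
      using f g by (intro CollectI exI[of _ "f * g"]) (auto intro: mult_polys)
  qed
qed

text \<open>
  The nonzero elements form the least preordering of \<open>E\<close> that contains \<open>P\<close>, if \<open>- 1\<close> is not
  among them.
\<close>

inductive_set weighted_squares :: "'a::field set \<Rightarrow> 'a set \<Rightarrow> 'a set" for P E where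
  zero: "0 \<in> weighted_squares P E"
| step: "s \<in> weighted_squares P E \<Longrightarrow> c \<in> P \<Longrightarrow> y \<in> E \<Longrightarrow> s + c * (y * y) \<in> weighted_squares P E"

lemma weighted_squares_add:
  "t \<in> weighted_squares P E \<Longrightarrow> s \<in> weighted_squares P E \<Longrightarrow> s + t \<in> weighted_squares P E"
proof (induction rule: weighted_squares.induct)
  case (step t c y)
  then show ?case using weighted_squares.step[of "s + t" P E c y] by (simp add: add.assoc)
qed simp

lemma weighted_squares_mult:
  assumes "\<And>c d. c \<in> P \<Longrightarrow> d \<in> P \<Longrightarrow> c * d \<in> P" "\<And>x y. x \<in> E \<Longrightarrow> y \<in> E \<Longrightarrow> x * y \<in> E"
  shows "t \<in> weighted_squares P E \<Longrightarrow> s \<in> weighted_squares P E \<Longrightarrow> s * t \<in> weighted_squares P E"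
proof (induction rule: weighted_squares.induct)
  case (step t c y)
  have "s * (c * (y * y)) \<in> weighted_squares P E" using \<open>s \<in> weighted_squares P E\<close>
  proof (induction rule: weighted_squares.induct)
    case (step s d z)
    have "(s + d * (z * z)) * (c * (y * y)) = s * (c * (y * y)) + (d * c) * ((z * y) * (z * y))"
      by (simp add: algebra_simps)
    then show ?case
      using weighted_squares.step[OF step.IH, of "d * c" "z * y"] assms step.hyps \<open>c \<in> P\<close> \<open>y \<in> E\<close> by auto
  qed (simp add: weighted_squares.zero)
  then have "s * t + s * (c * (y * y)) \<in> weighted_squares P E"
    using step by (intro weighted_squares_add) auto
  then show ?case by (simp add: algebra_simps)
qed (simp add: weighted_squares.zero)

lemma (in pos_cone) extend_to_simple_extension:
  assumes E: "subfld E" "F \<subseteq> E" and neg: "- 1 \<notin> weighted_squares P E"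
  obtains P' where "pos_cone P'" "P \<subseteq> P'" "cone_field P' = E"
proof -
  interpret E: subfld E by fact
  define T where "T = weighted_squares P E - {0}"
  have WE: "s \<in> E" if "s \<in> weighted_squares P E" for s
    using that
  proof induction
    case zero
    show ?case by (rule E.zero_mem)
  next
    case (step s c y)
    then have "c \<in> E" using pos_mem \<open>F \<subseteq> E\<close> by blast
    then show ?case using step by (intro E.add_mem E.mult_mem)
  qed
  have sqW: "x * x \<in> weighted_squares P E" if "x \<in> E" for x
    using weighted_squares.step[OF weighted_squares.zero one_pos that] by simp
  have mulW: "s * t \<in> weighted_squares P E" if "s \<in> weighted_squares P E" "t \<in> weighted_squares P E" for s t
    using weighted_squares_mult[OF _ _ that(2,1)] mult_pos E.mult_mem by blast
  obtain P' where P': "T \<subseteq> P'" "pos_cone P'" "cone_field P' = E"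
  proof (rule preordering_extends[OF E(1), of T])
    show "T \<subseteq> E" using WE by (auto simp: T_def)
    show "0 \<notin> T" by (simp add: T_def)
    show "x * x \<in> T" if "x \<in> E" "x \<noteq> 0" for x using sqW that by (simp add: T_def)
    show "x * y \<in> T" if "x \<in> T" "y \<in> T" for x y using that mulW by (simp add: T_def)
    show "x + y \<in> T" if xy: "x \<in> T" "y \<in> T" for x y
    proof -
      have W: "x \<in> weighted_squares P E" "y \<in> weighted_squares P E" and "x \<noteq> 0" "y \<noteq> 0"
        using xy by (auto simp: T_def)
      have "x + y \<noteq> 0"
      proof
        assume "x + y = 0"
        then have "y = - x" by (simp add: add_eq_0_iff)
        then have "y * x * (inverse x * inverse x) = - ((x * inverse x) * (x * inverse x))"
          by (simp add: ac_simps)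
        then have "y * x * (inverse x * inverse x) = - 1" using \<open>x \<noteq> 0\<close> by simp
        moreover have "y * x * (inverse x * inverse x) \<in> weighted_squares P E"
          using W WE by (intro mulW sqW E.inverse_mem) auto
        ultimately show False using neg by simp
      qed
      then show ?thesis using weighted_squares_add[OF W(2,1)] by (simp add: T_def)
    qed
  qed blast
  have "P \<subseteq> T"
    using weighted_squares.step[OF weighted_squares.zero _ E.one_mem] zero_not_pos by (force simp: T_def)
  then show thesis using that P' by blast
qed

text \<open>
  A counterexample \<open>p\<close> of least degree cannot be factored, as one of the factors would change
  sign too. If \<open>\<alpha>\<close> is a root of \<open>p\<close>, then by maximality the field generated by \<open>\<alpha>\<close>, which is
  larger, carries no ordering extending the given one. Hence \<open>1 + G(\<alpha>) = 0\<close> for a weighted sum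
  of squares \<open>G\<close> of degree below \<open>2 * degree p\<close>, that is, \<open>1 + G = p * h\<close> with
  \<open>degree h < degree p\<close>. As \<open>1 + G\<close> is positive on the ordered field, \<open>h\<close> changes sign where
  \<open>p\<close> does, so \<open>h\<close> has a root in the field, at which \<open>1 + G\<close> vanishes: a contradiction.
\<close>

theorem maximal_cone_ivt:
  fixes P :: "'a::alg_closed_field set"
  assumes "pos_cone P" "maximal_cone P"
  shows "real_closed_cone P"
proof -
  interpret pos_cone P by fact
  let ?root = "\<lambda>p a b. \<exists>c\<in>F. c - a \<in> P \<and> b - c \<in> P \<and> poly p c = 0"
  have "p \<in> polys \<longrightarrow> (\<forall>a\<in>F. \<forall>b\<in>F. b - a \<in> P \<longrightarrow> - (poly p a * poly p b) \<in> P \<longrightarrow> ?root p a b)" for p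
  proof (induction "Polynomial.degree p" arbitrary: p rule: less_induct)
    case less
    have IH: "?root q a b" if "q \<in> polys" "Polynomial.degree q < Polynomial.degree p" "a \<in> F" "b \<in> F" "b - a \<in> P"
      "- (poly q a * poly q b) \<in> P" for q a b
      using less that by blast
    show ?case
    proof (intro impI ballI, rule ccontr)
      fix a b assume p: "p \<in> polys" and ab: "a \<in> F" "b \<in> F" "b - a \<in> P"
        and sc: "- (poly p a * poly p b) \<in> P" and nr: "\<not> ?root p a b"
      have pa: "poly p a \<noteq> 0" and pb: "poly p b \<noteq> 0" using sc zero_not_pos by auto
      then have p0: "p \<noteq> 0" by auto
      \<comment> \<open>A sign change of a product is a sign change of a factor.\<close>
      have prime: False if gh: "g \<in> polys" "h \<in> polys" "p = g * h"
        "Polynomial.degree g < Polynomial.degree p" "Polynomial.degree h < Polynomial.degree p" for g h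
      proof -
        define u where "u = poly g a * poly g b"
        define v where "v = poly h a * poly h b"
        have uv: "u \<in> F" "v \<in> F" unfolding u_def v_def using gh ab by (auto intro!: mult_mem poly_mem)
        have "- (u * v) \<in> P" using sc unfolding u_def v_def gh(3) by (simp add: ac_simps)
        then have "- u \<in> P \<or> - v \<in> P"
          using uv trichotomy[of u] trichotomy[of v] mult_pos[of u v] not_both[of "u * v"] zero_not_pos by auto
        then have "?root g a b \<or> ?root h a b"
          using IH[OF gh(1) gh(4) ab] IH[OF gh(2) gh(5) ab] by (auto simp: u_def v_def)
        then show False using nr gh(3) by auto
      qed
      have deg: "Polynomial.degree p > 0"
      proof (rule ccontr)
        assume "\<not> Polynomial.degree p > 0"
        then obtain c where c: "p = [:c:]" using degree_eq_zeroE by blast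
        have "c \<in> F" using p c by (simp add: pCons_polys_iff)
        then show False using sc c pa square_pos[of c] not_both[of "c * c"] by simp
      qed
      obtain \<alpha> where \<alpha>: "poly p \<alpha> = 0" using alg_closed_imp_poly_has_root[OF deg] by blast
      have min: "Polynomial.degree p \<le> Polynomial.degree f" if "f \<in> polys" "f \<noteq> 0" "poly f \<alpha> = 0" for f
      proof (rule ccontr)
        assume "\<not> Polynomial.degree p \<le> Polynomial.degree f"
        define d where "d = (LEAST d. \<exists>f\<in>polys. f \<noteq> 0 \<and> poly f \<alpha> = 0 \<and> Polynomial.degree f = d)"
        have ex: "\<exists>d. \<exists>f\<in>polys. f \<noteq> 0 \<and> poly f \<alpha> = 0 \<and> Polynomial.degree f = d" using that by blast
        obtain g where g: "g \<in> polys" "g \<noteq> 0" "poly g \<alpha> = 0" "Polynomial.degree g = d"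
          using LeastI_ex[OF ex] unfolding d_def by blast
        have gmin: "d \<le> Polynomial.degree f" if "f \<in> polys" "f \<noteq> 0" "poly f \<alpha> = 0" for f
          unfolding d_def using that by (intro Least_le) blast
        have dlt: "Polynomial.degree g < Polynomial.degree p"
          using gmin[OF that] g \<open>\<not> Polynomial.degree p \<le> Polynomial.degree f\<close> by simp
        have dpos: "Polynomial.degree g > 0"
        proof (rule ccontr)
          assume "\<not> Polynomial.degree g > 0"
          then obtain c where "g = [:c:]" using degree_eq_zeroE by blast
          then show False using g by simp
        qed
        obtain q r where qr: "q \<in> polys" "r \<in> polys" "p = g * q + r" "r = 0 \<or> Polynomial.degree r < Polynomial.degree g"
          using division[OF g(1,2) p] by blast
        have "poly r \<alpha> = 0" using \<alpha> g qr by simp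
        then have "r = 0" using gmin[of r] qr g by fastforce
        then have pq: "p = g * q" using qr by simp
        then have "q \<noteq> 0" using p0 by auto
        then have "Polynomial.degree q < Polynomial.degree p" using pq g dpos by (simp add: degree_mult_eq)
        then show False using prime[OF g(1) qr(1) pq dlt] by simp
      qed
      define E where "E = {poly f \<alpha> | f. f \<in> polys}"
      note adj = adjoin_root[OF p p0 \<alpha>, rule_format, OF min]
      have red: "\<exists>g\<in>polys. poly g \<alpha> = poly f \<alpha> \<and> (g = 0 \<or> Polynomial.degree g < Polynomial.degree p)"
        if "f \<in> polys" for f using that by (intro adj(2))
      have quot: "\<exists>h\<in>polys. f = p * h" if "f \<in> polys" "poly f \<alpha> = 0" for f
        using that by (intro adj(3))
      have subE: "subfld E" unfolding E_def by (rule adj(1))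
      have FE: "F \<subseteq> E"
      proof
        fix x assume "x \<in> F"
        then show "x \<in> E" unfolding E_def using zero_polys
          by (intro CollectI exI[of _ "[:x:]"]) (auto simp: pCons_polys_iff)
      qed
      have aE: "\<alpha> \<in> E" unfolding E_def using zero_polys zero_mem one_mem
        by (intro CollectI exI[of _ "[:0, 1:]"]) (auto simp: pCons_polys_iff)
      have aF: "\<alpha> \<notin> F"
      proof
        assume a: "\<alpha> \<in> F"
        then obtain q where q: "q \<in> polys" "p = [:- \<alpha>, 1:] * q" using root_factor[OF p a \<alpha>] by blast
        then have q0: "q \<noteq> 0" using p0 by auto
        show False
        proof (cases "Polynomial.degree q = 0")
          case False
          have "[:- \<alpha>, 1:] \<in> polys" using a zero_polys one_mem by (auto simp: pCons_polys_iff intro: uminus_mem)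
          moreover have "Polynomial.degree p = 1 + Polynomial.degree q"
            using q q0 by (simp only: q(2)) (subst degree_mult_eq, auto)
          ultimately show False using prime[OF _ q] False by simp
        next
          case True
          then obtain c where c: "q = [:c:]" using degree_eq_zeroE by blast
          then have c: "c \<noteq> 0" "c \<in> F" "\<And>x. poly p x = (x - \<alpha>) * c"
            using q0 q by (auto simp: pCons_polys_iff algebra_simps)
          define u v where "u = \<alpha> - a" and "v = b - \<alpha>"
          have uv: "u \<in> F" "v \<in> F" using a ab by (auto simp: u_def v_def intro: diff_mem)
          have "u * v * (c * c) \<in> P" using sc unfolding c(3) u_def v_def by (simp add: algebra_simps)
          then have "u * v * (c * c) * inverse (c * c) \<in> P"
            using square_pos[OF c(2,1)] inverse_pos mult_pos by blast
          moreover have "u * v * (c * c) * inverse (c * c) = u * v"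
            using c(1) right_inverse[of "c * c"] by (simp only: mult.assoc[of "u * v"]) simp
          ultimately have uvP: "u * v \<in> P" by metis
          have "u + v \<in> P" using ab by (simp add: u_def v_def)
          have "u \<in> P \<and> v \<in> P"
          proof (rule ccontr)
            assume "\<not> ?thesis"
            then have "- u \<in> P \<and> - v \<in> P"
              using uvP uv trichotomy[of u] trichotomy[of v] mult_pos[of "-u" v] mult_pos[of u "-v"] not_both[of "u * v"] zero_not_pos
              by auto
            then have "- u + - v \<in> P" using add_pos by blast
            then have "- (u + v) \<in> P" by (metis minus_add_distrib)
            then show False using not_both[OF \<open>u + v \<in> P\<close>] by simp
          qed
          then show False using nr a \<alpha> by (auto simp: u_def v_def)
        qed
      qed
      have "- 1 \<notin> weighted_squares P E"
      proof
        assume W: "- 1 \<in> weighted_squares P E"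
        \<comment> \<open>Reduced modulo \<open>p\<close>, the squared elements have degree below \<open>degree p\<close>.\<close>
        have repr: "\<exists>G\<in>polys. poly G \<alpha> = s \<and> (G = 0 \<or> Polynomial.degree G < 2 * Polynomial.degree p) \<and>
            (\<forall>x\<in>F. poly G x = 0 \<or> poly G x \<in> P)" if "s \<in> weighted_squares P E" for s
          using that
        proof induction
          case zero
          then show ?case using zero_polys by (intro bexI[of _ 0]) auto
        next
          case (step s c y)
          then obtain G where G: "G \<in> polys" "poly G \<alpha> = s" "Polynomial.degree G < 2 * Polynomial.degree p"
            "\<And>x. x \<in> F \<Longrightarrow> poly G x = 0 \<or> poly G x \<in> P" using deg by auto
          obtain g0 where "g0 \<in> polys" "y = poly g0 \<alpha>" using \<open>y \<in> E\<close> unfolding E_def by blast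
          then obtain g where g: "g \<in> polys" "poly g \<alpha> = y" "g = 0 \<or> Polynomial.degree g < Polynomial.degree p"
            using red by metis
          have "Polynomial.degree (smult c (g * g)) < 2 * Polynomial.degree p"
          proof -
            have "Polynomial.degree g < Polynomial.degree p" using g(3) deg by auto
            then show ?thesis using degree_smult_le[of c "g * g"] degree_mult_le[of g g] by linarith
          qed
          then have "Polynomial.degree (G + smult c (g * g)) < 2 * Polynomial.degree p"
            using G(3) by (rule degree_add_less[rotated])
          moreover have "poly (G + smult c (g * g)) x = 0 \<or> poly (G + smult c (g * g)) x \<in> P" if "x \<in> F" for x
          proof -
            have "poly g x \<in> F" using g that by (intro poly_mem)
            then have "c * (poly g x * poly g x) = 0 \<or> c * (poly g x * poly g x) \<in> P"
              using square_pos[of "poly g x"] mult_pos[OF \<open>c \<in> P\<close>] by auto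
            then show ?thesis using G(4)[OF that] add_pos by auto
          qed
          moreover have "G + smult c (g * g) \<in> polys"
            using G g step.hyps pos_mem by (intro polys_mem) auto
          ultimately show ?case using G g
            by (intro bexI[of _ "G + smult c (g * g)"]) auto
        qed
        obtain G where G: "G \<in> polys" "poly G \<alpha> = - 1" "G = 0 \<or> Polynomial.degree G < 2 * Polynomial.degree p"
          "\<And>x. x \<in> F \<Longrightarrow> poly G x = 0 \<or> poly G x \<in> P" using repr[OF W] by blast
        have pos: "poly (1 + G) x \<in> P" if "x \<in> F" for x
          using G(4)[OF that] one_pos add_pos[OF one_pos, of "poly G x"] by auto
        have "1 + G \<in> polys" using G one_polys by (intro add_polys)
        then have "\<exists>h\<in>polys. 1 + G = p * h" by (rule quot) (simp add: G(2))
        then obtain h where h: "h \<in> polys" "1 + G = p * h" by blast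
        have h0: "h \<noteq> 0"
        proof
          assume "h = 0"
          then show False using pos[of 0] h zero_mem zero_not_pos by simp
        qed
        have "Polynomial.degree (1 + G) < 2 * Polynomial.degree p"
          using G(3) deg by (intro degree_add_less) auto
        then have hdeg: "Polynomial.degree h < Polynomial.degree p"
          using h p0 h0 by (simp add: degree_mult_eq)
        define u v where "u = poly (1 + G) a * poly (1 + G) b" and "v = poly p a * poly p b"
        have "u \<in> P" unfolding u_def using pos ab by (intro mult_pos)
        have v: "- v \<in> P" "v \<noteq> 0" using sc pa pb by (auto simp: v_def)
        have "poly h a * poly h b = u * inverse v"
          unfolding u_def v_def h(2) using pa pb by (simp add: field_simps)
        then have "- (poly h a * poly h b) = u * inverse (- v)" using v by simp
        moreover have "u * inverse (- v) \<in> P" by (intro mult_pos inverse_pos \<open>u \<in> P\<close> v(1))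
        ultimately have "- (poly h a * poly h b) \<in> P" by metis
        then obtain c where "c \<in> F" "poly h c = 0" using IH[OF h(1) hdeg ab] by blast
        then show False using pos[of c] h zero_not_pos by simp
      qed
      then obtain P' where P': "pos_cone P'" "P \<subseteq> P'" "cone_field P' = E"
        using extend_to_simple_extension[OF subE FE] by blast
      then have "P' = P"
        using assms(2) p p0 \<alpha> unfolding maximal_cone_def E_def by blast
      then show False using P' aE aF by simp
    qed
  qed
  then show ?thesis by unfold_locales blast
qed

section \<open>Signs and Rolle's theorem over ordered fields\<close>

definition sg :: "'a::field set \<Rightarrow> 'a \<Rightarrow> int" where
  "sg P x = (if x \<in> P then 1 else if - x \<in> P then - 1 else 0)"

context pos_cone
begin

lemma sg_eq_1_iff: "sg P x = 1 \<longleftrightarrow> x \<in> P"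
  by (simp add: sg_def)

lemma sg_eq_neg_iff: "sg P x = - 1 \<longleftrightarrow> - x \<in> P"
  using not_both[of x] by (auto simp: sg_def)

lemma sg_0: "sg P 0 = 0"
  using zero_not_pos by (simp add: sg_def)

lemma sg_eq_0_iff: "x \<in> F \<Longrightarrow> sg P x = 0 \<longleftrightarrow> x = 0"
  using trichotomy[of x] zero_not_pos by (auto simp: sg_def)

lemma sg_uminus: "sg P (- x) = - sg P x"
  using not_both[of x] by (auto simp: sg_def)

lemma sg_mult_pos: assumes "c \<in> P" shows "sg P (c * x) = sg P x"
proof -
  have 1: "c * y \<in> P \<longleftrightarrow> y \<in> P" for y
  proof
    assume "c * y \<in> P"
    then have "inverse c * (c * y) \<in> P" by (rule mult_pos[OF inverse_pos[OF assms]])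
    moreover have "inverse c * (c * y) = y"
      using assms zero_not_pos by (cases "c = 0") (auto simp: mult.assoc[symmetric])
    ultimately show "y \<in> P" by simp
  qed (rule mult_pos[OF assms])
  show ?thesis using 1[of x] 1[of "- x"] by (simp add: sg_def)
qed

lemma sg_cases: "sg P x = 1 \<or> sg P x = - 1 \<or> sg P x = 0"
  by (simp add: sg_def)

lemma sg_swap: "sg P (x - y) = - sg P (y - x)"
  using sg_uminus[of "y - x"] by simp

abbreviation less :: "'a \<Rightarrow> 'a \<Rightarrow> bool" (infix "\<prec>" 50) where "x \<prec> y \<equiv> y - x \<in> P"

lemma less_trans: "x \<prec> y \<Longrightarrow> y \<prec> z \<Longrightarrow> x \<prec> z"
  using add_pos[of "y - x" "z - y"] by simp

lemma less_irrefl: "\<not> x \<prec> x"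
  using zero_not_pos by simp

lemma less_asym: "x \<prec> y \<Longrightarrow> \<not> y \<prec> x"
  using less_trans less_irrefl by blast

lemma less_cases: "x \<in> F \<Longrightarrow> y \<in> F \<Longrightarrow> x = y \<or> x \<prec> y \<or> y \<prec> x"
  using trichotomy[OF diff_mem[of y x]] by auto

lemma exists_max: "finite A \<Longrightarrow> A \<noteq> {} \<Longrightarrow> A \<subseteq> F \<Longrightarrow> \<exists>m\<in>A. \<forall>x\<in>A. x = m \<or> x \<prec> m"
proof (induction rule: finite_ne_induct)
  case (insert a A)
  then obtain m where m: "m \<in> A" "\<forall>x\<in>A. x = m \<or> x \<prec> m" by auto
  have "m = a \<or> m \<prec> a \<or> a \<prec> m" using less_cases insert.prems m by blast
  then show ?case
  proof (elim disjE)
    assume "m = a" then show ?thesis using m by (intro bexI[of _ m]) auto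
  next
    assume ma: "m \<prec> a"
    have "x \<prec> a" if "x \<in> A" for x using m(2) that ma less_trans[of m x a] by metis
    then show ?thesis by blast
  next
    assume "a \<prec> m" then show ?thesis using m by (intro bexI[of _ m]) auto
  qed
qed auto

lemma exists_min: assumes "finite A" "A \<noteq> {}" "A \<subseteq> F" shows "\<exists>m\<in>A. \<forall>x\<in>A. x = m \<or> m \<prec> x"
proof -
  have "\<exists>m\<in>uminus ` A. \<forall>x\<in>uminus ` A. x = m \<or> x \<prec> m"
    using assms uminus_mem by (intro exists_max) auto
  then show ?thesis by auto
qed

lemma two_pos: "1 + 1 \<in> P"
  by (intro add_pos one_pos)

lemma dense: assumes "x \<prec> y" "x \<in> F" "y \<in> F" shows "\<exists>z\<in>F. x \<prec> z \<and> z \<prec> y"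
proof -
  have nz: "(1::'a) + 1 \<noteq> 0" using two_pos zero_not_pos by auto
  define d where "d = (y - x) / (1 + 1)"
  have d: "d \<in> P" unfolding d_def using assms two_pos by (intro divide_pos)
  have "d + d = y - x" unfolding d_def using nz
    by (metis (no_types, lifting) add_divide_distrib distrib_left mult.right_neutral nonzero_mult_div_cancel_right)
  then have "y - (x + d) = d" by (metis add_diff_cancel_right' diff_diff_add)
  then have "x + d \<prec> y" using d by metis
  moreover have "x \<prec> x + d" using d by simp
  ultimately show ?thesis using add_mem[OF assms(2) pos_mem[OF d]] by blast
qed

lemma separate:
  assumes "finite A" "finite B" "A \<subseteq> F" "B \<subseteq> F" "\<And>a b. a \<in> A \<Longrightarrow> b \<in> B \<Longrightarrow> a \<prec> b"
  shows "\<exists>y\<in>F. (\<forall>a\<in>A. a \<prec> y) \<and> (\<forall>b\<in>B. y \<prec> b)"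
proof -
  have up: "\<exists>y\<in>F. \<forall>a\<in>A. a \<prec> y" if ne: "A \<noteq> {}"
  proof -
    obtain m where m: "m \<in> A" "\<forall>x\<in>A. x = m \<or> x \<prec> m" using exists_max[of A] assms(1,3) ne by blast
    have "m \<prec> m + 1" using one_pos by simp
    then have "a \<prec> m + 1" if "a \<in> A" for a using m(2) that less_trans[of m a "m + 1"] by metis
    moreover have "m + 1 \<in> F" using m(1) assms(3) one_mem by (blast intro: add_mem)
    ultimately show ?thesis by blast
  qed
  have down: "\<exists>y\<in>F. \<forall>b\<in>B. y \<prec> b" if ne: "B \<noteq> {}"
  proof -
    obtain m where m: "m \<in> B" "\<forall>x\<in>B. x = m \<or> m \<prec> x" using exists_min[of B] assms(2,4) ne by blast
    have "m - 1 \<prec> m" using one_pos by simp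
    then have "m - 1 \<prec> b" if "b \<in> B" for b using m(2) that less_trans[of m "m - 1" b] by metis
    moreover have "m - 1 \<in> F" using m(1) assms(4) one_mem by (blast intro: diff_mem)
    ultimately show ?thesis by blast
  qed
  show ?thesis
  proof (cases "A = {} \<or> B = {}")
    case True
    then show ?thesis using up down zero_mem by (cases "A = {}"; cases "B = {}") auto
  next
    case False
    obtain a where a: "a \<in> A" "\<forall>x\<in>A. x = a \<or> x \<prec> a" using exists_max[of A] assms(1,3) False by blast
    obtain b where b: "b \<in> B" "\<forall>x\<in>B. x = b \<or> b \<prec> x" using exists_min[of B] assms(2,4) False by blast
    obtain y where "y \<in> F" "a \<prec> y" "y \<prec> b" using dense[OF assms(5)[OF a(1) b(1)]] assms(3,4) a(1) b(1) by blast
    moreover have "a' \<prec> y" if "a' \<in> A" for a' using a(2) that \<open>a \<prec> y\<close> less_trans[of a a' y] by metis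
    moreover have "y \<prec> b'" if "b' \<in> B" for b' using b(2) that \<open>y \<prec> b\<close> less_trans[of b y b'] by metis
    ultimately show ?thesis by blast
  qed
qed

lemma upper_bound: assumes "u \<in> F" "v \<in> F" shows "\<exists>m\<in>F. u \<prec> m \<and> v \<prec> m"
  using separate[of "{u, v}" "{}"] assms by auto

lemma of_nat_neq_0: "n > 0 \<Longrightarrow> (of_nat n :: 'a) \<noteq> 0"
  using of_nat_pos[of n] zero_not_pos by auto

text \<open>
  The bound \<open>\<delta>\<close> away from \<open>0\<close> is what makes the induction over the coefficients work.
\<close>

lemma eventually_pos:
  "p \<in> polys \<Longrightarrow> Polynomial.lead_coeff p \<in> P \<Longrightarrow> \<exists>M\<in>F. \<exists>\<delta>\<in>P. \<forall>x\<in>F. M \<prec> x \<longrightarrow> \<delta> \<prec> poly p x"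
proof (induction p)
  case 0
  then show ?case using zero_not_pos by simp
next
  case (pCons a q)
  show ?case
  proof (cases "q = 0")
    case True
    then have aP: "a \<in> P" using pCons.prems by simp
    then obtain \<delta> where "0 \<prec> \<delta>" "\<delta> \<prec> a" using dense[of a 0] pos_mem zero_mem by auto
    then show ?thesis using True zero_mem by (intro bexI[of _ 0] bexI[of _ \<delta>]) auto
  next
    case False
    have q: "q \<in> polys" "a \<in> F" using pCons.prems by (auto simp: pCons_polys_iff)
    obtain M \<delta> where M: "M \<in> F" "\<delta> \<in> P" "\<And>x. x \<in> F \<Longrightarrow> M \<prec> x \<Longrightarrow> \<delta> \<prec> poly q x"
      using pCons.IH q pCons.prems False by auto
    have d: "\<delta> \<in> F" "\<delta> \<noteq> 0" using M pos_mem zero_not_pos by auto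
    obtain M' where M': "M' \<in> F" "M \<prec> M'" "0 \<prec> M'"
      using upper_bound[OF M(1) zero_mem] by blast
    obtain N where N: "N \<in> F" "M' \<prec> N" "(1 - a) / \<delta> \<prec> N"
      using upper_bound[of M' "(1 - a) / \<delta>"] M' q d one_mem by (auto intro: divide_mem diff_mem)
    have "1 \<prec> poly (pCons a q) x" if x: "x \<in> F" "N \<prec> x" for x
    proof -
      have x0: "x \<in> P" using less_trans[OF less_trans[OF M'(3) N(2)] x(2)] by simp
      have "\<delta> \<prec> poly q x" using M(3)[OF x(1)] less_trans[OF less_trans[OF M'(2) N(2)] x(2)] by blast
      then have xq: "x * (poly q x - \<delta>) \<in> P" using x0 by (intro mult_pos)
      have "\<delta> * (x - (1 - a) / \<delta>) \<in> P"
        using M(2) less_trans[OF N(3) x(2)] by (intro mult_pos)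
      moreover have "\<delta> * ((1 - a) / \<delta>) = 1 - a" using d by simp
      ultimately have "\<delta> * x - (1 - a) \<in> P" by (metis right_diff_distrib)
      then have "x * (poly q x - \<delta>) + (\<delta> * x - (1 - a)) \<in> P" by (rule add_pos[OF xq])
      then show ?thesis by (simp add: algebra_simps)
    qed
    then show ?thesis using N(1) one_pos by blast
  qed
qed

end

lemma (in subfld) split_multiplicity:
  assumes "a \<in> F"
  shows "p \<in> polys \<Longrightarrow> p \<noteq> 0 \<Longrightarrow> \<exists>m q. q \<in> polys \<and> p = [:- a, 1:] ^ m * q \<and> poly q a \<noteq> 0"
proof (induction "Polynomial.degree p" arbitrary: p rule: less_induct)
  case less
  show ?case
  proof (cases "poly p a = 0")
    case False
    then show ?thesis using less.prems by (intro exI[of _ 0] exI[of _ p]) auto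
  next
    case True
    then obtain q where q: "q \<in> polys" "p = [:- a, 1:] * q"
      using root_factor less.prems assms by blast
    then have "q \<noteq> 0" using less.prems by auto
    moreover have "Polynomial.degree p = 1 + Polynomial.degree q"
      unfolding q(2) using \<open>q \<noteq> 0\<close> by (subst degree_mult_eq) auto
    ultimately obtain m r where "r \<in> polys" "q = [:- a, 1:] ^ m * r" "poly r a \<noteq> 0"
      using less.hyps[of q] q by auto
    moreover from this have "p = [:- a, 1:] ^ Suc m * r"
      unfolding q(2) by (simp only: power_Suc mult.assoc)
    ultimately show ?thesis by blast
  qed
qed

context real_closed_cone
begin

text \<open>
  Write \<open>p = (x - a)\<^sup>m (x - b)\<^sup>n s\<close> with \<open>s\<close> nonzero at \<open>a\<close> and \<open>b\<close>. Then \<open>p'\<close> is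
  \<open>(x - a)\<^sup>m\<^sup>-\<^sup>1 (x - b)\<^sup>n\<^sup>-\<^sup>1 t\<close> with \<open>t(a) t(b) = - m n (b - a)\<^sup>2 s(a) s(b)\<close>. If \<open>s\<close> has the
  same sign at \<open>a\<close> and \<open>b\<close>, then \<open>t\<close> has a root between them. Otherwise \<open>s\<close> has a root \<open>c\<close>
  there, and fewer roots of \<open>p\<close> lie between \<open>a\<close> and \<open>c\<close>.
\<close>

lemma rolle:
  assumes "p \<in> polys" "p \<noteq> 0" "a \<in> F"
  shows "b \<in> F \<Longrightarrow> a \<prec> b \<Longrightarrow> poly p a = 0 \<Longrightarrow> poly p b = 0 \<Longrightarrow>
    \<exists>c\<in>F. a \<prec> c \<and> c \<prec> b \<and> poly (pderiv p) c = 0"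
proof (induction "card {x. poly p x = 0 \<and> a \<prec> x \<and> x \<prec> b}" arbitrary: b rule: less_induct)
  case (less b)
  have ab: "a \<noteq> b" using less.prems less_irrefl by blast
  obtain m q where q: "q \<in> polys" "p = [:- a, 1:] ^ m * q" "poly q a \<noteq> 0"
    using split_multiplicity[OF assms(3,1,2)] by blast
  have "q \<noteq> 0" using q assms by auto
  then obtain n s where s: "s \<in> polys" "q = [:- b, 1:] ^ n * s" "poly s b \<noteq> 0"
    using split_multiplicity[OF less.prems(1) q(1)] by blast
  have sa: "poly s a \<noteq> 0" using q(3) s(2) by auto
  have "m \<noteq> 0" using q less.prems by (cases m) auto
  then obtain m' where m': "m = Suc m'" by (cases m) auto
  have "n \<noteq> 0" using q s less.prems ab by (cases n) auto
  then obtain n' where n': "n = Suc n'" by (cases n) auto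
  define A B where "A = [:- a, 1:]" and "B = [:- b, 1:]"
  have AB: "pderiv A = 1" "pderiv B = 1" "\<And>x. poly A x = x - a" "\<And>x. poly B x = x - b"
    by (simp_all add: A_def B_def pderiv_pCons one_pCons)
  define t where "t = smult (of_nat m) (B * s) + smult (of_nat n) (A * s) + A * B * pderiv s"
  have deriv: "poly (pderiv p) x = (x - a) ^ m' * (x - b) ^ n' * poly t x" for x
    unfolding q(2) s(2) t_def m' n' A_def[symmetric] B_def[symmetric]
    by (simp only: pderiv_mult pderiv_power_Suc AB(1,2)) (simp add: AB(3,4)[symmetric] algebra_simps)
  have lin: "[:- c, 1:] \<in> polys" if "c \<in> F" for c
    using that zero_polys one_mem by (auto simp: pCons_polys_iff intro: uminus_mem)
  have t: "t \<in> polys" unfolding t_def A_def B_def using less.prems s assms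
    by (intro polys_mem lin of_nat_mem)
  have ta: "poly t a = of_nat m * (a - b) * poly s a" and tb: "poly t b = of_nat n * (b - a) * poly s b"
    by (simp_all add: t_def AB)
  have sF: "poly s a \<in> F" "poly s b \<in> F" using s assms less.prems by (auto intro: poly_mem)
  have "poly s a * poly s b \<in> P \<or> - (poly s a * poly s b) \<in> P"
    using trichotomy[OF mult_mem[OF sF]] sa s(3) by auto
  then show ?case
  proof
    assume pos: "poly s a * poly s b \<in> P"
    have mn: "of_nat m \<in> P" "of_nat n \<in> P" using m' n' by (auto intro!: of_nat_pos simp del: of_nat_Suc)
    have "of_nat m * of_nat n * ((b - a) * (b - a)) * (poly s a * poly s b) \<in> P"
      by (rule mult_pos[OF mult_pos[OF mult_pos[OF mn] mult_pos[OF less.prems(2,2)]] pos])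
    then have "- (poly t a * poly t b) \<in> P" unfolding ta tb by (simp add: algebra_simps)
    then obtain c where "c \<in> F" "a \<prec> c" "c \<prec> b" "poly t c = 0"
      using ivt[OF t assms(3) less.prems(1,2)] by blast
    then show ?thesis using deriv by (intro bexI[of _ c]) auto
  next
    assume "- (poly s a * poly s b) \<in> P"
    then obtain c where c: "c \<in> F" "a \<prec> c" "c \<prec> b" "poly s c = 0"
      using ivt[OF s(1) assms(3) less.prems(1,2)] by blast
    have pc: "poly p c = 0" using c q s by simp
    have "card {x. poly p x = 0 \<and> a \<prec> x \<and> x \<prec> c} < card {x. poly p x = 0 \<and> a \<prec> x \<and> x \<prec> b}"
    proof (rule psubset_card_mono)
      show "finite {x. poly p x = 0 \<and> a \<prec> x \<and> x \<prec> b}"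
        using poly_roots_finite[OF assms(2)] by simp
      show "{x. poly p x = 0 \<and> a \<prec> x \<and> x \<prec> c} \<subset> {x. poly p x = 0 \<and> a \<prec> x \<and> x \<prec> b}"
        using c pc less_trans less_irrefl by blast
    qed
    then obtain d where "d \<in> F" "a \<prec> d" "d \<prec> c" "poly (pderiv p) d = 0"
      using less.hyps[of c] c pc less.prems by blast
    then show ?thesis using c less_trans by blast
  qed
qed

lemma mean_value:
  assumes "p \<in> polys" "a \<in> F" "b \<in> F" "a \<prec> b"
  shows "\<exists>c\<in>F. a \<prec> c \<and> c \<prec> b \<and> poly p b - poly p a = poly (pderiv p) c * (b - a)"
proof -
  define k where "k = (poly p b - poly p a) / (b - a)"
  have ba: "b - a \<noteq> 0" using assms(4) zero_not_pos by metis
  define g where "g = p - [:poly p a - k * a, k:]"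
  have kF: "k \<in> F" unfolding k_def using assms by (intro divide_mem diff_mem poly_mem)
  have g: "g \<in> polys" unfolding g_def using assms kF zero_polys
    by (auto simp: pCons_polys_iff intro!: diff_polys diff_mem mult_mem poly_mem)
  have "k * (b - a) = poly p b - poly p a" unfolding k_def using ba by simp
  then have k: "poly p b - poly p a = k * (b - a)" by simp
  then have gab: "poly g a = 0" "poly g b = 0" by (simp_all add: g_def algebra_simps)
  have "pderiv g = pderiv p - [:k:]" by (simp add: g_def pderiv_diff pderiv_pCons)
  moreover have "\<exists>c\<in>F. a \<prec> c \<and> c \<prec> b \<and> poly (pderiv g) c = 0"
  proof (cases "g = 0")
    case True
    then show ?thesis using dense[OF assms(4,2,3)] by auto
  next
    case False
    then show ?thesis using rolle[OF g] gab assms by blast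
  qed
  ultimately show ?thesis unfolding k by auto
qed

lemma deriv_pos_increasing:
  assumes "p \<in> polys" "a \<in> F" "b \<in> F" "a \<prec> b"
    "\<And>x. x \<in> F \<Longrightarrow> a \<prec> x \<Longrightarrow> x \<prec> b \<Longrightarrow> poly (pderiv p) x \<in> P"
  shows "poly p a \<prec> poly p b"
  using mean_value[OF assms(1-4)] assms(4,5) mult_pos by metis

text \<open>
  Far to the right, \<open>p'\<close> has the sign of its leading coefficient, a positive multiple of that
  of \<open>p\<close>. So the latter is positive, and \<open>p\<close> is eventually positive as well.
\<close>

lemma unbounded_above:
  assumes p: "p \<in> polys" "a \<in> F" and pos: "\<And>x. x \<in> F \<Longrightarrow> a \<prec> x \<Longrightarrow> poly (pderiv p) x \<in> P"
  shows "\<exists>x\<in>F. a \<prec> x \<and> poly p x \<in> P"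
proof -
  obtain a1 where a1: "a1 \<in> F" "a \<prec> a1" using upper_bound[OF p(2,2)] by blast
  have "pderiv p \<noteq> 0" using pos[OF a1] zero_not_pos by auto
  define n where "n = Polynomial.degree p"
  have n: "n > 0" using \<open>pderiv p \<noteq> 0\<close> by (metis degree_eq_zeroE gr0I n_def pderiv_0 pderiv_pCons add_0 pCons_0_0)
  have lc: "coeff (pderiv p) (n - 1) = of_nat n * Polynomial.lead_coeff p"
    using n by (simp add: coeff_pderiv n_def)
  have lc0: "Polynomial.lead_coeff p \<noteq> 0" using n by (auto simp: n_def)
  have "coeff (pderiv p) (n - 1) \<noteq> 0" unfolding lc using of_nat_neq_0[OF n] lc0 by simp
  moreover have "Polynomial.degree (pderiv p) \<le> n - 1"
    by (rule degree_le) (auto simp: coeff_pderiv n_def coeff_eq_0)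
  ultimately have dn: "Polynomial.degree (pderiv p) = n - 1" by (meson le_antisym le_degree)
  have ex: "\<exists>x\<in>F. a \<prec> x \<and> poly q x \<in> P" if q: "q \<in> polys" "Polynomial.lead_coeff q \<in> P" for q
  proof -
    obtain M \<delta> where M: "M \<in> F" "\<delta> \<in> P" "\<And>x. x \<in> F \<Longrightarrow> M \<prec> x \<Longrightarrow> \<delta> \<prec> poly q x"
      using eventually_pos[OF q] by blast
    obtain x where x: "x \<in> F" "a \<prec> x" "M \<prec> x" using upper_bound[OF p(2) M(1)] by blast
    have "0 \<prec> poly q x" using less_trans[of \<delta> 0 "poly q x"] M x by simp
    then show ?thesis using x by auto
  qed
  have "Polynomial.lead_coeff p \<in> P"
  proof (rule ccontr)
    assume "Polynomial.lead_coeff p \<notin> P"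
    then have "- Polynomial.lead_coeff p \<in> P" using trichotomy[OF coeff_mem[OF p(1)]] lc0 by blast
    then have "of_nat n * - Polynomial.lead_coeff p \<in> P" using of_nat_pos[OF n] by (intro mult_pos)
    then have "Polynomial.lead_coeff (- pderiv p) \<in> P" using dn lc by simp
    then obtain x where "x \<in> F" "a \<prec> x" "poly (- pderiv p) x \<in> P"
      using ex[of "- pderiv p"] p by (auto intro: uminus_polys pderiv_polys)
    then show False using pos[of x] not_both[of "poly (pderiv p) x"] by simp
  qed
  then show ?thesis using ex[OF p(1)] by blast
qed

lemma unbounded_below:
  assumes p: "p \<in> polys" "a \<in> F" and pos: "\<And>x. x \<in> F \<Longrightarrow> x \<prec> a \<Longrightarrow> poly (pderiv p) x \<in> P"
  shows "\<exists>x\<in>F. x \<prec> a \<and> - poly p x \<in> P"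
proof -
  define q where "q = - pcompose p [:0, - 1:]"
  have "pcompose p [:0, - 1:] \<in> polys"
    using p(1)
  proof (induction p)
    case (pCons a p)
    then show ?case using zero_polys zero_mem one_mem
      by (auto simp: pcompose_pCons pCons_polys_iff intro!: add_polys mult_polys uminus_mem uminus_polys)
  qed (simp add: zero_polys)
  then have q: "q \<in> polys" unfolding q_def by (rule uminus_polys)
  have "pderiv q = pcompose (pderiv p) [:0, - 1:]"
    by (simp add: q_def pderiv_pcompose pderiv_minus pderiv_pCons)
  then have dq: "poly (pderiv q) x = poly (pderiv p) (- x)" for x
    by (simp add: poly_pcompose)
  have "\<exists>x\<in>F. - a \<prec> x \<and> poly q x \<in> P"
    using q uminus_mem[OF p(2)] pos[OF uminus_mem] by (intro unbounded_above) (auto simp: dq add.commute)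
  then obtain x where x: "x \<in> F" "- a \<prec> x" "poly q x \<in> P" by blast
  then show ?thesis using uminus_mem[OF x(1)]
    by (intro bexI[of _ "- x"]) (auto simp: q_def poly_pcompose add.commute)
qed

text \<open>
  The points of \<open>Z\<close> cut the field into points and open intervals, the cells; on a cell where
  the derivative of \<open>p\<close> is positive, the signs of \<open>p\<close> at the ends decide everything.
\<close>

definition in_cell :: "'a set \<Rightarrow> 'a \<Rightarrow> 'a \<Rightarrow> bool" where
  "in_cell Z x u \<longleftrightarrow> u \<in> F \<and> (\<forall>z\<in>Z. sg P (u - z) = sg P (x - z))"

lemma in_cellI:
  assumes "u \<in> F" "\<And>z. z \<in> Z \<Longrightarrow> z \<prec> x \<Longrightarrow> z \<prec> u" "\<And>z. z \<in> Z \<Longrightarrow> x \<prec> z \<Longrightarrow> u \<prec> z"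
    "Z \<subseteq> F" "x \<in> F" "x \<notin> Z"
  shows "in_cell Z x u"
  unfolding in_cell_def
proof (intro conjI ballI)
  fix z assume z: "z \<in> Z"
  then have "z \<prec> x \<or> x \<prec> z" using less_cases[of z x] assms by auto
  then show "sg P (u - z) = sg P (x - z)"
  proof
    assume "z \<prec> x"
    then have "sg P (x - z) = 1" "sg P (u - z) = 1" using assms(2)[OF z] by (auto simp: sg_eq_1_iff)
    then show ?thesis by simp
  next
    assume "x \<prec> z"
    then have "sg P (x - z) = - 1" "sg P (u - z) = - 1" using assms(3)[OF z] by (auto simp: sg_eq_neg_iff)
    then show ?thesis by simp
  qed
qed (rule assms)

lemma in_cellD:
  assumes "in_cell Z x u" "z \<in> Z"
  shows "z \<prec> u \<longleftrightarrow> z \<prec> x" "u \<prec> z \<longleftrightarrow> x \<prec> z"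
  using assms sg_eq_1_iff[of "u - z"] sg_eq_1_iff[of "x - z"]
    sg_eq_neg_iff[of "u - z"] sg_eq_neg_iff[of "x - z"] by (auto simp: in_cell_def)

context
  fixes Z x p
  assumes Z: "finite Z" "Z \<subseteq> F" and x: "x \<in> F" "x \<notin> Z" and p: "p \<in> polys"
    and pos: "\<And>u. in_cell Z x u \<Longrightarrow> poly (pderiv p) u \<in> P"
begin

lemma in_cell_between:
  assumes "in_cell Z x u \<or> (u \<in> Z \<and> u \<prec> x \<and> (\<forall>z\<in>Z. z \<prec> x \<longrightarrow> z = u \<or> z \<prec> u))"
    and "in_cell Z x v \<or> (v \<in> Z \<and> x \<prec> v \<and> (\<forall>z\<in>Z. x \<prec> z \<longrightarrow> z = v \<or> v \<prec> z))"
    and "y \<in> F" "u \<prec> y" "y \<prec> v"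
  shows "in_cell Z x y"
proof (rule in_cellI)
  fix z assume z: "z \<in> Z" "z \<prec> x"
  then have "z = u \<or> z \<prec> u" using assms(1) in_cellD(1)[of Z x u z] by blast
  then show "z \<prec> y" using assms less_trans by blast
next
  fix z assume z: "z \<in> Z" "x \<prec> z"
  then have "z = v \<or> v \<prec> z" using assms(2) in_cellD(2)[of Z x v z] by blast
  then show "y \<prec> z" using assms less_trans by blast
qed (use assms Z x in auto)

lemma in_cell_self: "in_cell Z x x"
  using x by (simp add: in_cell_def)

lemma increasing_on_cell:
  assumes "in_cell Z x u" "in_cell Z x v" "u \<prec> v"
  shows "poly p u \<prec> poly p v"
proof (rule deriv_pos_increasing[OF p _ _ assms(3)])
  show "u \<in> F" "v \<in> F" using assms by (auto simp: in_cell_def)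
  fix y assume "y \<in> F" "u \<prec> y" "y \<prec> v"
  then have "in_cell Z x y" using in_cell_between[of u v y] assms by blast
  then show "poly (pderiv p) y \<in> P" by (rule pos)
qed

lemma pos_on_cell:
  assumes "z \<in> Z" "z \<prec> x" "\<And>z'. z' \<in> Z \<Longrightarrow> z' \<prec> x \<Longrightarrow> z' = z \<or> z' \<prec> z" "- poly p z \<notin> P"
  shows "poly p x \<in> P"
proof -
  have "poly p z \<prec> poly p x"
  proof (rule deriv_pos_increasing[OF p])
    fix y assume "y \<in> F" "z \<prec> y" "y \<prec> x"
    then show "poly (pderiv p) y \<in> P" using in_cell_between[of z x y] in_cell_self assms pos by blast
  qed (use assms Z x in auto)
  moreover have "poly p z = 0 \<or> poly p z \<in> P" using trichotomy[of "poly p z"] assms Z p poly_mem by blast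
  ultimately show ?thesis using add_pos[of "poly p x - poly p z" "poly p z"] by auto
qed

lemma neg_on_cell:
  assumes "z \<in> Z" "x \<prec> z" "\<And>z'. z' \<in> Z \<Longrightarrow> x \<prec> z' \<Longrightarrow> z' = z \<or> z \<prec> z'" "poly p z \<notin> P"
  shows "- poly p x \<in> P"
proof -
  have "poly p x \<prec> poly p z"
  proof (rule deriv_pos_increasing[OF p])
    fix y assume "y \<in> F" "x \<prec> y" "y \<prec> z"
    then show "poly (pderiv p) y \<in> P" using in_cell_between[of x z y] in_cell_self assms pos by blast
  qed (use assms Z x in auto)
  moreover have "poly p z = 0 \<or> - poly p z \<in> P" using trichotomy[of "poly p z"] assms Z p poly_mem by blast
  ultimately show ?thesis using add_pos[of "poly p z - poly p x" "- poly p z"] by auto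
qed

text \<open>
  At an unbounded end of the cell, \<open>p\<close> has the required sign somewhere in the cell by
  \<open>unbounded_below\<close> or \<open>unbounded_above\<close>.
\<close>

lemma root_in_cell:
  assumes left: "\<And>z. z \<in> Z \<Longrightarrow> z \<prec> x \<Longrightarrow> (\<And>z'. z' \<in> Z \<Longrightarrow> z' \<prec> x \<Longrightarrow> z' = z \<or> z' \<prec> z) \<Longrightarrow> - poly p z \<in> P"
    and right: "\<And>z. z \<in> Z \<Longrightarrow> x \<prec> z \<Longrightarrow> (\<And>z'. z' \<in> Z \<Longrightarrow> x \<prec> z' \<Longrightarrow> z' = z \<or> z \<prec> z') \<Longrightarrow> poly p z \<in> P"
  shows "\<exists>u. in_cell Z x u \<and> poly p u = 0"
proof -
  define A where "A = {z \<in> Z. z \<prec> x}"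
  define B where "B = {z \<in> Z. x \<prec> z}"
  have AB: "finite A" "finite B" "A \<subseteq> F" "B \<subseteq> F" using Z by (auto simp: A_def B_def)
  let ?L = "\<lambda>u. in_cell Z x u \<or> (u \<in> Z \<and> u \<prec> x \<and> (\<forall>z\<in>Z. z \<prec> x \<longrightarrow> z = u \<or> z \<prec> u))"
  let ?R = "\<lambda>v. in_cell Z x v \<or> (v \<in> Z \<and> x \<prec> v \<and> (\<forall>z\<in>Z. x \<prec> z \<longrightarrow> z = v \<or> v \<prec> z))"
  have "\<exists>u\<in>F. u \<prec> x \<and> - poly p u \<in> P \<and> ?L u"
  proof (cases "A = {}")
    case True
    have cell: "in_cell Z x u" if "u \<in> F" "u \<prec> x" for u
    proof (rule in_cellI[OF that(1) _ _ Z(2) x])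
      fix z assume "z \<in> Z"
      then show "z \<prec> x \<Longrightarrow> z \<prec> u" using True by (auto simp: A_def)
      show "x \<prec> z \<Longrightarrow> u \<prec> z" by (rule less_trans[OF that(2)])
    qed
    then obtain u where "u \<in> F" "u \<prec> x" "- poly p u \<in> P"
      using unbounded_below[OF p x(1)] pos by blast
    then show ?thesis using cell by blast
  next
    case False
    then obtain u where u: "u \<in> A" "\<forall>z\<in>A. z = u \<or> z \<prec> u" using exists_max[OF AB(1) False AB(3)] by blast
    then have "- poly p u \<in> P" using left[of u] by (auto simp: A_def)
    then show ?thesis using u Z by (intro bexI[of _ u]) (auto simp: A_def)
  qed
  then obtain u where u: "u \<in> F" "u \<prec> x" "- poly p u \<in> P" "?L u" by blast
  have "\<exists>v\<in>F. x \<prec> v \<and> poly p v \<in> P \<and> ?R v"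
  proof (cases "B = {}")
    case True
    have cell: "in_cell Z x v" if "v \<in> F" "x \<prec> v" for v
    proof (rule in_cellI[OF that(1) _ _ Z(2) x])
      fix z assume "z \<in> Z"
      then show "x \<prec> z \<Longrightarrow> v \<prec> z" using True by (auto simp: B_def)
      show "z \<prec> x \<Longrightarrow> z \<prec> v" by (rule less_trans[OF _ that(2)])
    qed
    then obtain v where "v \<in> F" "x \<prec> v" "poly p v \<in> P"
      using unbounded_above[OF p x(1)] pos by blast
    then show ?thesis using cell by blast
  next
    case False
    then obtain v where v: "v \<in> B" "\<forall>z\<in>B. z = v \<or> v \<prec> z" using exists_min[OF AB(2) False AB(4)] by blast
    then have "poly p v \<in> P" using right[of v] by (auto simp: B_def)
    then show ?thesis using v Z by (intro bexI[of _ v]) (auto simp: B_def)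
  qed
  then obtain v where v: "v \<in> F" "x \<prec> v" "poly p v \<in> P" "?R v" by blast
  have "- (poly p u * poly p v) \<in> P" using mult_pos[OF u(3) v(3)] by simp
  then obtain c where "c \<in> F" "u \<prec> c" "c \<prec> v" "poly p c = 0"
    using ivt[OF p u(1) v(1) less_trans[OF u(2) v(2)]] by blast
  then show ?thesis using in_cell_between[OF u(4) v(4)] by blast
qed

end

end

section \<open>Real closures\<close>

lemma pos_coneI:
  assumes E: "subfld E" and "P \<subseteq> E"
    and add: "\<And>x y. x \<in> P \<Longrightarrow> y \<in> P \<Longrightarrow> x + y \<in> P"
    and mult: "\<And>x y. x \<in> P \<Longrightarrow> y \<in> P \<Longrightarrow> x * y \<in> P"
    and zero: "0 \<notin> P" and tri: "\<And>x. x \<in> E \<Longrightarrow> x \<noteq> 0 \<Longrightarrow> x \<in> P \<or> - x \<in> P"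
  shows "pos_cone P \<and> cone_field P = E"
proof -
  interpret E: subfld E by fact
  have sq: "x * x \<in> P" if "x \<in> E" "x \<noteq> 0" for x
    using tri[OF that] mult[of x x] mult[of "- x" "- x"] by auto
  obtain P' where P': "P \<subseteq> P'" "pos_cone P'" "cone_field P' = E"
    using preordering_extends[OF E \<open>P \<subseteq> E\<close> add mult sq zero] by blast
  interpret P': pos_cone P' by fact
  have "P' \<subseteq> P"
  proof
    fix x assume x: "x \<in> P'"
    then have "x \<in> E" "x \<noteq> 0" using P' P'.pos_mem P'.zero_not_pos by auto
    then show "x \<in> P" using tri[of x] P'.not_both[OF x] P'(1) by blast
  qed
  then have "P' = P" using P' by blast
  then show ?thesis using P' by simp
qed

lemma pos_cone_of_ordering:
  assumes F: "subfld F" and R: "field_ordering_on F R"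
  defines "S \<equiv> {x \<in> F. x \<noteq> 0 \<and> (0, x) \<in> R}"
  shows "pos_cone S \<and> cone_field S = F"
proof -
  interpret F: subfld F by fact
  have tr: "(x, z) \<in> R" if "(x, y) \<in> R" "(y, z) \<in> R" for x y z
    using R that unfolding field_ordering_on_def linear_order_on_def partial_order_on_def preorder_on_def trans_def by blast
  have anti: "x = y" if "(x, y) \<in> R" "(y, x) \<in> R" for x y
    using R that unfolding field_ordering_on_def linear_order_on_def partial_order_on_def antisym_def by blast
  have tot: "(x, y) \<in> R \<or> (y, x) \<in> R" if "x \<in> F" "y \<in> F" "x \<noteq> y" for x y
    using R that unfolding field_ordering_on_def linear_order_on_def total_on_def by blast
  have transl: "(x + z, y + z) \<in> R" if "x \<in> F" "y \<in> F" "z \<in> F" "(x, y) \<in> R" for x y z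
    using R that unfolding field_ordering_on_def by blast
  have mul: "(0, x * y) \<in> R" if "x \<in> F" "y \<in> F" "(0, x) \<in> R" "(0, y) \<in> R" for x y
    using R that unfolding field_ordering_on_def by blast
  have "x + y \<in> S" if "x \<in> S" "y \<in> S" for x y
  proof -
    have xy: "(y, x + y) \<in> R" using transl[of 0 x y] that F.zero_mem by (simp add: S_def)
    then have "(0, x + y) \<in> R" using tr that unfolding S_def by blast
    moreover have "x + y \<noteq> 0" using xy anti[of y 0] that by (auto simp: S_def)
    ultimately show ?thesis using that F.add_mem by (simp add: S_def)
  qed
  moreover have "x * y \<in> S" if "x \<in> S" "y \<in> S" for x y
    using that mul F.mult_mem by (simp add: S_def)
  moreover have "x \<in> S \<or> - x \<in> S" if x: "x \<in> F" "x \<noteq> 0" for x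
    using tot[of 0 x] x transl[of x 0 "- x"] F.zero_mem F.uminus_mem by (auto simp: S_def)
  ultimately show ?thesis by (intro pos_coneI[OF F]) (auto simp: S_def)
qed

text \<open>
  Needed to recognize the extensions of \<open>to_ac ` C\<close> as formally real in \<open>real_closed_on_cone\<close>.
\<close>

lemma ordering_of_pos_cone:
  assumes "pos_cone P"
  shows "\<exists>R. field_ordering_on (cone_field P) R"
proof -
  interpret pos_cone P by fact
  define R where "R = {(x, y). x \<in> F \<and> y \<in> F \<and> (x = y \<or> x \<prec> y)}"
  have "linear_order_on F R"
    unfolding linear_order_on_def partial_order_on_def preorder_on_def
  proof (intro conjI)
    show "refl_on F R" by (auto simp: refl_on_def R_def)
    show "trans R" unfolding trans_def R_def using less_trans by blast
    show "antisym R" unfolding antisym_def R_def using less_asym by blast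
    show "total_on F R" unfolding total_on_def R_def using less_cases by blast
  qed (auto simp: R_def)
  moreover have "(x + z, y + z) \<in> R" if "x \<in> F" "y \<in> F" "z \<in> F" "(x, y) \<in> R" for x y z
    using that add_mem by (auto simp: R_def)
  moreover have "(0, x * y) \<in> R" if "x \<in> F" "y \<in> F" "(0, x) \<in> R" "(0, y) \<in> R" for x y
    using that mult_mem mult_pos[of x y] by (auto simp: R_def)
  ultimately show ?thesis unfolding field_ordering_on_def by blast
qed

lemma pos_cone_image:
  assumes P: "pos_cone P" and h: "field_hom h"
  shows "pos_cone (h ` P)" "cone_field (h ` P) = h ` cone_field P"
proof -
  interpret pos_cone P by fact
  interpret h: field_hom h by fact
  have sub: "subfld (h ` F)"
  proof
    show "1 \<in> h ` F" using one_mem h.hom_one by (metis imageI)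
    show "x + y \<in> h ` F" if "x \<in> h ` F" "y \<in> h ` F" for x y
      using that add_mem by (auto simp: h.hom_add[symmetric])
    show "- x \<in> h ` F" if "x \<in> h ` F" for x
      using that uminus_mem by (auto simp: h.hom_uminus[symmetric])
    show "x * y \<in> h ` F" if "x \<in> h ` F" "y \<in> h ` F" for x y
      using that mult_mem by (auto simp: h.hom_mult[symmetric])
    show "inverse x \<in> h ` F" if "x \<in> h ` F" for x
      using that inverse_mem by (auto simp: h.hom_inverse[symmetric])
  qed
  have "pos_cone (h ` P) \<and> cone_field (h ` P) = h ` F"
  proof (rule pos_coneI[OF sub], goal_cases)
    case 1 then show ?case using pos_mem by auto
  next
    case (2 x y) then show ?case using add_pos by (auto simp: h.hom_add[symmetric])
  next
    case (3 x y) then show ?case using mult_pos by (auto simp: h.hom_mult[symmetric])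
  next
    case 4 then show ?case using zero_not_pos h.hom_0_iff by auto
  next
    case (5 x) then show ?case using trichotomy by (fastforce simp: h.hom_uminus[symmetric])
  qed
  then show "pos_cone (h ` P)" "cone_field (h ` P) = h ` F" by simp_all
qed

text \<open>
  Zorn's lemma for cones of the ambient algebraically closed field, which contains the roots
  required by \<open>maximal_cone_ivt\<close>.
\<close>

theorem real_closure_exists:
  fixes P0 :: "'a::alg_closed_field set"
  assumes "pos_cone P0"
  shows "\<exists>P. P0 \<subseteq> P \<and> real_closed_cone P"
proof -
  define AA where "AA = {P. P0 \<subseteq> P \<and> pos_cone P}"
  have "\<exists>M\<in>AA. \<forall>P\<in>AA. M \<subseteq> P \<longrightarrow> P = M"
  proof (rule subset_Zorn_nonempty)
    show "AA \<noteq> {}" using assms by (auto simp: AA_def)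
  next
    fix CC assume C: "CC \<noteq> {}" "subset.chain AA CC"
    have sub: "P0 \<subseteq> S" "pos_cone S" if "S \<in> CC" for S
      using C(2) that unfolding subset_chain_def AA_def by blast+
    have two: "\<exists>S\<in>CC. x \<in> S \<and> y \<in> S" if "x \<in> \<Union>CC" "y \<in> \<Union>CC" for x y
      using C(2) that unfolding subset_chain_def by blast
    obtain S0 where S0: "S0 \<in> CC" using C(1) by blast
    have "pos_cone (\<Union>CC)"
    proof
      show "1 \<in> \<Union>CC" using S0 pos_cone.one_pos[OF sub(2)[OF S0]] by blast
      show "0 \<notin> \<Union>CC" using pos_cone.zero_not_pos[OF sub(2)] by blast
      show "inverse x \<in> \<Union>CC" if "x \<in> \<Union>CC" for x using that pos_cone.inverse_pos[OF sub(2)] by blast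
      fix x y assume "x \<in> \<Union>CC" "y \<in> \<Union>CC"
      then obtain S where S: "S \<in> CC" "x \<in> S" "y \<in> S" using two by blast
      interpret S: pos_cone S by (rule sub(2)[OF S(1)])
      show "x + y \<in> \<Union>CC" "x * y \<in> \<Union>CC" using S S.add_pos S.mult_pos by blast+
      show "x = y \<or> x - y \<in> \<Union>CC \<or> y - x \<in> \<Union>CC" using S S.comparable by blast
    qed
    then show "\<Union>CC \<in> AA" using sub(1)[OF S0] S0 by (auto simp: AA_def)
  qed
  then obtain M where M: "M \<in> AA" "\<And>P. P \<in> AA \<Longrightarrow> M \<subseteq> P \<Longrightarrow> P = M" by blast
  have "maximal_cone M" unfolding maximal_cone_def
    using M by (auto simp: AA_def)
  then show ?thesis using M(1) maximal_cone_ivt[of M] by (auto simp: AA_def)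
qed

text \<open>
  The powers of \<open>f(\<alpha>)\<close> are combinations of \<open>1, \<alpha>, \<dots>, \<alpha>\<^sup>n\<^sup>-\<^sup>1\<close>, hence linearly dependent.
\<close>

lemma (in subfld) simple_extension_algebraic:
  fixes \<alpha> :: 'a
  assumes p: "p \<in> polys" "p \<noteq> 0" "poly p \<alpha> = 0" and f: "f \<in> polys"
  shows "\<exists>q\<in>polys. q \<noteq> 0 \<and> poly q (poly f \<alpha>) = 0"
proof -
  define n where "n = Polynomial.degree p"
  have n: "n > 0"
  proof (rule ccontr)
    assume "\<not> n > 0"
    then obtain c where "p = [:c:]" unfolding n_def using degree_eq_zeroE by blast
    then show False using p by simp
  qed
  have "\<exists>g. g \<in> polys \<and> poly g \<alpha> = poly f \<alpha> ^ j \<and> Polynomial.degree g < n" for j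
  proof -
    obtain q g where "g \<in> polys" "f ^ j = p * q + g" "g = 0 \<or> Polynomial.degree g < n"
      using division[OF p(1,2) power_polys[OF f]] unfolding n_def by blast
    moreover from this have "poly f \<alpha> ^ j = poly g \<alpha>" using p(3) by (metis (no_types) add_0 mult_zero_left poly_add poly_mult poly_power)
    ultimately show ?thesis using n by auto
  qed
  then obtain g where g: "\<And>j. g j \<in> polys" "\<And>j. poly (g j) \<alpha> = poly f \<alpha> ^ j" "\<And>j. Polynomial.degree (g j) < n"
    by metis
  obtain c where c: "\<And>j. c j \<in> F" "\<exists>j\<le>n. c j \<noteq> 0" "\<And>i. i < n \<Longrightarrow> (\<Sum>j\<le>n. coeff (g j) i * c j) = 0"
    using linear_dependence[of "\<lambda>i j. coeff (g j) i" n] coeff_mem[OF g(1)] by blast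
  define q where "q = (\<Sum>j\<le>n. monom (c j) j)"
  have cq: "coeff q i = (if i \<le> n then c i else 0)" for i
    by (simp add: q_def coeff_sum coeff_monom)
  have "q \<in> polys" using c(1) zero_mem by (simp add: polys_def cq)
  moreover have "q \<noteq> 0"
  proof -
    obtain j where "j \<le> n" "c j \<noteq> 0" using c(2) by blast
    then show ?thesis using cq[of j] by auto
  qed
  moreover have "poly q (poly f \<alpha>) = 0"
  proof -
    have "poly (g j) \<alpha> = (\<Sum>i<n. coeff (g j) i * \<alpha> ^ i)" for j
    proof -
      have "poly (g j) \<alpha> = (\<Sum>i\<le>Polynomial.degree (g j). coeff (g j) i * \<alpha> ^ i)" by (rule poly_altdef)
      also have "\<dots> = (\<Sum>i<n. coeff (g j) i * \<alpha> ^ i)"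
        by (rule sum.mono_neutral_left) (use g(3)[of j] in \<open>auto simp: coeff_eq_0\<close>)
      finally show ?thesis .
    qed
    then have "poly q (poly f \<alpha>) = (\<Sum>j\<le>n. c j * (\<Sum>i<n. coeff (g j) i * \<alpha> ^ i))"
      by (simp add: q_def poly_sum poly_monom g(2)[symmetric])
    also have "\<dots> = (\<Sum>j\<le>n. \<Sum>i<n. \<alpha> ^ i * (coeff (g j) i * c j))"
      by (simp add: sum_distrib_left ac_simps)
    also have "\<dots> = (\<Sum>i<n. \<Sum>j\<le>n. \<alpha> ^ i * (coeff (g j) i * c j))" by (rule sum.swap)
    also have "\<dots> = (\<Sum>i<n. \<alpha> ^ i * (\<Sum>j\<le>n. coeff (g j) i * c j))" by (simp add: sum_distrib_left)
    also have "\<dots> = 0" using c(3) by simp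
    finally show ?thesis .
  qed
  ultimately show ?thesis by blast
qed

section \<open>Subfields in the sense of the algebra library\<close>

lemma ring_of_type_algebra_simps:
  "carrier (ring_of_type_algebra :: 'a::field ring) = UNIV"
  "x \<otimes>\<^bsub>ring_of_type_algebra\<^esub> y = x * (y :: 'a)" "\<one>\<^bsub>ring_of_type_algebra\<^esub> = (1 :: 'a)"
  "x \<oplus>\<^bsub>ring_of_type_algebra\<^esub> y = x + (y :: 'a)" "\<zero>\<^bsub>ring_of_type_algebra\<^esub> = (0 :: 'a)"
  by (simp_all add: ring_of_type_algebra_def)

lemma ring_of_type_algebra_inverses:
  "\<ominus>\<^bsub>ring_of_type_algebra\<^esub> x = - (x :: 'a::field)"
  "x \<noteq> 0 \<Longrightarrow> inv\<^bsub>ring_of_type_algebra\<^esub> x = inverse (x :: 'a::field)"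
proof -
  interpret R: field "ring_of_type_algebra :: 'a ring" by (rule field_from_type_algebra)
  show "\<ominus>\<^bsub>ring_of_type_algebra\<^esub> x = - x"
    by (rule R.minus_equality) (simp_all add: ring_of_type_algebra_simps)
  show "x \<noteq> 0 \<Longrightarrow> inv\<^bsub>ring_of_type_algebra\<^esub> x = inverse x"
    by (rule R.comm_inv_char) (simp_all add: ring_of_type_algebra_simps)
qed

lemma subfield_iff_subfld:
  "subfield F (ring_of_type_algebra :: 'a::field ring) \<longleftrightarrow> subfld F"
proof -
  interpret R: field "ring_of_type_algebra :: 'a ring" by (rule field_from_type_algebra)
  note simps = ring_of_type_algebra_simps ring_of_type_algebra_inverses
  show ?thesis
  proof
    assume F: "subfield F (ring_of_type_algebra :: 'a ring)"
    note sr = subfieldE(1)[OF F]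
    show "subfld F"
    proof
      show "1 \<in> F" using subringE(3)[OF sr] by (simp add: simps)
      show "x + y \<in> F" if "x \<in> F" "y \<in> F" for x y using subringE(7)[OF sr that] by (simp add: simps)
      show "x * y \<in> F" if "x \<in> F" "y \<in> F" for x y using subringE(6)[OF sr that] by (simp add: simps)
      show "- x \<in> F" if "x \<in> F" for x using subringE(5)[OF sr that] by (simp add: simps)
      show "inverse x \<in> F" if "x \<in> F" for x
        using that R.subfield_m_inv(1)[OF F, of x] by (cases "x = 0") (auto simp: simps)
    qed
  next
    assume "subfld F"
    then interpret F: subfld F .
    show "subfield F (ring_of_type_algebra :: 'a ring)"
    proof (rule R.subfieldI')
      show "subring F (ring_of_type_algebra :: 'a ring)"
        by (rule R.subringI) (auto simp: simps intro: F.mem)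
      show "inv\<^bsub>ring_of_type_algebra\<^esub> k \<in> F" if "k \<in> F - {\<zero>\<^bsub>ring_of_type_algebra\<^esub>}" for k
        using that F.inverse_mem by (simp add: simps)
    qed
  qed
qed

lemma field_hom_to_ac: "field_hom (to_ac :: 'a::field \<Rightarrow> 'a alg_closure)"
  by unfold_locales auto

text \<open>
  A larger cone on a field generated by one algebraic element would make that field a formally
  real algebraic extension, so by hypothesis the field is \<open>to_ac ` C\<close> itself, and a field has
  no two orderings of which one contains the other.
\<close>

theorem real_closed_on_cone:
  fixes C :: "'k::field set"
  assumes "real_closed_on C"
  shows "\<exists>P. real_closed_cone P \<and> cone_field P = to_ac ` C"
proof -
  have C: "subfld C" using assms by (simp add: real_closed_on_def formally_real_on_def subfield_iff_subfld)
  obtain R where R: "field_ordering_on C R" using assms by (auto simp: real_closed_on_def formally_real_on_def)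
  define P0 where "P0 = {x \<in> C. x \<noteq> 0 \<and> (0, x) \<in> R}"
  have P0: "pos_cone P0" "cone_field P0 = C" unfolding P0_def using pos_cone_of_ordering[OF C R] by simp_all
  define P where "P = to_ac ` P0"
  have P: "pos_cone P" and PC: "cone_field P = to_ac ` C"
    unfolding P_def using pos_cone_image[OF P0(1) field_hom_to_ac] P0(2) by simp_all
  interpret pos_cone P by fact
  have "P' = P"
    if p: "p \<in> polys" "p \<noteq> 0" "poly p \<alpha> = 0" and P': "pos_cone P'" "P \<subseteq> P'" "cone_field P' = {poly f \<alpha> | f. f \<in> polys}"
    for \<alpha> p P'
  proof -
    interpret P': pos_cone P' by fact
    have sub: "to_ac ` C \<subseteq> P'.F" using P'(2) PC by (auto simp: cone_field_def)
    have "\<exists>q. q \<noteq> 0 \<and> (\<forall>i. coeff q i \<in> to_ac ` C) \<and> poly q x = 0" if "x \<in> P'.F" for x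
    proof -
      obtain f where "f \<in> polys" "x = poly f \<alpha>" using \<open>x \<in> P'.F\<close> P'(3) by blast
      then obtain q where q: "q \<in> polys" "q \<noteq> 0" "poly q x = 0" using simple_extension_algebraic[OF p] by blast
      have "\<forall>i. coeff q i \<in> to_ac ` C" using coeff_mem[OF q(1)] PC by simp
      then show ?thesis using q by blast
    qed
    then have "algebraic_extension_of (to_ac ` C) P'.F"
      unfolding algebraic_extension_of_def subfield_iff_subfld
      using subfld_axioms P'.subfld_axioms sub PC by auto
    moreover have "formally_real_on P'.F"
      unfolding formally_real_on_def subfield_iff_subfld using P'.subfld_axioms ordering_of_pos_cone[OF P'(1)] by blast
    ultimately have F': "P'.F = F" using assms PC by (simp add: real_closed_on_def)
    have "x \<in> P" if x: "x \<in> P'" for x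
      using trichotomy[of x] P'.pos_mem[OF x] F' P'(2) P'.not_both[OF x] P'.zero_not_pos x by auto
    then show ?thesis using P'(2) by blast
  qed
  then have "maximal_cone P" unfolding maximal_cone_def by blast
  then show ?thesis using maximal_cone_ivt[OF P] PC by blast
qed

lemma (in real_closed_cone) square_root_exists:
  assumes x: "x \<in> P"
  shows "\<exists>y\<in>F. y * y = x"
proof -
  have xF: "x \<in> F" by (rule pos_mem[OF x])
  define p where "p = [:- x, 0, 1:]"
  have p: "p \<in> polys" using xF zero_polys zero_mem one_mem uminus_mem by (auto simp: p_def pCons_polys_iff)
  have ev: "poly p y = y * y - x" for y by (simp add: p_def algebra_simps)
  have "x * (x * x + x + 1) \<in> P" using x by (intro mult_pos add_pos one_pos)
  moreover have "- (poly p 0 * poly p (x + 1)) = x * (x * x + x + 1)" by (simp add: ev algebra_simps)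
  ultimately have "- (poly p 0 * poly p (x + 1)) \<in> P" by simp
  moreover have "x + 1 - 0 \<in> P" using add_pos[OF x one_pos] by simp
  ultimately obtain c where "c \<in> F" "poly p c = 0"
    using ivt[OF p zero_mem add_mem[OF xF one_mem]] by blast
  then show ?thesis by (intro bexI[of _ c]) (auto simp: ev)
qed

section \<open>Sign diagrams of polynomials over two real closed fields\<close>

text \<open>
  Marked points of two ordered fields, in the same order. A set of pairs with a condition on
  the signs of differences replaces two sorted lists.
\<close>

definition matching :: "'x::field set \<Rightarrow> 'y::field set \<Rightarrow> ('x \<times> 'y) set \<Rightarrow> bool" where
  "matching P Q G \<longleftrightarrow> finite G \<and> (\<forall>z w. (z, w) \<in> G \<longrightarrow> z \<in> cone_field P \<and> w \<in> cone_field Q \<and>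
     (\<forall>z' w'. (z', w') \<in> G \<longrightarrow> sg P (z - z') = sg Q (w - w')))"

text \<open>
  The position of \<open>x\<close> among the marked points of the first field is that of \<open>y\<close> in the second.
\<close>

definition same_cell :: "'x::field set \<Rightarrow> 'y::field set \<Rightarrow> ('x \<times> 'y) set \<Rightarrow> 'x \<Rightarrow> 'y \<Rightarrow> bool" where
  "same_cell P Q G x y \<longleftrightarrow> (\<forall>z w. (z, w) \<in> G \<longrightarrow> sg P (x - z) = sg Q (y - w))"

text \<open>
  In particular \<open>p\<close> has constant sign on each cell, because all points of one cell are compared
  with the same \<open>y\<close>.
\<close>

definition aligned :: "'x::field set \<Rightarrow> 'y::field set \<Rightarrow> ('x \<times> 'y) set \<Rightarrow> 'x poly \<Rightarrow> 'y poly \<Rightarrow> bool" where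
  "aligned P Q G p q \<longleftrightarrow> (\<forall>x\<in>cone_field P. \<forall>y\<in>cone_field Q. same_cell P Q G x y \<longrightarrow>
     sg P (poly p x) = sg Q (poly q y))"

definition sign_diagram :: "'x::field set \<Rightarrow> 'y::field set \<Rightarrow> ('x \<times> 'y) set \<Rightarrow> 'x poly \<Rightarrow> 'y poly \<Rightarrow> bool" where
  "sign_diagram P Q G p q \<longleftrightarrow> aligned P Q G p q \<and>
     (p = 0 \<or> (\<forall>x\<in>cone_field P. poly p x = 0 \<longrightarrow> x \<in> fst ` G)) \<and>
     (q = 0 \<or> (\<forall>y\<in>cone_field Q. poly q y = 0 \<longrightarrow> y \<in> snd ` G))"

lemma matching_converse: "matching P Q G \<Longrightarrow> matching Q P (G\<inverse>)"
  unfolding matching_def by simp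

lemma same_cell_converse: "same_cell Q P (G\<inverse>) y x \<longleftrightarrow> same_cell P Q G x y"
  unfolding same_cell_def by (auto simp: eq_commute)

lemma same_cell_mono: "G \<subseteq> H \<Longrightarrow> same_cell P Q H x y \<Longrightarrow> same_cell P Q G x y"
  unfolding same_cell_def by blast

lemma sign_diagram_mono: "G \<subseteq> H \<Longrightarrow> sign_diagram P Q G p q \<Longrightarrow> sign_diagram P Q H p q"
  unfolding sign_diagram_def aligned_def using same_cell_mono[of G H P Q] by (meson image_mono subsetD)

lemma (in real_closed_cone) sign_change_root:
  assumes "q \<in> polys" "y \<in> F" "y' \<in> F" "sg P (poly q y) \<noteq> sg P (poly q y')"
  shows "\<exists>w\<in>F. poly q w = 0 \<and> sg P (y - w) \<noteq> sg P (y' - w)"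
proof -
  have F: "poly q y \<in> F" "poly q y' \<in> F" using assms by (auto intro: poly_mem)
  have yy: "y \<noteq> y'" using assms by auto
  show ?thesis
  proof (cases "poly q y = 0 \<or> poly q y' = 0")
    case True
    then show ?thesis
    proof
      assume "poly q y = 0"
      moreover have "sg P (y' - y) \<noteq> 0" using yy assms by (subst sg_eq_0_iff) (auto intro: diff_mem)
      ultimately show ?thesis using assms by (intro bexI[of _ y]) (auto simp: sg_0)
    next
      assume "poly q y' = 0"
      moreover have "sg P (y - y') \<noteq> 0" using yy assms by (subst sg_eq_0_iff) (auto intro: diff_mem)
      ultimately show ?thesis using assms by (intro bexI[of _ y']) (auto simp: sg_0)
    qed
  next
    case False
    have opp: "- (poly q y * poly q y') \<in> P"
    proof (cases "poly q y \<in> P")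
      case True
      then have "poly q y' \<notin> P" using assms(4) by (auto simp: sg_def)
      then have "- poly q y' \<in> P" using trichotomy[OF F(2)] False by auto
      then show ?thesis using mult_pos[OF True] by force
    next
      case n: False
      then have ny: "- poly q y \<in> P" using trichotomy[OF F(1)] False by auto
      then have "- poly q y' \<notin> P" using assms(4) sg_eq_neg_iff by metis
      then have "poly q y' \<in> P" using trichotomy[OF F(2)] False by auto
      then show ?thesis using mult_pos[OF ny] by force
    qed
    have "y \<prec> y' \<or> y' \<prec> y" using less_cases assms yy by blast
    then show ?thesis
    proof
      assume "y \<prec> y'"
      then obtain c where c: "c \<in> F" "y \<prec> c" "c \<prec> y'" "poly q c = 0"
        using ivt[OF assms(1-3) _ opp] by blast
      have "sg P (y' - c) = 1" "sg P (y - c) = - 1" using c sg_eq_1_iff sg_eq_neg_iff[of "y - c"] by auto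
      then show ?thesis using c by (intro bexI[of _ c]) auto
    next
      have opp': "- (poly q y' * poly q y) \<in> P" using opp by (simp add: mult.commute)
      assume "y' \<prec> y"
      then obtain c where c: "c \<in> F" "y' \<prec> c" "c \<prec> y" "poly q c = 0"
        using ivt[OF assms(1,3,2) _ opp'] by blast
      have "sg P (y - c) = 1" "sg P (y' - c) = - 1" using c sg_eq_1_iff sg_eq_neg_iff[of "y' - c"] by auto
      then show ?thesis using c by (intro bexI[of _ c]) auto
    qed
  qed
qed

locale two_cones = A: real_closed_cone P + B: real_closed_cone Q
  for P :: "'x::field set" and Q :: "'y::field set"
begin

text \<open>
  Orderings of fields are dense and unbounded, so a cell of one field has a nonempty
  counterpart in the other.
\<close>

lemma partner_total:
  assumes G: "matching P Q G" and x: "x \<in> A.F"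
  shows "\<exists>y\<in>B.F. same_cell P Q G x y"
proof (cases "x \<in> fst ` G")
  case True
  then obtain w where "(x, w) \<in> G" by force
  then show ?thesis using G by (intro bexI[of _ w]) (auto simp: matching_def same_cell_def)
next
  case False
  define L where "L = {w. \<exists>z. (z, w) \<in> G \<and> x - z \<in> P}"
  define R where "R = {w. \<exists>z. (z, w) \<in> G \<and> z - x \<in> P}"
  have fin: "finite G" and GF: "\<And>z w. (z, w) \<in> G \<Longrightarrow> z \<in> A.F \<and> w \<in> B.F"
    and Gsg: "\<And>z w z' w'. (z, w) \<in> G \<Longrightarrow> (z', w') \<in> G \<Longrightarrow> sg P (z - z') = sg Q (w - w')"
    using G unfolding matching_def by blast+
  have "L \<subseteq> snd ` G" "R \<subseteq> snd ` G" by (force simp: L_def R_def)+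
  then have LR: "finite L" "finite R" "L \<subseteq> B.F" "R \<subseteq> B.F"
    using fin GF by (auto intro: finite_subset)
  have lr: "b - a \<in> Q" if ab: "a \<in> L" "b \<in> R" for a b
  proof -
    obtain z where z: "(z, a) \<in> G" "x - z \<in> P" using ab unfolding L_def by blast
    obtain z' where z': "(z', b) \<in> G" "z' - x \<in> P" using ab unfolding R_def by blast
    have "z' - z \<in> P" using A.less_trans[OF z(2) z'(2)] .
    then have "sg P (z' - z) = 1" by (simp add: A.sg_eq_1_iff)
    then have "sg Q (b - a) = 1" using Gsg[OF z'(1) z(1)] by simp
    then show ?thesis by (simp add: B.sg_eq_1_iff)
  qed
  obtain y where y: "y \<in> B.F" "\<forall>a\<in>L. y - a \<in> Q" "\<forall>b\<in>R. b - y \<in> Q"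
    using B.separate[OF LR lr] by blast
  have "sg P (x - z) = sg Q (y - w)" if zw: "(z, w) \<in> G" for z w
  proof -
    have "z \<noteq> x" using zw False by force
    then have "x - z \<in> P \<or> z - x \<in> P" using A.less_cases[of z x] GF[OF zw] x by blast
    then show ?thesis
    proof
      assume "x - z \<in> P"
      then have "w \<in> L" using zw by (auto simp: L_def)
      then have "y - w \<in> Q" using y by blast
      then show ?thesis using \<open>x - z \<in> P\<close> by (simp add: sg_def)
    next
      assume zx: "z - x \<in> P"
      then have "w \<in> R" using zw by (auto simp: R_def)
      then have "w - y \<in> Q" using y by blast
      then have "sg Q (y - w) = - 1" using B.sg_eq_neg_iff[of "y - w"] by simp
      moreover have "sg P (x - z) = - 1" using A.sg_eq_neg_iff[of "x - z"] zx by simp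
      ultimately show ?thesis by simp
    qed
  qed
  then show ?thesis using y by (auto simp: same_cell_def)
qed

lemma swap: "two_cones Q P"
  by unfold_locales

lemma partner_total':
  assumes "matching P Q G" "y \<in> B.F"
  shows "\<exists>x\<in>A.F. same_cell P Q G x y"
  using two_cones.partner_total[OF swap matching_converse[OF assms(1)] assms(2)]
  by (simp add: same_cell_converse)

text \<open>
  The three cases are: \<open>p\<close> is not negative at the left end, \<open>p\<close> is not positive at the right
  end, and neither. Since \<open>p\<close> and \<open>q\<close> have the same signs at matched points, the same case
  applies to both.
\<close>

lemma cell_cases_pos:
  assumes G: "matching P Q G" and p: "p \<in> A.polys" and q: "q \<in> B.polys"
    and x: "x \<in> A.F" "x \<notin> fst ` G" and y: "y \<in> B.F" "y \<notin> snd ` G" and xy: "same_cell P Q G x y"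
    and pos: "\<And>u. A.in_cell (fst ` G) x u \<Longrightarrow> poly (pderiv p) u \<in> P"
      "\<And>v. B.in_cell (snd ` G) y v \<Longrightarrow> poly (pderiv q) v \<in> Q"
    and sgn: "\<And>z w. (z, w) \<in> G \<Longrightarrow> sg P (poly p z) = sg Q (poly q w)"
  shows "poly p x \<in> P \<and> poly q y \<in> Q \<or> - poly p x \<in> P \<and> - poly q y \<in> Q \<or>
    (\<exists>u v. A.in_cell (fst ` G) x u \<and> B.in_cell (snd ` G) y v \<and> poly p u = 0 \<and> poly q v = 0)"
proof -
  have fin: "finite (fst ` G)" "finite (snd ` G)" and GF: "fst ` G \<subseteq> A.F" "snd ` G \<subseteq> B.F"
    and Gsg: "\<And>z w z' w'. (z, w) \<in> G \<Longrightarrow> (z', w') \<in> G \<Longrightarrow> sg P (z - z') = sg Q (w - w')"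
    using G unfolding matching_def by force+
  have order: "z - z' \<in> P \<longleftrightarrow> w - w' \<in> Q" if "(z, w) \<in> G" "(z', w') \<in> G" for z w z' w'
    using Gsg[OF that] A.sg_eq_1_iff[of "z - z'"] B.sg_eq_1_iff[of "w - w'"] by auto
  have eq: "z = z' \<longleftrightarrow> w = w'" if zw: "(z, w) \<in> G" "(z', w') \<in> G" for z w z' w'
  proof -
    have "z \<in> A.F" "z' \<in> A.F" "w \<in> B.F" "w' \<in> B.F" using zw GF by force+
    then have "sg P (z - z') = 0 \<longleftrightarrow> z = z'" "sg Q (w - w') = 0 \<longleftrightarrow> w = w'"
      using A.sg_eq_0_iff[OF A.diff_mem] B.sg_eq_0_iff[OF B.diff_mem] by auto
    then show ?thesis using Gsg[OF zw] by simp
  qed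
  have left: "x - z \<in> P \<longleftrightarrow> y - w \<in> Q" and right: "z - x \<in> P \<longleftrightarrow> w - y \<in> Q" if "(z, w) \<in> G" for z w
    using xy that A.sg_eq_1_iff[of "x - z"] B.sg_eq_1_iff[of "y - w"]
      A.sg_eq_neg_iff[of "x - z"] B.sg_eq_neg_iff[of "y - w"] by (auto simp: same_cell_def)
  have psgn: "poly p z \<in> P \<longleftrightarrow> poly q w \<in> Q" and nsgn: "- poly p z \<in> P \<longleftrightarrow> - poly q w \<in> Q"
    if "(z, w) \<in> G" for z w
    using sgn[OF that] A.sg_eq_1_iff B.sg_eq_1_iff A.sg_eq_neg_iff B.sg_eq_neg_iff by metis+
  let ?NL = "\<lambda>z w. (z, w) \<in> G \<and> x - z \<in> P \<and> (\<forall>z' w'. (z', w') \<in> G \<longrightarrow> x - z' \<in> P \<longrightarrow> z' = z \<or> z - z' \<in> P)"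
  let ?NR = "\<lambda>z w. (z, w) \<in> G \<and> z - x \<in> P \<and> (\<forall>z' w'. (z', w') \<in> G \<longrightarrow> z' - x \<in> P \<longrightarrow> z' = z \<or> z' - z \<in> P)"
  show ?thesis
  proof (cases "\<exists>z w. ?NL z w \<and> - poly p z \<notin> P")
    case True
    then obtain z w where zw: "?NL z w" "- poly p z \<notin> P" by blast
    have "poly p x \<in> P"
      using A.pos_on_cell[OF fin(1) GF(1) x p pos(1), where z = z] zw by force
    moreover have "poly q y \<in> Q"
    proof (rule B.pos_on_cell[OF fin(2) GF(2) y q pos(2), where z = w])
      show "w \<in> snd ` G" using zw by force
      show "y - w \<in> Q" using zw left by blast
      show "- poly q w \<notin> Q" using zw nsgn by blast
      fix w' assume "w' \<in> snd ` G" "y - w' \<in> Q"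
      then obtain z' where z': "(z', w') \<in> G" by force
      then have "z' = z \<or> z - z' \<in> P" using zw left[OF z'] \<open>y - w' \<in> Q\<close> by blast
      then show "w' = w \<or> w - w' \<in> Q" using eq[OF z', of z w] order[of z w z' w'] z' zw by blast
    qed
    ultimately show ?thesis by blast
  next
    case noL: False
    show ?thesis
    proof (cases "\<exists>z w. ?NR z w \<and> poly p z \<notin> P")
      case True
      then obtain z w where zw: "?NR z w" "poly p z \<notin> P" by blast
      have "- poly p x \<in> P"
        using A.neg_on_cell[OF fin(1) GF(1) x p pos(1), where z = z] zw by force
      moreover have "- poly q y \<in> Q"
      proof (rule B.neg_on_cell[OF fin(2) GF(2) y q pos(2), where z = w])
        show "w \<in> snd ` G" using zw by force
        show "w - y \<in> Q" using zw right by blast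
        show "poly q w \<notin> Q" using zw psgn by blast
        fix w' assume "w' \<in> snd ` G" "w' - y \<in> Q"
        then obtain z' where z': "(z', w') \<in> G" by force
        then have "z' = z \<or> z' - z \<in> P" using zw right[OF z'] \<open>w' - y \<in> Q\<close> by blast
        then show "w' = w \<or> w' - w \<in> Q" using eq[OF z', of z w] order[of z' w' z w] z' zw by blast
      qed
      ultimately show ?thesis by blast
    next
      case noR: False
      have "\<exists>u. A.in_cell (fst ` G) x u \<and> poly p u = 0"
      proof (rule A.root_in_cell[OF fin(1) GF(1) x p pos(1)])
        fix z assume z: "z \<in> fst ` G" "x - z \<in> P" "\<And>z'. z' \<in> fst ` G \<Longrightarrow> x - z' \<in> P \<Longrightarrow> z' = z \<or> z - z' \<in> P"
        then obtain w where "(z, w) \<in> G" by force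
        moreover have "z' = z \<or> z - z' \<in> P" if "(z', w') \<in> G" "x - z' \<in> P" for z' w'
          using z(3)[of z'] that by force
        ultimately have "?NL z w" using z(2) by blast
        then show "- poly p z \<in> P" using noL by blast
      next
        fix z assume z: "z \<in> fst ` G" "z - x \<in> P" "\<And>z'. z' \<in> fst ` G \<Longrightarrow> z' - x \<in> P \<Longrightarrow> z' = z \<or> z' - z \<in> P"
        then obtain w where "(z, w) \<in> G" by force
        moreover have "z' = z \<or> z' - z \<in> P" if "(z', w') \<in> G" "z' - x \<in> P" for z' w'
          using z(3)[of z'] that by force
        ultimately have "?NR z w" using z(2) by blast
        then show "poly p z \<in> P" using noR by blast
      qed
      moreover have "\<exists>v. B.in_cell (snd ` G) y v \<and> poly q v = 0"
      proof (rule B.root_in_cell[OF fin(2) GF(2) y q pos(2)])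
        fix w assume w: "w \<in> snd ` G" "y - w \<in> Q" "\<And>w'. w' \<in> snd ` G \<Longrightarrow> y - w' \<in> Q \<Longrightarrow> w' = w \<or> w - w' \<in> Q"
        then obtain z where z: "(z, w) \<in> G" by force
        have "z' = z \<or> z - z' \<in> P" if z': "(z', w') \<in> G" "x - z' \<in> P" for z' w'
        proof -
          have "w' = w \<or> w - w' \<in> Q" using w(3)[of w'] left[OF z'(1)] z' by force
          then show ?thesis using eq[OF z'(1) z] order[OF z z'(1)] by blast
        qed
        then have "?NL z w" using z left[OF z] w(2) by blast
        then show "- poly q w \<in> Q" using noL nsgn[OF z] by blast
      next
        fix w assume w: "w \<in> snd ` G" "w - y \<in> Q" "\<And>w'. w' \<in> snd ` G \<Longrightarrow> w' - y \<in> Q \<Longrightarrow> w' = w \<or> w' - w \<in> Q"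
        then obtain z where z: "(z, w) \<in> G" by force
        have "z' = z \<or> z' - z \<in> P" if z': "(z', w') \<in> G" "z' - x \<in> P" for z' w'
        proof -
          have "w' = w \<or> w' - w \<in> Q" using w(3)[of w'] right[OF z'(1)] z' by force
          then show ?thesis using eq[OF z'(1) z] order[OF z'(1) z] by blast
        qed
        then have "?NR z w" using z right[OF z] w(2) by blast
        then show "poly q w \<in> Q" using noR psgn[OF z] by blast
      qed
      ultimately show ?thesis by blast
    qed
  qed
qed

lemma cell_cases:
  assumes G: "matching P Q G" and p: "p \<in> A.polys" and q: "q \<in> B.polys"
    and x: "x \<in> A.F" "x \<notin> fst ` G" and y: "y \<in> B.F" "y \<notin> snd ` G" and xy: "same_cell P Q G x y"
    and deriv: "s = 1 \<or> s = - 1" "\<And>u. A.in_cell (fst ` G) x u \<Longrightarrow> sg P (poly (pderiv p) u) = s"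
      "\<And>v. B.in_cell (snd ` G) y v \<Longrightarrow> sg Q (poly (pderiv q) v) = s"
    and sgn: "\<And>z w. (z, w) \<in> G \<Longrightarrow> sg P (poly p z) = sg Q (poly q w)"
  shows "poly p x \<in> P \<and> poly q y \<in> Q \<or> - poly p x \<in> P \<and> - poly q y \<in> Q \<or>
    (\<exists>u v. A.in_cell (fst ` G) x u \<and> B.in_cell (snd ` G) y v \<and> poly p u = 0 \<and> poly q v = 0)"
proof (cases "s = 1")
  case True
  then show ?thesis
    using deriv by (intro cell_cases_pos[OF G p q x y xy _ _ sgn]) (auto simp: A.sg_eq_1_iff B.sg_eq_1_iff)
next
  case False
  then have s: "s = - 1" using deriv by simp
  have "poly (- p) x \<in> P \<and> poly (- q) y \<in> Q \<or> - poly (- p) x \<in> P \<and> - poly (- q) y \<in> Q \<or>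
    (\<exists>u v. A.in_cell (fst ` G) x u \<and> B.in_cell (snd ` G) y v \<and> poly (- p) u = 0 \<and> poly (- q) v = 0)"
  proof (rule cell_cases_pos[OF G A.uminus_polys[OF p] B.uminus_polys[OF q] x y xy])
    show "poly (pderiv (- p)) u \<in> P" if "A.in_cell (fst ` G) x u" for u
      using deriv(2)[OF that] s A.sg_eq_neg_iff by (simp add: pderiv_minus)
    show "poly (pderiv (- q)) v \<in> Q" if "B.in_cell (snd ` G) y v" for v
      using deriv(3)[OF that] s B.sg_eq_neg_iff by (simp add: pderiv_minus)
    show "sg P (poly (- p) z) = sg Q (poly (- q) w)" if "(z, w) \<in> G" for z w
      using sgn[OF that] by (simp add: A.sg_uminus B.sg_uminus)
  qed
  then show ?thesis by auto
qed

end

lemma (in real_closed_cone) sign_on_cell: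
  assumes Z: "finite Z" "Z \<subseteq> F" and x: "x \<in> F" "x \<notin> Z" and p: "p \<in> polys"
    and deriv: "s = 1 \<or> s = - 1" "\<And>u. in_cell Z x u \<Longrightarrow> sg P (poly (pderiv p) u) = s"
    and u: "in_cell Z x u" "poly p u = 0"
  shows "sg P (poly p x) = s * sg P (x - u)"
proof -
  have self: "in_cell Z x x" and uF: "u \<in> F" using x u by (simp_all add: in_cell_def)
  have main: "sg P (poly q x) = sg P (x - u)"
    if q: "q \<in> polys" "poly q u = 0" "\<And>u. in_cell Z x u \<Longrightarrow> poly (pderiv q) u \<in> P" for q
  proof -
    have inc: "poly q a \<prec> poly q b" if "in_cell Z x a" "in_cell Z x b" "a \<prec> b" for a b
      using increasing_on_cell[OF Z x q(1) _ that] q(3) by blast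
    consider "x = u" | "x \<prec> u" | "u \<prec> x" using less_cases[OF x(1) uF] by blast
    then show ?thesis
    proof cases
      case 1 then show ?thesis using q by (simp add: sg_0)
    next
      case 2
      then have "- poly q x \<in> P" using inc[OF self u(1)] q by simp
      then have "sg P (poly q x) = - 1" by (simp add: sg_eq_neg_iff)
      moreover have "sg P (x - u) = - 1" using 2 sg_eq_neg_iff[of "x - u"] by simp
      ultimately show ?thesis by simp
    next
      case 3
      then have "poly q x \<in> P" using inc[OF u(1) self] q by simp
      then show ?thesis using 3 by (simp add: sg_def)
    qed
  qed
  show ?thesis
  proof (cases "s = 1")
    case True
    then show ?thesis using main[OF p u(2)] deriv(2) by (simp add: sg_eq_1_iff)
  next
    case False
    then have s: "s = - 1" using deriv by simp
    have "sg P (poly (- p) x) = sg P (x - u)"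
      using u(2) deriv(2) s by (intro main uminus_polys p) (auto simp: pderiv_minus sg_eq_neg_iff)
    then show ?thesis using s by (simp add: sg_uminus)
  qed
qed

context two_cones
begin

text \<open>
  Between consecutive marked points the derivatives do not vanish, so each of \<open>p\<close> and \<open>q\<close> has
  at most one root there, and whether it has one depends only on the signs at the marked
  points. Matching up these roots gives a diagram for \<open>p\<close> and \<open>q\<close>.
\<close>

lemma diagram_from_derivative:
  assumes G: "matching P Q G" and p: "p \<in> A.polys" and q: "q \<in> B.polys"
    and sign_diagram: "sign_diagram P Q G (pderiv p) (pderiv q)" and nz: "pderiv p \<noteq> 0" "pderiv q \<noteq> 0"
    and sgn: "\<And>z w. (z, w) \<in> G \<Longrightarrow> sg P (poly p z) = sg Q (poly q w)"
  shows "\<exists>H. G \<subseteq> H \<and> matching P Q H \<and> sign_diagram P Q H p q"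
proof -
  have fin: "finite (fst ` G)" "finite (snd ` G)" "finite G" and GF: "fst ` G \<subseteq> A.F" "snd ` G \<subseteq> B.F"
    and Gsg: "\<And>z w z' w'. (z, w) \<in> G \<Longrightarrow> (z', w') \<in> G \<Longrightarrow> sg P (z - z') = sg Q (w - w')"
    using G unfolding matching_def by force+
  have p0: "p \<noteq> 0" and q0: "q \<noteq> 0" using nz by auto
  have partner: "x \<in> fst ` G \<longleftrightarrow> y \<in> snd ` G" and partner_eq: "\<And>w. (x, w) \<in> G \<Longrightarrow> y = w"
    if xy: "x \<in> A.F" "y \<in> B.F" "same_cell P Q G x y" for x y
  proof -
    have iff: "x = z \<longleftrightarrow> y = w" if zw: "(z, w) \<in> G" for z w
    proof -
      have "z \<in> A.F" "w \<in> B.F" using zw GF by force+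
      then have "sg P (x - z) = 0 \<longleftrightarrow> x = z" "sg Q (y - w) = 0 \<longleftrightarrow> y = w"
        using A.sg_eq_0_iff[OF A.diff_mem] B.sg_eq_0_iff[OF B.diff_mem] xy by auto
      then show ?thesis using xy(3) zw by (auto simp: same_cell_def)
    qed
    then show "x \<in> fst ` G \<longleftrightarrow> y \<in> snd ` G" by force
    show "\<And>w. (x, w) \<in> G \<Longrightarrow> y = w" using iff by blast
  qed
  have cells: "same_cell P Q G u v"
    if "same_cell P Q G x y" "A.in_cell (fst ` G) x u" "B.in_cell (snd ` G) y v" for x y u v
    unfolding same_cell_def
  proof (intro allI impI)
    fix z w assume zw: "(z, w) \<in> G"
    then have "z \<in> fst ` G" "w \<in> snd ` G" by force+
    then have "sg P (u - z) = sg P (x - z)" "sg Q (v - w) = sg Q (y - w)"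
      using that(2,3) unfolding A.in_cell_def B.in_cell_def by blast+
    then show "sg P (u - z) = sg Q (v - w)"
      using that(1) zw by (simp add: same_cell_def)
  qed
  have al: "sg P (poly (pderiv p) x) = sg Q (poly (pderiv q) y)"
    if "x \<in> A.F" "y \<in> B.F" "same_cell P Q G x y" for x y
    using sign_diagram that by (auto simp: sign_diagram_def aligned_def)
  have deriv: "\<exists>s. (s = 1 \<or> s = - 1) \<and> (\<forall>u. A.in_cell (fst ` G) x u \<longrightarrow> sg P (poly (pderiv p) u) = s) \<and>
      (\<forall>v. B.in_cell (snd ` G) y v \<longrightarrow> sg Q (poly (pderiv q) v) = s)"
    if xy: "x \<in> A.F" "y \<in> B.F" "same_cell P Q G x y" "x \<notin> fst ` G" for x y
  proof (intro exI[of _ "sg P (poly (pderiv p) x)"] conjI allI impI)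
    have "poly (pderiv p) x \<noteq> 0" using sign_diagram nz xy by (auto simp: sign_diagram_def)
    moreover have "poly (pderiv p) x \<in> A.F" using p xy by (intro A.poly_mem A.pderiv_polys)
    ultimately have "sg P (poly (pderiv p) x) \<noteq> 0" by (simp add: A.sg_eq_0_iff)
    then show "sg P (poly (pderiv p) x) = 1 \<or> sg P (poly (pderiv p) x) = - 1"
      using A.sg_cases by blast
    have sx: "A.in_cell (fst ` G) x x" and sy: "B.in_cell (snd ` G) y y"
      using xy by (auto simp: A.in_cell_def B.in_cell_def)
    show "sg P (poly (pderiv p) u) = sg P (poly (pderiv p) x)" if u: "A.in_cell (fst ` G) x u" for u
    proof -
      have "u \<in> A.F" using u by (simp add: A.in_cell_def)
      then show ?thesis using al[of u y] al[of x y] cells[OF xy(3) u sy] xy by simp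
    qed
    show "sg Q (poly (pderiv q) v) = sg P (poly (pderiv p) x)" if v: "B.in_cell (snd ` G) y v" for v
    proof -
      have "v \<in> B.F" using v by (simp add: B.in_cell_def)
      then show ?thesis using al[of x v] cells[OF xy(3) sx v] xy by simp
    qed
  qed
  \<comment> \<open>The new pairs: roots of \<open>p\<close> and \<open>q\<close> in corresponding open cells.\<close>
  define N where "N = {(z, w). z \<in> A.F \<and> w \<in> B.F \<and> poly p z = 0 \<and> poly q w = 0 \<and>
    same_cell P Q G z w \<and> z \<notin> fst ` G}"
  have inN: "(u, v) \<in> N"
    if "x \<in> A.F" "x \<notin> fst ` G" "same_cell P Q G x y" "A.in_cell (fst ` G) x u" "B.in_cell (snd ` G) y v"
      "poly p u = 0" "poly q v = 0" for x y u v
  proof -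
    have F: "u \<in> A.F" "v \<in> B.F" using that by (auto simp: A.in_cell_def B.in_cell_def)
    have "u \<notin> fst ` G"
    proof
      assume u: "u \<in> fst ` G"
      then have "sg P (u - u) = sg P (x - u)" using that(4) by (auto simp: A.in_cell_def)
      then have "x - u = 0" using A.sg_eq_0_iff[OF A.diff_mem[OF that(1) F(1)]] by (simp add: A.sg_0)
      then show False using u that by simp
    qed
    then show ?thesis using cells[OF that(3-5)] F that by (simp add: N_def)
  qed
  have "N \<subseteq> {z. poly p z = 0} \<times> {w. poly q w = 0}" by (auto simp: N_def)
  then have finN: "finite N" using poly_roots_finite[OF p0] poly_roots_finite[OF q0]
    by (meson finite_SigmaI finite_subset)
  have NG: "sg P (z - z') = sg Q (w - w')" if "(z, w) \<in> N" "(z', w') \<in> G" for z w z' w'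
    using that by (auto simp: N_def same_cell_def)
  have NN: "sg P (z - z') = sg Q (w - w')" if N: "(z, w) \<in> N" "(z', w') \<in> N" for z w z' w'
  proof -
    have F: "z \<in> A.F" "z' \<in> A.F" "w \<in> B.F" "w' \<in> B.F" and roots: "poly p z = 0" "poly p z' = 0" "poly q w = 0" "poly q w' = 0"
      and cell: "same_cell P Q G z w" "same_cell P Q G z' w'" and nG: "z \<notin> fst ` G" "z' \<notin> fst ` G"
      using N by (auto simp: N_def)
    have nG': "w \<notin> snd ` G" using partner[OF F(1,3) cell(1)] nG by blast
    show ?thesis
    proof (cases "A.in_cell (fst ` G) z z'")
      case True
      have w': "B.in_cell (snd ` G) w w'"
        unfolding B.in_cell_def
      proof (intro conjI ballI)
        fix b assume "b \<in> snd ` G"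
        then obtain a where ab: "(a, b) \<in> G" by force
        have "sg P (z' - a) = sg P (z - a)" using True ab by (force simp: A.in_cell_def)
        then show "sg Q (w' - b) = sg Q (w - b)" using cell ab by (simp add: same_cell_def)
      qed (rule F)
      obtain s where s: "s = 1 \<or> s = - 1" "\<And>u. A.in_cell (fst ` G) z u \<Longrightarrow> sg P (poly (pderiv p) u) = s"
        "\<And>v. B.in_cell (snd ` G) w v \<Longrightarrow> sg Q (poly (pderiv q) v) = s"
        using deriv[OF F(1,3) cell(1) nG(1)] by blast
      have "sg P (poly p z) = s * sg P (z - z')"
        by (rule A.sign_on_cell[OF fin(1) GF(1) F(1) nG(1) p s(1,2) True roots(2)])
      then have "sg P (z - z') = 0" using s(1) roots by (auto simp: A.sg_0)
      moreover have "sg Q (poly q w) = s * sg Q (w - w')"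
        by (rule B.sign_on_cell[OF fin(2) GF(2) F(3) nG' q s(1,3) w' roots(4)])
      then have "sg Q (w - w') = 0" using s(1) roots by (auto simp: B.sg_0)
      ultimately show ?thesis by simp
    next
      case False
      then obtain a where a: "a \<in> fst ` G" "sg P (z' - a) \<noteq> sg P (z - a)" using F by (auto simp: A.in_cell_def)
      then obtain b where ab: "(a, b) \<in> G" by force
      have aF: "a \<in> A.F" "b \<in> B.F" using ab GF by force+
      have sgs: "sg P (z - a) = sg Q (w - b)" "sg P (z' - a) = sg Q (w' - b)"
        using cell ab by (auto simp: same_cell_def)
      have "sg P (z - a) \<noteq> 0" "sg P (z' - a) \<noteq> 0"
        using A.sg_eq_0_iff[OF A.diff_mem[OF F(1) aF(1)]] A.sg_eq_0_iff[OF A.diff_mem[OF F(2) aF(1)]] a nG by auto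
      then have "sg P (z - a) = 1 \<and> sg P (z' - a) = - 1 \<or> sg P (z - a) = - 1 \<and> sg P (z' - a) = 1"
        using a(2) A.sg_cases[of "z - a"] A.sg_cases[of "z' - a"] by auto
      then show ?thesis
      proof (elim disjE conjE)
        assume 1: "sg P (z - a) = 1" "sg P (z' - a) = - 1"
        have "z - z' \<in> P" using A.less_trans[of a z' z] 1 A.sg_eq_1_iff[of "z - a"] A.sg_eq_neg_iff[of "z' - a"] by auto
        moreover have "w - w' \<in> Q"
          using B.less_trans[of b w' w] 1 sgs B.sg_eq_1_iff[of "w - b"] B.sg_eq_neg_iff[of "w' - b"] by auto
        ultimately show ?thesis by (simp add: sg_def)
      next
        assume 1: "sg P (z - a) = - 1" "sg P (z' - a) = 1"
        have "z' - z \<in> P" using A.less_trans[of a z z'] 1 A.sg_eq_1_iff[of "z' - a"] A.sg_eq_neg_iff[of "z - a"] by auto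
        moreover have "w' - w \<in> Q"
          using B.less_trans[of b w w'] 1 sgs B.sg_eq_1_iff[of "w' - b"] B.sg_eq_neg_iff[of "w - b"] by auto
        ultimately show ?thesis using A.sg_swap[of z z'] B.sg_swap[of w w'] by (simp add: sg_def)
      qed
    qed
  qed
  define H where "H = G \<union> N"
  have mH: "matching P Q H"
    unfolding matching_def
  proof (intro conjI allI impI)
    show "finite H" using fin finN by (simp add: H_def)
    fix z w assume zw: "(z, w) \<in> H"
    show "z \<in> A.F" "w \<in> B.F" using zw GF by (force simp: H_def N_def)+
    fix z' w' assume zw': "(z', w') \<in> H"
    consider "(z, w) \<in> G" "(z', w') \<in> G" | "(z, w) \<in> N" "(z', w') \<in> G"
      | "(z, w) \<in> G" "(z', w') \<in> N" | "(z, w) \<in> N" "(z', w') \<in> N" using zw zw' by (auto simp: H_def)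
    then show "sg P (z - z') = sg Q (w - w')"
    proof cases
      case 3
      then show ?thesis using NG[OF 3(2,1)] A.sg_swap[of z z'] B.sg_swap[of w w'] by simp
    qed (use Gsg NG NN in auto)
  qed
  have cases3: "poly p x \<in> P \<and> poly q y \<in> Q \<or> - poly p x \<in> P \<and> - poly q y \<in> Q \<or>
     (\<exists>u v s. (u, v) \<in> N \<and> (s = 1 \<or> s = - 1) \<and> sg P (poly p x) = s * sg P (x - u) \<and> sg Q (poly q y) = s * sg Q (y - v))"
    if xy: "x \<in> A.F" "y \<in> B.F" "same_cell P Q G x y" "x \<notin> fst ` G" for x y
  proof -
    have ny: "y \<notin> snd ` G" using partner[OF xy(1-3)] xy(4) by blast
    obtain s where s: "s = 1 \<or> s = - 1" "\<And>u. A.in_cell (fst ` G) x u \<Longrightarrow> sg P (poly (pderiv p) u) = s"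
      "\<And>v. B.in_cell (snd ` G) y v \<Longrightarrow> sg Q (poly (pderiv q) v) = s"
      using deriv[OF xy] by blast
    note c = cell_cases[OF G p q xy(1,4) xy(2) ny xy(3) s sgn]
    show ?thesis
    proof (cases "\<exists>u v. A.in_cell (fst ` G) x u \<and> B.in_cell (snd ` G) y v \<and> poly p u = 0 \<and> poly q v = 0")
      case False then show ?thesis using c by blast
    next
      case True
      then obtain u v where uv: "A.in_cell (fst ` G) x u" "B.in_cell (snd ` G) y v" "poly p u = 0" "poly q v = 0"
        by blast
      have "(u, v) \<in> N" by (rule inN[OF xy(1,4,3) uv])
      moreover have "sg P (poly p x) = s * sg P (x - u)"
        by (rule A.sign_on_cell[OF fin(1) GF(1) xy(1,4) p s(1,2) uv(1,3)])
      moreover have "sg Q (poly q y) = s * sg Q (y - v)"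
        by (rule B.sign_on_cell[OF fin(2) GF(2) xy(2) ny q s(1,3) uv(2,4)])
      ultimately show ?thesis using s(1) by blast
    qed
  qed
  have "aligned P Q H p q"
    unfolding aligned_def
  proof (intro ballI impI)
    fix x y assume xy: "x \<in> A.F" "y \<in> B.F" "same_cell P Q H x y"
    then have xyG: "same_cell P Q G x y" using same_cell_mono[of G H] by (auto simp: H_def)
    show "sg P (poly p x) = sg Q (poly q y)"
    proof (cases "x \<in> fst ` G")
      case True
      then obtain w where "(x, w) \<in> G" by force
      then show ?thesis using partner_eq[OF xy(1,2) xyG] sgn by blast
    next
      case False
      consider "poly p x \<in> P" "poly q y \<in> Q" | "- poly p x \<in> P" "- poly q y \<in> Q"
        | u v s where "(u, v) \<in> N" "sg P (poly p x) = s * sg P (x - u)" "sg Q (poly q y) = s * sg Q (y - v)"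
        using cases3[OF xy(1,2) xyG False] by blast
      then show ?thesis
      proof cases
        case 2
        then show ?thesis using A.sg_eq_neg_iff B.sg_eq_neg_iff by metis
      next
        case uv: (3 u v s)
        have "sg P (x - u) = sg Q (y - v)" using xy(3) uv(1) by (auto simp: same_cell_def H_def)
        then show ?thesis using uv by simp
      qed (simp add: sg_def)
    qed
  qed
  moreover have "x \<in> fst ` H" if x: "x \<in> A.F" "poly p x = 0" for x
  proof (cases "x \<in> fst ` G")
    case False
    obtain y where y: "y \<in> B.F" "same_cell P Q G x y" using partner_total[OF G x(1)] by blast
    from cases3[OF x(1) y False] obtain u v s where uv: "(u, v) \<in> N" "s = 1 \<or> s = - 1" "sg P (poly p x) = s * sg P (x - u)"
      using x A.zero_not_pos by auto
    then have "sg P (x - u) = 0" using x by (auto simp: A.sg_0)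
    moreover have "u \<in> A.F" using uv by (auto simp: N_def)
    ultimately have "x = u" using A.sg_eq_0_iff[OF A.diff_mem[OF x(1)]] by auto
    then show ?thesis using uv(1) by (force simp: H_def)
  qed (auto simp: H_def)
  moreover have "y \<in> snd ` H" if y: "y \<in> B.F" "poly q y = 0" for y
  proof (cases "y \<in> snd ` G")
    case False
    obtain x where x: "x \<in> A.F" "same_cell P Q G x y" using partner_total'[OF G y(1)] by blast
    have nx: "x \<notin> fst ` G" using partner[OF x(1) y(1) x(2)] False by blast
    from cases3[OF x(1) y(1) x(2) nx] obtain u v s where uv: "(u, v) \<in> N" "s = 1 \<or> s = - 1" "sg Q (poly q y) = s * sg Q (y - v)"
      using y B.zero_not_pos by auto
    then have "sg Q (y - v) = 0" using y by (auto simp: B.sg_0)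
    moreover have "v \<in> B.F" using uv by (auto simp: N_def)
    ultimately have "y = v" using B.sg_eq_0_iff[OF B.diff_mem[OF y(1)]] by auto
    then show ?thesis using uv(1) by (force simp: H_def)
  qed (auto simp: H_def)
  ultimately have "sign_diagram P Q H p q" by (auto simp: sign_diagram_def)
  then show ?thesis using mH by (intro exI[of _ H]) (auto simp: H_def)
qed

text \<open>
  A marked point at which no polynomial of the family vanishes can be dropped: none of them
  changes sign there, by the intermediate value property.
\<close>

lemma prune_diagram:
  assumes G: "matching P Q G"
    and S: "\<And>p q. (p, q) \<in> S \<Longrightarrow> p \<in> A.polys \<and> q \<in> B.polys \<and> sign_diagram P Q G p q \<and> (p = 0 \<longleftrightarrow> q = 0)"
  defines "H \<equiv> {(z, w) \<in> G. \<exists>p q. (p, q) \<in> S \<and> p \<noteq> 0 \<and> q \<noteq> 0 \<and> poly p z = 0 \<and> poly q w = 0}"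
  shows "matching P Q H" and "\<And>p q. (p, q) \<in> S \<Longrightarrow> sign_diagram P Q H p q"
proof -
  have HG: "H \<subseteq> G" by (auto simp: H_def)
  show mH: "matching P Q H"
    using G HG finite_subset[OF HG] unfolding matching_def by (meson subsetD)
  fix p q assume pq: "(p, q) \<in> S"
  show "sign_diagram P Q H p q"
  proof (cases "p = 0")
    case True
    then have "q = 0" using S[OF pq] by simp
    then show ?thesis using True by (simp add: sign_diagram_def aligned_def A.sg_0 B.sg_0)
  next
    case p0: False
    have q0: "q \<noteq> 0" and pp: "p \<in> A.polys" and qp: "q \<in> B.polys" and gd: "sign_diagram P Q G p q"
      using S[OF pq] p0 by auto
    have al: "sg P (poly p x) = sg Q (poly q y)" if "x \<in> A.F" "y \<in> B.F" "same_cell P Q G x y" for x y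
      using gd that by (auto simp: sign_diagram_def aligned_def)
    have zeros: "poly p z = 0 \<longleftrightarrow> poly q w = 0" if zw: "(z, w) \<in> G" for z w
    proof -
      have F: "z \<in> A.F" "w \<in> B.F" using zw G by (auto simp: matching_def)
      have "same_cell P Q G z w" using zw G by (auto simp: matching_def same_cell_def)
      then have "sg P (poly p z) = sg Q (poly q w)" using al F by blast
      then show ?thesis
        using A.sg_eq_0_iff[OF A.poly_mem[OF pp F(1)]] B.sg_eq_0_iff[OF B.poly_mem[OF qp F(2)]] by simp
    qed
    have rootsp: "x \<in> fst ` H" if x: "x \<in> A.F" "poly p x = 0" for x
    proof -
      have "x \<in> fst ` G" using gd p0 x by (auto simp: sign_diagram_def)
      then obtain w where "(x, w) \<in> G" by force
      then have "(x, w) \<in> H" using zeros x pq p0 q0 by (auto simp: H_def)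
      then show ?thesis by force
    qed
    have rootsq: "y \<in> snd ` H" if y: "y \<in> B.F" "poly q y = 0" for y
    proof -
      have "y \<in> snd ` G" using gd q0 y by (auto simp: sign_diagram_def)
      then obtain z where "(z, y) \<in> G" by force
      then have "(z, y) \<in> H" using zeros y pq p0 q0 by (auto simp: H_def)
      then show ?thesis by force
    qed
    have "aligned P Q H p q"
      unfolding aligned_def
    proof (intro ballI impI)
      fix x y assume xy: "x \<in> A.F" "y \<in> B.F" "same_cell P Q H x y"
      obtain y' where y': "y' \<in> B.F" "same_cell P Q G x y'" using partner_total[OF G xy(1)] by blast
      have H': "same_cell P Q H x y'" by (rule same_cell_mono[OF HG y'(2)])
      have "sg Q (poly q y) = sg Q (poly q y')"
      proof (rule ccontr)
        assume "\<not> ?thesis"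
        then obtain w where w: "w \<in> B.F" "poly q w = 0" "sg Q (y - w) \<noteq> sg Q (y' - w)"
          using B.sign_change_root[OF qp xy(2) y'(1)] by blast
        then obtain z where "(z, w) \<in> H" using rootsq by force
        then show False using w(3) xy(3) H' by (auto simp: same_cell_def)
      qed
      then show "sg P (poly p x) = sg Q (poly q y)" using al[OF xy(1) y'] by simp
    qed
    then show ?thesis using rootsp rootsq by (simp add: sign_diagram_def)
  qed
qed

end

section \<open>Elimination of one variable\<close>

text \<open>
  Polynomials are now lists of coefficients from a set \<open>E\<close> of formal expressions, and each pair
  in \<open>V\<close> evaluates these in both fields at once. The operations on \<open>E\<close> have to be correct only
  after evaluation, which is why they are required as existence statements.
\<close>

locale formal_coeffs = two_cones P Q
  for P :: "'x::field set" and Q :: "'y::field set" +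
  fixes E :: "'e set" and V :: "(('e \<Rightarrow> 'x) \<times> ('e \<Rightarrow> 'y)) set"
  assumes eval_mem: "\<And>u v e. (u, v) \<in> V \<Longrightarrow> e \<in> E \<Longrightarrow> u e \<in> A.F \<and> v e \<in> B.F"
    and add_ex: "\<And>a b. a \<in> E \<Longrightarrow> b \<in> E \<Longrightarrow> \<exists>c\<in>E. \<forall>u v. (u, v) \<in> V \<longrightarrow> u c = u a + u b \<and> v c = v a + v b"
    and mult_ex: "\<And>a b. a \<in> E \<Longrightarrow> b \<in> E \<Longrightarrow> \<exists>c\<in>E. \<forall>u v. (u, v) \<in> V \<longrightarrow> u c = u a * u b \<and> v c = v a * v b"
    and zero_ex: "\<exists>c\<in>E. \<forall>u v. (u, v) \<in> V \<longrightarrow> u c = 0 \<and> v c = 0"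
    and neg_ex: "\<exists>c\<in>E. \<forall>u v. (u, v) \<in> V \<longrightarrow> u c = - 1 \<and> v c = - 1"
begin

abbreviation ev_poly :: "('e \<Rightarrow> 'c) \<Rightarrow> 'e list \<Rightarrow> 'c::comm_ring_1 poly" where
  "ev_poly u f \<equiv> Poly (map u f)"

lemma formal_add:
  assumes "set f \<subseteq> E" "set g \<subseteq> E"
  shows "\<exists>h. set h \<subseteq> E \<and> length h = max (length f) (length g) \<and> (\<forall>u v. (u, v) \<in> V \<longrightarrow>
    ev_poly u h = ev_poly u f + ev_poly u g \<and> ev_poly v h = ev_poly v f + ev_poly v g)"
  using assms
proof (induction f g rule: list_induct2')
  case (4 a f b g)
  then obtain h where h: "set h \<subseteq> E" "length h = max (length f) (length g)" "\<forall>u v. (u, v) \<in> V \<longrightarrow>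
    ev_poly u h = ev_poly u f + ev_poly u g \<and> ev_poly v h = ev_poly v f + ev_poly v g" by auto
  obtain c where "c \<in> E" "\<forall>u v. (u, v) \<in> V \<longrightarrow> u c = u a + u b \<and> v c = v a + v b"
    using add_ex[of a b] 4 by auto
  then show ?case using h by (intro exI[of _ "c # h"]) auto
next
  case (2 a f) then show ?case by (intro exI[of _ "a # f"]) auto
next
  case (3 a f) then show ?case by (intro exI[of _ "a # f"]) auto
qed auto

lemma formal_smult:
  assumes "c \<in> E" "set f \<subseteq> E"
  shows "\<exists>h. set h \<subseteq> E \<and> length h = length f \<and> (\<forall>u v. (u, v) \<in> V \<longrightarrow>
    ev_poly u h = Polynomial.smult (u c) (ev_poly u f) \<and> ev_poly v h = Polynomial.smult (v c) (ev_poly v f))"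
  using assms(2)
proof (induction f)
  case (Cons a f)
  then obtain h where h: "set h \<subseteq> E" "length h = length f" "\<forall>u v. (u, v) \<in> V \<longrightarrow>
    ev_poly u h = Polynomial.smult (u c) (ev_poly u f) \<and> ev_poly v h = Polynomial.smult (v c) (ev_poly v f)" by auto
  obtain d where "d \<in> E" "\<forall>u v. (u, v) \<in> V \<longrightarrow> u d = u c * u a \<and> v d = v c * v a"
    using mult_ex[of c a] assms Cons.prems by auto
  then show ?case using h by (intro exI[of _ "d # h"]) auto
qed auto

lemma formal_shift:
  assumes "set f \<subseteq> E"
  shows "\<exists>h. set h \<subseteq> E \<and> length h = k + length f \<and> (\<forall>u v. (u, v) \<in> V \<longrightarrow>
    ev_poly u h = monom 1 k * ev_poly u f \<and> ev_poly v h = monom 1 k * ev_poly v f)"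
proof (induction k)
  case 0
  show ?case using assms by (intro exI[of _ f]) (auto simp: monom_0 one_pCons[symmetric])
next
  case (Suc k)
  then obtain h where h: "set h \<subseteq> E" "length h = k + length f" "\<forall>u v. (u, v) \<in> V \<longrightarrow>
    ev_poly u h = monom 1 k * ev_poly u f \<and> ev_poly v h = monom 1 k * ev_poly v f" by blast
  obtain z where "z \<in> E" "\<forall>u v. (u, v) \<in> V \<longrightarrow> u z = 0 \<and> v z = 0" using zero_ex by blast
  then show ?case using h by (intro exI[of _ "z # h"]) (auto simp: monom_Suc)
qed

lemma formal_mult:
  assumes "set f \<subseteq> E" "set g \<subseteq> E"
  shows "\<exists>h. set h \<subseteq> E \<and> (\<forall>u v. (u, v) \<in> V \<longrightarrow>
    ev_poly u h = ev_poly u f * ev_poly u g \<and> ev_poly v h = ev_poly v f * ev_poly v g)"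
  using assms(1)
proof (induction f)
  case (Cons a f)
  then obtain h where h: "set h \<subseteq> E" "\<forall>u v. (u, v) \<in> V \<longrightarrow>
    ev_poly u h = ev_poly u f * ev_poly u g \<and> ev_poly v h = ev_poly v f * ev_poly v g" by auto
  obtain h1 where h1: "set h1 \<subseteq> E" "\<forall>u v. (u, v) \<in> V \<longrightarrow>
    ev_poly u h1 = Polynomial.smult (u a) (ev_poly u g) \<and> ev_poly v h1 = Polynomial.smult (v a) (ev_poly v g)"
    using formal_smult[of a g] assms Cons.prems by auto
  obtain z where z: "z \<in> E" "\<forall>u v. (u, v) \<in> V \<longrightarrow> u z = 0 \<and> v z = 0" using zero_ex by blast
  obtain k where "set k \<subseteq> E" "\<forall>u v. (u, v) \<in> V \<longrightarrow>
    ev_poly u k = ev_poly u h1 + ev_poly u (z # h) \<and> ev_poly v k = ev_poly v h1 + ev_poly v (z # h)"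
    using formal_add[of h1 "z # h"] h1 h z by auto
  then show ?case using h h1 z by (intro exI[of _ k]) (auto simp: mult_pCons_left)
qed (intro exI[of _ "[]"], simp)

lemma formal_pderiv:
  "set f \<subseteq> E \<Longrightarrow> f \<noteq> [] \<Longrightarrow> \<exists>h. set h \<subseteq> E \<and> length h = length f - 1 \<and> (\<forall>u v. (u, v) \<in> V \<longrightarrow>
    ev_poly u h = pderiv (ev_poly u f) \<and> ev_poly v h = pderiv (ev_poly v f))"
proof (induction f)
  case (Cons a f)
  show ?case
  proof (cases "f = []")
    case True
    then show ?thesis by (intro exI[of _ "[]"]) (auto simp: pderiv_pCons)
  next
    case False
    then obtain h where h: "set h \<subseteq> E" "length h = length f - 1" "\<forall>u v. (u, v) \<in> V \<longrightarrow>
      ev_poly u h = pderiv (ev_poly u f) \<and> ev_poly v h = pderiv (ev_poly v f)" using Cons by auto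
    obtain z where z: "z \<in> E" "\<forall>u v. (u, v) \<in> V \<longrightarrow> u z = 0 \<and> v z = 0" using zero_ex by blast
    obtain k where "set k \<subseteq> E" "length k = max (length f) (length (z # h))" "\<forall>u v. (u, v) \<in> V \<longrightarrow>
      ev_poly u k = ev_poly u f + ev_poly u (z # h) \<and> ev_poly v k = ev_poly v f + ev_poly v (z # h)"
      using formal_add[of f "z # h"] h z Cons.prems by (metis insert_subset list.simps(15))
    then show ?thesis using h z False by (intro exI[of _ k]) (auto simp: pderiv_pCons)
  qed
qed simp

lemma top_coeff: "f \<noteq> [] \<Longrightarrow> coeff (ev_poly u f) (length f - 1) = u (last f)"
  by (simp add: nth_default_def last_conv_nth)

lemma butlast_zero_lead:
  assumes "f \<noteq> []" "u (last f) = 0"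
  shows "ev_poly u (butlast f) = ev_poly u f"
proof -
  have "map u (butlast f @ [last f]) = map u (butlast f) @ [0]" using assms(2) by simp
  then have "map u f = map u (butlast f) @ [0]" by (simp only: append_butlast_last_id[OF assms(1)])
  then show ?thesis by (simp only: Poly_snoc_zero)
qed

lemma ev_poly_polys:
  assumes "(u, v) \<in> V" "set f \<subseteq> E"
  shows "ev_poly u f \<in> A.polys" "ev_poly v f \<in> B.polys"
proof -
  have "ev_poly u f \<in> A.polys \<and> ev_poly v f \<in> B.polys" using assms(2)
  proof (induction f)
    case Nil
    show ?case by (simp add: A.zero_polys B.zero_polys)
  next
    case (Cons a f)
    then have "u a \<in> A.F \<and> v a \<in> B.F" by (intro eval_mem[OF assms(1)]) simp
    then show ?case using Cons by (simp add: A.pCons_polys_iff B.pCons_polys_iff)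
  qed
  then show "ev_poly u f \<in> A.polys" "ev_poly v f \<in> B.polys" by blast+
qed

text \<open>
  Nothing is asked where the formal leading coefficient of \<open>f\<close> evaluates to \<open>0\<close>: there \<open>f\<close> will
  be replaced by a shorter list.
\<close>

definition signed_remainder :: "'e list \<Rightarrow> 'e list \<Rightarrow> 'e list \<Rightarrow> bool" where
  "signed_remainder f p g \<longleftrightarrow> set g \<subseteq> E \<and> length g < length f \<and> (\<forall>u v. (u, v) \<in> V \<longrightarrow>
    (u (last f) \<noteq> 0 \<longrightarrow> (\<forall>z\<in>A.F. poly (ev_poly u f) z = 0 \<longrightarrow> sg P (poly (ev_poly u g) z) = sg P (poly (ev_poly u p) z))) \<and>
    (v (last f) \<noteq> 0 \<longrightarrow> (\<forall>z\<in>B.F. poly (ev_poly v f) z = 0 \<longrightarrow> sg Q (poly (ev_poly v g) z) = sg Q (poly (ev_poly v p) z))))"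

text \<open>
  Pseudo-division that multiplies by the square of the leading coefficient, so that no sign is
  lost.
\<close>

lemma formal_remainder:
  assumes f: "set f \<subseteq> E" "f \<noteq> []"
  shows "set p \<subseteq> E \<Longrightarrow> \<exists>g. signed_remainder f p g"
proof (induction "length p" arbitrary: p rule: less_induct)
  case less
  show ?case
  proof (cases "length p < length f")
    case True
    then show ?thesis using less.prems by (intro exI[of _ p]) (auto simp: signed_remainder_def)
  next
    case False
    then have pne: "p \<noteq> []" using f by auto
    define c d k where "c = last f" and "d = last p" and "k = length p - length f"
    have cd: "c \<in> E" "d \<in> E" using f pne less.prems by (auto simp: c_def d_def)
    obtain cc where cc: "cc \<in> E" "\<forall>u v. (u, v) \<in> V \<longrightarrow> u cc = u c * u c \<and> v cc = v c * v c"
      using mult_ex[OF cd(1,1)] by blast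
    obtain cdp where cdp: "cdp \<in> E" "\<forall>u v. (u, v) \<in> V \<longrightarrow> u cdp = u c * u d \<and> v cdp = v c * v d"
      using mult_ex[OF cd] by blast
    obtain m1 where m1: "m1 \<in> E" "\<forall>u v. (u, v) \<in> V \<longrightarrow> u m1 = - 1 \<and> v m1 = - 1" using neg_ex by blast
    obtain e where e: "e \<in> E" "\<forall>u v. (u, v) \<in> V \<longrightarrow> u e = u m1 * u cdp \<and> v e = v m1 * v cdp"
      using mult_ex[OF m1(1) cdp(1)] by blast
    have ee: "u e = - (u c * u d) \<and> v e = - (v c * v d)" if "(u, v) \<in> V" for u v
      using e(2)[rule_format, OF that] m1(2)[rule_format, OF that] cdp(2)[rule_format, OF that] by simp
    obtain h1 where h1: "set h1 \<subseteq> E" "length h1 = length p" "\<forall>u v. (u, v) \<in> V \<longrightarrow>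
      ev_poly u h1 = Polynomial.smult (u cc) (ev_poly u p) \<and> ev_poly v h1 = Polynomial.smult (v cc) (ev_poly v p)"
      using formal_smult[OF cc(1) less.prems] by blast
    obtain h2 where h2: "set h2 \<subseteq> E" "length h2 = k + length f" "\<forall>u v. (u, v) \<in> V \<longrightarrow>
      ev_poly u h2 = monom 1 k * ev_poly u f \<and> ev_poly v h2 = monom 1 k * ev_poly v f"
      using formal_shift[OF f(1), of k] by blast
    obtain h3 where h3: "set h3 \<subseteq> E" "length h3 = length h2" "\<forall>u v. (u, v) \<in> V \<longrightarrow>
      ev_poly u h3 = Polynomial.smult (u e) (ev_poly u h2) \<and> ev_poly v h3 = Polynomial.smult (v e) (ev_poly v h2)"
      using formal_smult[OF e(1) h2(1)] by blast
    obtain h where h: "set h \<subseteq> E" "length h = max (length h1) (length h3)" "\<forall>u v. (u, v) \<in> V \<longrightarrow>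
      ev_poly u h = ev_poly u h1 + ev_poly u h3 \<and> ev_poly v h = ev_poly v h1 + ev_poly v h3"
      using formal_add[OF h1(1) h3(1)] by blast
    have len: "length h = length p" using h(2) h1(2) h3(2) h2(2) False by (simp add: k_def)
    then have hne: "h \<noteq> []" using pne by auto
    have top: "coeff (ev_poly w p) (length p - 1) = w d" "coeff (monom 1 k * ev_poly w f) (length p - 1) = w c"
      for w :: "'e \<Rightarrow> 'c::comm_ring_1"
    proof -
      show "coeff (ev_poly w p) (length p - 1) = w d" unfolding d_def by (rule top_coeff[OF pne])
      have "length p - 1 - k = length f - 1" "k \<le> length p - 1"
        using False f by (auto simp: k_def length_greater_0_conv[symmetric] simp del: length_greater_0_conv)
      then show "coeff (monom 1 k * ev_poly w f) (length p - 1) = w c"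
        using top_coeff[OF f(2), of w] by (simp add: coeff_monom_mult c_def del: coeff_Poly_eq)
    qed
    have evh: "ev_poly u h = Polynomial.smult (u c * u c) (ev_poly u p) + Polynomial.smult (- (u c * u d)) (monom 1 k * ev_poly u f)"
      "ev_poly v h = Polynomial.smult (v c * v c) (ev_poly v p) + Polynomial.smult (- (v c * v d)) (monom 1 k * ev_poly v f)"
      if "(u, v) \<in> V" for u v
      using h(3)[rule_format, OF that] h3(3)[rule_format, OF that] h2(3)[rule_format, OF that]
        h1(3)[rule_format, OF that] cc(2)[rule_format, OF that] ee[OF that] by simp_all
    have "u (last h) = 0 \<and> v (last h) = 0" if V: "(u, v) \<in> V" for u v
      using top_coeff[OF hne, of u] top_coeff[OF hne, of v] unfolding len evh[OF V]
      by (simp add: top algebra_simps del: coeff_Poly_eq One_nat_def)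
    then have evb: "ev_poly u (butlast h) = ev_poly u h" "ev_poly v (butlast h) = ev_poly v h" if "(u, v) \<in> V" for u v
      using butlast_zero_lead[OF hne] that by blast+
    have "set (butlast h) \<subseteq> E" using h(1) by (meson in_set_butlastD subset_code(1))
    moreover have "length (butlast h) < length p" using len pne by (cases p) auto
    ultimately obtain g where g: "signed_remainder f (butlast h) g" using less.hyps[of "butlast h"] by blast
    have "sg P (poly (ev_poly u h) z) = sg P (poly (ev_poly u p) z)"
      if V: "(u, v) \<in> V" and "u (last f) \<noteq> 0" "poly (ev_poly u f) z = 0" for u v z
    proof -
      have "u c * u c \<in> P" using that eval_mem[OF V cd(1)] by (intro A.square_pos) (auto simp: c_def)
      moreover have "poly (ev_poly u h) z = (u c * u c) * poly (ev_poly u p) z"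
        using that(3) unfolding evh(1)[OF V] by simp
      ultimately show ?thesis using A.sg_mult_pos by metis
    qed
    moreover have "sg Q (poly (ev_poly v h) z) = sg Q (poly (ev_poly v p) z)"
      if V: "(u, v) \<in> V" and "v (last f) \<noteq> 0" "poly (ev_poly v f) z = 0" for u v z
    proof -
      have "v c * v c \<in> Q" using that eval_mem[OF V cd(1)] by (intro B.square_pos) (auto simp: c_def)
      moreover have "poly (ev_poly v h) z = (v c * v c) * poly (ev_poly v p) z"
        using that(3) unfolding evh(2)[OF V] by simp
      ultimately show ?thesis using B.sg_mult_pos by metis
    qed
    ultimately show ?thesis using g evb unfolding signed_remainder_def
      by (intro exI[of _ g]) (auto simp del: map_butlast)
  qed
qed

definition determines_diagram :: "'e set \<Rightarrow> 'e list multiset \<Rightarrow> bool" where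
  "determines_diagram S M \<longleftrightarrow> finite S \<and> S \<subseteq> E \<and>
    (\<forall>u v. (u, v) \<in> V \<longrightarrow> (\<forall>s\<in>S. sg P (u s) = sg Q (v s)) \<longrightarrow>
      (\<exists>G. matching P Q G \<and> (\<forall>f\<in>#M. sign_diagram P Q G (ev_poly u f) (ev_poly v f))))"

text \<open>
  Induction over the multiset of lengths. Either some formal leading coefficient vanishes and
  is dropped, or a longest polynomial \<open>p\<close> is replaced by its derivative and by its remainders
  modulo the other polynomials and modulo its derivative. At the roots of these the remainders
  have the signs of \<open>p\<close>, so \<open>diagram_from_derivative\<close> applies once all other marked points have
  been pruned. The coefficients whose signs were used in any of the cases are finite in number.
\<close>

theorem sign_diagram_exists:
  fixes M :: "'e list multiset"
  shows "(\<forall>f\<in>#M. set f \<subseteq> E) \<Longrightarrow> \<exists>S. determines_diagram S M"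
proof (induction M rule: wf_induct_rule[OF wf_mult[OF wf_measure[of length]]])
  case (1 M)
  note IH = 1(1) and ME = 1(2)
  show ?case
  proof (cases "\<forall>f\<in>#M. length f \<le> 1")
    case True
    define S where "S = (\<Union>f\<in>set_mset M. set f)"
    have "sign_diagram P Q {} (ev_poly u f) (ev_poly v f)"
      if V: "(u, v) \<in> V" "\<forall>s\<in>S. sg P (u s) = sg Q (v s)" and f: "f \<in># M" for u v f
    proof (cases f)
      case Nil
      then show ?thesis by (simp add: sign_diagram_def aligned_def A.sg_0 B.sg_0)
    next
      case (Cons a g)
      then have fa: "f = [a]" using True f by (cases g) auto
      then have "a \<in> S" using f by (force simp: S_def)
      then show ?thesis using V(2) fa by (auto simp: sign_diagram_def aligned_def)
    qed
    moreover have "matching P Q {}" by (simp add: matching_def)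
    ultimately show ?thesis using ME unfolding determines_diagram_def
      by (intro exI[of _ S]) (auto simp: S_def)
  next
    case False
    define n where "n = Max (length ` set_mset M)"
    have Mne: "M \<noteq> {#}" using False by auto
    then have "n \<in> length ` set_mset M" unfolding n_def by (intro Max_in) auto
    then obtain p where p: "p \<in># M" "length p = n" by auto
    have maxlen: "length f \<le> length p" if "f \<in># M" for f
      unfolding p(2) n_def using that by (intro Max_ge) auto
    have p2: "length p \<ge> 2" using False maxlen by force
    then have pne: "p \<noteq> []" by auto
    define N where "N = M - {#p#}"
    have MN: "M = N + {#p#}" using p by (simp add: N_def)
    have pE: "set p \<subseteq> E" using ME p by blast
    obtain dp where dp: "set dp \<subseteq> E" "length dp = length p - 1" "\<forall>u v. (u, v) \<in> V \<longrightarrow>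
      ev_poly u dp = pderiv (ev_poly u p) \<and> ev_poly v dp = pderiv (ev_poly v p)"
      using formal_pderiv[OF pE pne] by blast
    have dpne: "dp \<noteq> []" using dp(2) p2 by auto
    define R where "R f = (SOME g. signed_remainder f p g)" for f
    have R: "signed_remainder f p (R f)" if "set f \<subseteq> E" "f \<noteq> []" for f
      unfolding R_def by (rule someI_ex) (rule formal_remainder[OF that pE])
    have RE: "set (R f) \<subseteq> E" "length (R f) < length f" if "set f \<subseteq> E" "f \<noteq> []" for f
      using R[OF that] by (simp_all add: signed_remainder_def)
    define K where "K = {#dp#} + {#R dp#} + image_mset R (filter_mset (\<lambda>f. f \<noteq> []) N)"
    have NE: "set f \<subseteq> E" if "f \<in># N" for f using ME that by (auto simp: MN)
    have KE: "set f \<subseteq> E" if fK: "f \<in># K" for f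
    proof -
      consider "f = dp" | "f = R dp" | g where "f = R g" "g \<in># N" "g \<noteq> []" using fK by (auto simp: K_def)
      then show ?thesis
      proof cases
        case 3
        then show ?thesis using RE[OF NE[OF 3(2)] 3(3)] by simp
      qed (use dp(1) RE[OF dp(1) dpne] in auto)
    qed
    have "length k < length p" if k: "k \<in># K" for k
    proof -
      consider "k = dp" | "k = R dp" | f where "k = R f" "f \<in># N" "f \<noteq> []" using k by (auto simp: K_def)
      then show ?thesis
      proof cases
        case 3
        then show ?thesis using RE[OF NE[OF 3(2)] 3(3)] maxlen[of f] by (auto simp: MN)
      qed (use dp(2) p2 RE[OF dp(1) dpne] in auto)
    qed
    then have less3: "(N + K, M) \<in> mult (Wellfounded.measure length)"
      unfolding MN by (intro one_step_implies_mult) auto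
    have "\<exists>S. determines_diagram S (N + K)"
    proof (rule IH[OF less3], intro ballI)
      fix f assume "f \<in># N + K"
      then show "set f \<subseteq> E" using NE KE by (meson union_iff)
    qed
    then obtain S3 where S3: "determines_diagram S3 (N + K)" ..
    let ?M = "\<lambda>f. M - {#f#} + {#butlast f#}"
    have T_ex: "\<exists>S. determines_diagram S (?M f)"
      if f: "f \<in># M" "f \<noteq> []" for f
    proof (rule IH)
      have "(M - {#f#} + {#butlast f#}, M - {#f#} + {#f#}) \<in> mult (Wellfounded.measure length)"
        using f by (intro one_step_implies_mult) auto
      then show "(?M f, M) \<in> mult (Wellfounded.measure length)" using f by simp
      have "set f \<subseteq> E" using ME f by blast
      then have "set (butlast f) \<subseteq> E" by (meson in_set_butlastD subset_code(1))
      then show "\<forall>g\<in>#?M f. set g \<subseteq> E" using ME by (auto dest: in_diffD)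
    qed
    define T where "T f = (SOME S. determines_diagram S (?M f))" for f
    have T: "determines_diagram (T f) (?M f)" if "f \<in># M" "f \<noteq> []" for f
      unfolding T_def by (rule someI_ex) (rule T_ex[OF that])
    define L where "L = {f. f \<in># M \<and> f \<noteq> []}"
    have finL: "finite L" by (simp add: L_def)
    define S where "S = S3 \<union> (\<Union>f\<in>L. insert (last f) (T f))"
    have "finite S" unfolding S_def using S3 finL T by (auto simp: L_def determines_diagram_def)
    moreover have "S \<subseteq> E"
    proof -
      have "last f \<in> E" if "f \<in> L" for f using that ME by (auto simp: L_def dest: last_in_set)
      then show ?thesis unfolding S_def using S3 T by (auto simp: L_def determines_diagram_def)
    qed
    moreover have "\<exists>G. matching P Q G \<and> (\<forall>f\<in>#M. sign_diagram P Q G (ev_poly u f) (ev_poly v f))"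
      if V: "(u, v) \<in> V" and agree: "\<forall>s\<in>S. sg P (u s) = sg Q (v s)" for u v
    proof -
      have lead: "u (last f) = 0 \<longleftrightarrow> v (last f) = 0" if f: "f \<in> L" for f
      proof -
        have "last f \<in> E" using f ME by (auto simp: L_def dest: last_in_set)
        moreover have "sg P (u (last f)) = sg Q (v (last f))" using agree f by (auto simp: S_def)
        ultimately show ?thesis using eval_mem[OF V] A.sg_eq_0_iff B.sg_eq_0_iff by metis
      qed
      show ?thesis
      proof (cases "\<exists>f\<in>L. u (last f) = 0")
        case True
        then obtain f where f: "f \<in> L" "u (last f) = 0" by blast
        have fM: "f \<in># M" "f \<noteq> []" using f by (auto simp: L_def)
        have "\<forall>s\<in>T f. sg P (u s) = sg Q (v s)" using agree f by (auto simp: S_def)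
        then obtain G where G: "matching P Q G" "\<forall>g\<in>#?M f. sign_diagram P Q G (ev_poly u g) (ev_poly v g)"
          using T[OF fM] V unfolding determines_diagram_def by blast
        have "sign_diagram P Q G (ev_poly u g) (ev_poly v g)" if g: "g \<in># M" for g
        proof (cases "g = f")
          case True
          have "sign_diagram P Q G (ev_poly u (butlast f)) (ev_poly v (butlast f))" using G(2) by simp
          then show ?thesis
            using True butlast_zero_lead[OF fM(2), of u] butlast_zero_lead[OF fM(2), of v] f lead by simp
        next
          case False
          then have "g \<in># ?M f" using g using False by (simp add: in_diff_count)
          then show ?thesis using G(2) by blast
        qed
        then show ?thesis using G(1) by blast
      next
        case False
        then have un: "u (last f) \<noteq> 0" and vn: "v (last f) \<noteq> 0" if "f \<in> L" for f using lead that by auto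
        have "\<forall>s\<in>S3. sg P (u s) = sg Q (v s)" using agree by (auto simp: S_def)
        then obtain G where G: "matching P Q G" "\<forall>f\<in>#N + K. sign_diagram P Q G (ev_poly u f) (ev_poly v f)"
          using S3 V unfolding determines_diagram_def by blast
        have lastdp: "w (last dp) \<noteq> 0 \<and> pderiv (ev_poly w p) \<noteq> 0"
          if w: "ev_poly w dp = pderiv (ev_poly w p)" "w (last p) \<noteq> 0" "\<And>n. n > 0 \<Longrightarrow> of_nat n \<noteq> (0::'c)"
          for w :: "'e \<Rightarrow> 'c::field"
        proof -
          have "w (last dp) = coeff (ev_poly w dp) (length dp - 1)" using top_coeff[OF dpne] by metis
          also have "\<dots> = of_nat (length p - 1) * coeff (ev_poly w p) (length p - 1)"
            unfolding w(1) dp(2) coeff_pderiv using p2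
            by (simp add: Suc_diff_Suc numeral_2_eq_2 del: coeff_Poly_eq)
          also have "coeff (ev_poly w p) (length p - 1) = w (last p)" by (rule top_coeff[OF pne])
          finally have "w (last dp) \<noteq> 0" using w(2) w(3)[of "length p - 1"] p2 by simp
          moreover from this have "ev_poly w dp \<noteq> 0" using top_coeff[OF dpne, of w] by (metis coeff_0)
          ultimately show ?thesis using w(1) by simp
        qed
        have pL: "p \<in> L" using p pne by (simp add: L_def)
        have ud: "u (last dp) \<noteq> 0" "pderiv (ev_poly u p) \<noteq> 0"
          using lastdp[of u] dp(3) V un[OF pL] A.of_nat_neq_0 by blast+
        have vd: "v (last dp) \<noteq> 0" "pderiv (ev_poly v p) \<noteq> 0"
          using lastdp[of v] dp(3) V vn[OF pL] B.of_nat_neq_0 by blast+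
        define W where "W = {(ev_poly u f, ev_poly v f) | f. f \<in># N \<or> f = dp}"
        have W: "a \<in> A.polys \<and> b \<in> B.polys \<and> sign_diagram P Q G a b \<and> (a = 0 \<longleftrightarrow> b = 0)" if abW: "(a, b) \<in> W" for a b
        proof -
          obtain f where f: "a = ev_poly u f" "b = ev_poly v f" "f \<in># N \<or> f = dp" using abW by (auto simp: W_def)
          have "set f \<subseteq> E" using f NE dp(1) by blast
          moreover have "sign_diagram P Q G a b" using G(2) f by (auto simp: K_def)
          moreover have "a = 0 \<longleftrightarrow> b = 0"
          proof (cases "f = []")
            case ne: False
            have "u (last f) \<noteq> 0 \<and> v (last f) \<noteq> 0"
              using f(3) ud vd un[of f] vn[of f] ne by (auto simp: L_def MN)
            then show ?thesis using top_coeff[OF ne, of u] top_coeff[OF ne, of v] f(1,2) by (metis coeff_0)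
          qed (use f in simp)
          ultimately show ?thesis using ev_poly_polys[OF V] f by simp
        qed
        note pr = prune_diagram[OF G(1) W]
        define H where "H = {(z, w) \<in> G. \<exists>a b. (a, b) \<in> W \<and> a \<noteq> 0 \<and> b \<noteq> 0 \<and> poly a z = 0 \<and> poly b w = 0}"
        have mH: "matching P Q H" and gH: "\<And>a b. (a, b) \<in> W \<Longrightarrow> sign_diagram P Q H a b"
          using pr unfolding H_def by blast+
        have sgn: "sg P (poly (ev_poly u p) z) = sg Q (poly (ev_poly v p) w)" if zw: "(z, w) \<in> H" for z w
        proof -
          obtain f where f: "f \<in># N \<or> f = dp" "ev_poly u f \<noteq> 0" "poly (ev_poly u f) z = 0" "poly (ev_poly v f) w = 0"
            using zw unfolding H_def W_def by blast
          then have ne: "f \<noteq> []" by auto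
          have fE: "set f \<subseteq> E" using f NE dp(1) by blast
          have lf: "u (last f) \<noteq> 0" "v (last f) \<noteq> 0"
            using f(1) ud vd un[of f] vn[of f] ne by (auto simp: L_def MN)
          have zwG: "(z, w) \<in> G" using zw by (simp add: H_def)
          then have F: "z \<in> A.F" "w \<in> B.F" using G(1) by (auto simp: matching_def)
          have "same_cell P Q G z w" using zwG G(1) by (auto simp: matching_def same_cell_def)
          moreover have "R f \<in># N + K" using f(1) ne by (auto simp: K_def)
          then have "sign_diagram P Q G (ev_poly u (R f)) (ev_poly v (R f))" using G(2) by blast
          ultimately have "sg P (poly (ev_poly u (R f)) z) = sg Q (poly (ev_poly v (R f)) w)"
            using F by (auto simp: sign_diagram_def aligned_def)
          then show ?thesis using R[OF fE ne] V lf f F unfolding signed_remainder_def by metis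
        qed
        have "(ev_poly u dp, ev_poly v dp) \<in> W" by (auto simp: W_def)
        then have "sign_diagram P Q H (pderiv (ev_poly u p)) (pderiv (ev_poly v p))" using gH dp(3) V by metis
        then obtain H' where H': "H \<subseteq> H'" "matching P Q H'" "sign_diagram P Q H' (ev_poly u p) (ev_poly v p)"
          using diagram_from_derivative[OF mH ev_poly_polys[OF V pE] _ ud(2) vd(2) sgn] by blast
        have "sign_diagram P Q H' (ev_poly u f) (ev_poly v f)" if f: "f \<in># M" for f
        proof (cases "f = p")
          case False
          then have "(ev_poly u f, ev_poly v f) \<in> W" using f by (auto simp: W_def MN)
          then show ?thesis using gH sign_diagram_mono[OF H'(1)] by blast
        qed (use H' in simp)
        then show ?thesis using H'(2) by blast
      qed
    qed
    ultimately show ?thesis unfolding determines_diagram_def by blast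
  qed
qed

end

section \<open>Polynomial expressions and the transfer principle\<close>

text \<open>
  Expressions take the place of multivariate polynomials: they can be evaluated in any field
  that receives the coefficients, and no ring laws are needed for the expressions themselves.
\<close>

datatype (pcoeffs: 'c, pvars: 'v) pexp =
  Const 'c | Var 'v | Add "('c, 'v) pexp" "('c, 'v) pexp" | Mult "('c, 'v) pexp" "('c, 'v) pexp"

primrec ev :: "('c \<Rightarrow> 'x::comm_ring_1) \<Rightarrow> ('v \<Rightarrow> 'x) \<Rightarrow> ('c, 'v) pexp \<Rightarrow> 'x" where
  "ev h x (Const c) = h c"
| "ev h x (Var v) = x v"
| "ev h x (Add a b) = ev h x a + ev h x b"
| "ev h x (Mult a b) = ev h x a * ev h x b"

definition pexps :: "'c set \<Rightarrow> 'v set \<Rightarrow> ('c, 'v) pexp set" where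
  "pexps B W = {e. pcoeffs e \<subseteq> B \<and> pvars e \<subseteq> W}"

lemma pexps_simps [simp]:
  "Const c \<in> pexps B W \<longleftrightarrow> c \<in> B"
  "Var v \<in> pexps B W \<longleftrightarrow> v \<in> W"
  "Add a b \<in> pexps B W \<longleftrightarrow> a \<in> pexps B W \<and> b \<in> pexps B W"
  "Mult a b \<in> pexps B W \<longleftrightarrow> a \<in> pexps B W \<and> b \<in> pexps B W"
  by (auto simp: pexps_def)

lemma ev_cong: "e \<in> pexps B W \<Longrightarrow> (\<And>v. v \<in> W \<Longrightarrow> x v = y v) \<Longrightarrow> ev h x e = ev h y e"
  by (induction e) auto

lemma (in comm_ring_hom) hom_ev: "hom (ev h x e) = ev (hom \<circ> h) (hom \<circ> x) e"
  by (induction e) (auto simp: hom_add hom_mult)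

lemma (in subfld) ev_mem:
  "e \<in> pexps B W \<Longrightarrow> (\<And>b. b \<in> B \<Longrightarrow> h b \<in> F) \<Longrightarrow> (\<And>v. v \<in> W \<Longrightarrow> x v \<in> F) \<Longrightarrow> ev h x e \<in> F"
  by (induction e) (auto intro: add_mem mult_mem)

text \<open>
  Induction over the variables. Read as polynomials in one variable \<open>v\<close>, the expressions have
  coefficients in the remaining variables, and the signs of finitely many of these determine a
  sign diagram. By induction these signs are realized at some \<open>x\<close>, and the diagram provides a
  value for \<open>v\<close> in the same position as \<open>y v\<close>.
\<close>

theorem transfer_principle:
  fixes i :: "'k::field \<Rightarrow> 'x::field" and j :: "'k \<Rightarrow> 'y::field" and y :: "'v \<Rightarrow> 'y"
  assumes rc: "real_closed_cone P" "real_closed_cone Q" and B: "subfld B"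
    and hom: "comm_ring_hom i" "comm_ring_hom j"
    and mem: "\<And>b. b \<in> B \<Longrightarrow> i b \<in> cone_field P" "\<And>b. b \<in> B \<Longrightarrow> j b \<in> cone_field Q"
    and sgn: "\<And>b. b \<in> B \<Longrightarrow> sg P (i b) = sg Q (j b)"
    and W: "finite W" and S: "finite S" "S \<subseteq> pexps B W" and y: "\<And>w. y w \<in> cone_field Q"
  shows "\<exists>x. (\<forall>w. x w \<in> cone_field P) \<and> (\<forall>e\<in>S. sg P (ev i x e) = sg Q (ev j y e))"
  using W S
proof (induction W arbitrary: S)
  case empty
  interpret B: subfld B by fact
  interpret A: real_closed_cone P by fact
  interpret i: comm_ring_hom i by fact
  interpret j: comm_ring_hom j by fact
  have "sg P (ev i (\<lambda>_. 0) e) = sg Q (ev j y e)" if "e \<in> S" for e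
  proof -
    have e: "e \<in> pexps B {}" using that empty by blast
    have "ev id (\<lambda>_. 0) e \<in> B" using e by (rule B.ev_mem) auto
    moreover have "i (ev id (\<lambda>_. 0) e) = ev i (\<lambda>_. 0) e" "j (ev id (\<lambda>_. 0) e) = ev j y e"
      unfolding i.hom_ev j.hom_ev using e by (auto intro!: ev_cong)
    ultimately show ?thesis using sgn by metis
  qed
  then show ?case using A.zero_mem by (intro exI[of _ "\<lambda>_. 0"]) auto
next
  case (insert v W)
  interpret B: subfld B by fact
  interpret i: comm_ring_hom i by fact
  interpret j: comm_ring_hom j by fact
  define V where "V = {(ev i x, ev j y) | (x :: 'v \<Rightarrow> 'x) (y :: 'v \<Rightarrow> 'y). (\<forall>w. x w \<in> cone_field P) \<and> (\<forall>w. y w \<in> cone_field Q)}"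
  interpret A: real_closed_cone P by fact
  interpret Q: real_closed_cone Q by fact
  interpret fc: formal_coeffs P Q "pexps B W" V
  proof
    show "u e \<in> cone_field P \<and> w e \<in> cone_field Q" if V: "(u, w) \<in> V" and e: "e \<in> pexps B W" for u w e
    proof -
      obtain x y where xy: "u = ev i x" "w = ev j y" "\<forall>w. x w \<in> cone_field P" "\<forall>w. y w \<in> cone_field Q"
        using V unfolding V_def by blast
      show ?thesis using A.ev_mem[OF e mem(1)] Q.ev_mem[OF e mem(2)] xy by simp
    qed
    show "\<exists>c\<in>pexps B W. \<forall>u w. (u, w) \<in> V \<longrightarrow> u c = u a + u b \<and> w c = w a + w b"
      if "a \<in> pexps B W" "b \<in> pexps B W" for a b
      using that by (intro bexI[of _ "Add a b"]) (auto simp: V_def)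
    show "\<exists>c\<in>pexps B W. \<forall>u w. (u, w) \<in> V \<longrightarrow> u c = u a * u b \<and> w c = w a * w b"
      if "a \<in> pexps B W" "b \<in> pexps B W" for a b
      using that by (intro bexI[of _ "Mult a b"]) (auto simp: V_def)
    show "\<exists>c\<in>pexps B W. \<forall>u w. (u, w) \<in> V \<longrightarrow> u c = 0 \<and> w c = 0"
      using B.zero_mem by (intro bexI[of _ "Const 0"]) (auto simp: V_def)
    show "\<exists>c\<in>pexps B W. \<forall>u w. (u, w) \<in> V \<longrightarrow> u c = - 1 \<and> w c = - 1"
      using B.uminus_mem[OF B.one_mem] by (intro bexI[of _ "Const (- 1)"]) (auto simp: V_def i.hom_uminus j.hom_uminus)
  qed
  let ?rep = "\<lambda>e f. set f \<subseteq> pexps B W \<and> (\<forall>x y s t. (\<forall>w. x w \<in> cone_field P) \<longrightarrow> (\<forall>w. y w \<in> cone_field Q) \<longrightarrow>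
    ev i (x(v := s)) e = poly (fc.ev_poly (ev i x) f) s \<and> ev j (y(v := t)) e = poly (fc.ev_poly (ev j y) f) t)"
  have rep: "\<exists>f. ?rep e f" if "e \<in> pexps B (insert v W)" for e
    using that
  proof (induction e)
    case (Const c)
    then show ?case by (intro exI[of _ "[Const c]"]) auto
  next
    case (Var w)
    show ?case
    proof (cases "w = v")
      case True
      then show ?thesis using B.zero_mem B.one_mem by (intro exI[of _ "[Const 0, Const 1]"]) auto
    next
      case False
      then show ?thesis using Var by (intro exI[of _ "[Var w]"]) auto
    qed
  next
    case (Add a b)
    have "\<exists>f. ?rep a f" by (rule Add.IH(1)) (use Add.prems in simp)
    then obtain f where f: "?rep a f" by (elim exE)
    have "\<exists>f. ?rep b f" by (rule Add.IH(2)) (use Add.prems in simp)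
    then obtain g where g: "?rep b g" by (elim exE)
    obtain h where h: "set h \<subseteq> pexps B W" "\<forall>u w. (u, w) \<in> V \<longrightarrow>
      fc.ev_poly u h = fc.ev_poly u f + fc.ev_poly u g \<and> fc.ev_poly w h = fc.ev_poly w f + fc.ev_poly w g"
      using fc.formal_add[of f g] f g by blast
    show ?case
    proof (intro exI[of _ h] conjI allI impI)
      show "set h \<subseteq> pexps B W" by (rule h(1))
      fix x :: "'v \<Rightarrow> 'x" and y :: "'v \<Rightarrow> 'y" and s t
      assume xy: "\<forall>w. x w \<in> cone_field P" "\<forall>w. y w \<in> cone_field Q"
      then have "(ev i x, ev j y) \<in> V" unfolding V_def by blast
      note hV = h(2)[rule_format, OF this]
      note fg = f[THEN conjunct2, rule_format, of x y s t] g[THEN conjunct2, rule_format, of x y s t]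
      show "ev i (x(v := s)) (Add a b) = poly (fc.ev_poly (ev i x) h) s"
        and "ev j (y(v := t)) (Add a b) = poly (fc.ev_poly (ev j y) h) t"
        using fg xy hV by simp_all
    qed
  next
    case (Mult a b)
    have "\<exists>f. ?rep a f" by (rule Mult.IH(1)) (use Mult.prems in simp)
    then obtain f where f: "?rep a f" by (elim exE)
    have "\<exists>f. ?rep b f" by (rule Mult.IH(2)) (use Mult.prems in simp)
    then obtain g where g: "?rep b g" by (elim exE)
    obtain h where h: "set h \<subseteq> pexps B W" "\<forall>u w. (u, w) \<in> V \<longrightarrow>
      fc.ev_poly u h = fc.ev_poly u f * fc.ev_poly u g \<and> fc.ev_poly w h = fc.ev_poly w f * fc.ev_poly w g"
      using fc.formal_mult[of f g] f g by blast
    show ?case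
    proof (intro exI[of _ h] conjI allI impI)
      show "set h \<subseteq> pexps B W" by (rule h(1))
      fix x :: "'v \<Rightarrow> 'x" and y :: "'v \<Rightarrow> 'y" and s t
      assume xy: "\<forall>w. x w \<in> cone_field P" "\<forall>w. y w \<in> cone_field Q"
      then have "(ev i x, ev j y) \<in> V" unfolding V_def by blast
      note hV = h(2)[rule_format, OF this]
      note fg = f[THEN conjunct2, rule_format, of x y s t] g[THEN conjunct2, rule_format, of x y s t]
      show "ev i (x(v := s)) (Mult a b) = poly (fc.ev_poly (ev i x) h) s"
        and "ev j (y(v := t)) (Mult a b) = poly (fc.ev_poly (ev j y) h) t"
        using fg xy hV by simp_all
    qed
  qed
  define f where "f e = (SOME f. ?rep e f)" for e
  have f: "?rep e (f e)" if "e \<in> S" for e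
  proof -
    have "e \<in> pexps B (insert v W)" using insert.prems that by blast
    then show ?thesis unfolding f_def by (rule someI_ex[OF rep])
  qed
  have "\<forall>g\<in>#image_mset f (mset_set S). set g \<subseteq> pexps B W"
    using f insert.prems(1) by auto
  from fc.sign_diagram_exists[OF this] obtain S' where S'_all: "fc.determines_diagram S' (image_mset f (mset_set S))" ..
  then have S': "finite S'" "S' \<subseteq> pexps B W" by (simp_all add: fc.determines_diagram_def)
  obtain x where x: "\<forall>w. x w \<in> cone_field P" "\<forall>e\<in>S'. sg P (ev i x e) = sg Q (ev j y e)"
    using insert.IH[OF S'(1,2)] by blast
  have "(ev i x, ev j y) \<in> V" unfolding V_def using x(1) y by (intro CollectI exI[of _ x] exI[of _ y] conjI) auto
  then have "\<exists>G. matching P Q G \<and>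
      (\<forall>g\<in>#image_mset f (mset_set S). sign_diagram P Q G (fc.ev_poly (ev i x) g) (fc.ev_poly (ev j y) g))"
    using S'_all x(2) unfolding fc.determines_diagram_def by blast
  then obtain G where G0: "matching P Q G \<and>
      (\<forall>g\<in>#image_mset f (mset_set S). sign_diagram P Q G (fc.ev_poly (ev i x) g) (fc.ev_poly (ev j y) g))" ..
  then have G: "matching P Q G" "\<And>e. e \<in> S \<Longrightarrow> sign_diagram P Q G (fc.ev_poly (ev i x) (f e)) (fc.ev_poly (ev j y) (f e))"
    using insert.prems(1) by auto
  obtain s where s: "s \<in> cone_field P" "same_cell P Q G s (y v)"
    using fc.partner_total'[OF G(1) y] by blast
  have "sg P (ev i (x(v := s)) e) = sg Q (ev j y e)" if e: "e \<in> S" for e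
  proof -
    have "sg P (poly (fc.ev_poly (ev i x) (f e)) s) = sg Q (poly (fc.ev_poly (ev j y) (f e)) (y v))"
      using G(2)[OF e] s y by (auto simp: sign_diagram_def aligned_def)
    moreover have "ev i (x(v := s)) e = poly (fc.ev_poly (ev i x) (f e)) s"
      and "ev j (y(v := y v)) e = poly (fc.ev_poly (ev j y) (f e)) (y v)"
      using f[OF e] x(1) y by blast+
    ultimately show ?thesis by simp
  qed
  moreover have "\<forall>w. (x(v := s)) w \<in> cone_field P" using x(1) s(1) by simp
  ultimately show ?case by blast
qed

section \<open>Hilbert's basis theorem\<close>

definition is_subring :: "'a::comm_ring_1 set \<Rightarrow> bool" where
  "is_subring A \<longleftrightarrow> 1 \<in> A \<and> (\<forall>x\<in>A. \<forall>y\<in>A. x + y \<in> A \<and> x * y \<in> A \<and> - x \<in> A)"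

definition combinations :: "'a::comm_ring_1 set \<Rightarrow> (nat \<Rightarrow> 'a) \<Rightarrow> nat \<Rightarrow> 'a set" where
  "combinations A g n = {\<Sum>k<n. c k * g k | c. \<forall>k. c k \<in> A}"

text \<open>
  The ascending chain condition for ideals generated by initial segments of sequences: this
  form is both what the proof of the basis theorem uses and what the application needs.
\<close>

definition noetherian :: "'a::comm_ring_1 set \<Rightarrow> bool" where
  "noetherian A \<longleftrightarrow> (\<forall>g. (\<forall>n. g n \<in> A) \<longrightarrow> (\<exists>n. g n \<in> combinations A g n))"

definition adjoin :: "'a::comm_ring_1 set \<Rightarrow> 'a \<Rightarrow> 'a set" where
  "adjoin A t = {poly p t | p. \<forall>i. coeff p i \<in> A}"

context
  fixes A :: "'a::comm_ring_1 set"
  assumes A: "is_subring A"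
begin

lemma subring_mem:
  "1 \<in> A" "0 \<in> A" "x \<in> A \<Longrightarrow> y \<in> A \<Longrightarrow> x + y \<in> A" "x \<in> A \<Longrightarrow> y \<in> A \<Longrightarrow> x * y \<in> A"
  "x \<in> A \<Longrightarrow> - x \<in> A" "x \<in> A \<Longrightarrow> y \<in> A \<Longrightarrow> x - y \<in> A"
proof -
  show 1: "1 \<in> A" "x \<in> A \<Longrightarrow> y \<in> A \<Longrightarrow> x + y \<in> A" "x \<in> A \<Longrightarrow> y \<in> A \<Longrightarrow> x * y \<in> A" "x \<in> A \<Longrightarrow> - x \<in> A" for x y
    using A unfolding is_subring_def by blast+
  show "0 \<in> A" using 1(2)[OF 1(1) 1(4)[OF 1(1)]] by simp
  show "x \<in> A \<Longrightarrow> y \<in> A \<Longrightarrow> x - y \<in> A" using 1(2)[of x "- y"] 1(4)[of y] by simp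
qed

lemma subring_sum: "(\<And>i. i \<in> I \<Longrightarrow> f i \<in> A) \<Longrightarrow> sum f I \<in> A"
  by (induction I rule: infinite_finite_induct) (auto intro: subring_mem)

lemma combinations_add:
  assumes "x \<in> combinations A g n" "y \<in> combinations A g n"
  shows "x + y \<in> combinations A g n"
proof -
  obtain c where c: "x = (\<Sum>k<n. c k * g k)" "\<forall>k. c k \<in> A" using assms(1) unfolding combinations_def by blast
  obtain d where d: "y = (\<Sum>k<n. d k * g k)" "\<forall>k. d k \<in> A" using assms(2) unfolding combinations_def by blast
  have "x + y = (\<Sum>k<n. (c k + d k) * g k)" using c d by (simp add: sum.distrib distrib_right)
  then show ?thesis unfolding combinations_def using c d subring_mem by (intro CollectI exI[of _ "\<lambda>k. c k + d k"]) auto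
qed

lemma combinations_mult:
  assumes "a \<in> A" "x \<in> combinations A g n"
  shows "a * x \<in> combinations A g n"
proof -
  obtain c where c: "x = (\<Sum>k<n. c k * g k)" "\<forall>k. c k \<in> A" using assms(2) unfolding combinations_def by blast
  have "a * x = (\<Sum>k<n. (a * c k) * g k)" using c by (simp add: sum_distrib_left mult.assoc)
  then show ?thesis unfolding combinations_def using c assms subring_mem by (intro CollectI exI[of _ "\<lambda>k. a * c k"]) auto
qed

lemma combinations_zero: "0 \<in> combinations A g n"
  unfolding combinations_def using subring_mem by (intro CollectI exI[of _ "\<lambda>_. 0"]) auto

lemma combinations_sum: "(\<And>i. i \<in> I \<Longrightarrow> f i \<in> combinations A g n) \<Longrightarrow> sum f I \<in> combinations A g n"
  by (induction I rule: infinite_finite_induct) (auto intro: combinations_zero combinations_add)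

lemma combinations_diff: "x \<in> combinations A g n \<Longrightarrow> y \<in> combinations A g n \<Longrightarrow> x - y \<in> combinations A g n"
  using combinations_add[of x g n "- 1 * y"] combinations_mult[of "- 1" y] subring_mem by simp

lemma combinations_incl: assumes "k < n" shows "g k \<in> combinations A g n"
proof -
  have "(\<Sum>l<n. (if l = k then 1 else 0) * g l) = (\<Sum>l<n. if l = k then g l else 0)"
    by (rule sum.cong) auto
  also have "\<dots> = g k" using assms by simp
  finally have "g k = (\<Sum>l<n. (if l = k then 1 else 0) * g l)" by simp
  then show ?thesis unfolding combinations_def using subring_mem
    by (intro CollectI exI[of _ "\<lambda>l. if l = k then 1 else 0"]) auto
qed

lemma combinations_subset:
  assumes "\<And>k. k < n \<Longrightarrow> g k \<in> combinations A f m"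
  shows "combinations A g n \<subseteq> combinations A f m"
proof
  fix x assume "x \<in> combinations A g n"
  then obtain c where c: "x = (\<Sum>k<n. c k * g k)" "\<forall>k. c k \<in> A" unfolding combinations_def by blast
  show "x \<in> combinations A f m" unfolding c(1) using c(2) assms by (intro combinations_sum combinations_mult) auto
qed

lemma combinations_mono: "n \<le> m \<Longrightarrow> combinations A g n \<subseteq> combinations A g m"
  by (rule combinations_subset) (auto intro: combinations_incl)

lemma adjoin_subring: "is_subring (adjoin A t)"
  unfolding is_subring_def
proof (intro conjI ballI)
  show "1 \<in> adjoin A t" unfolding adjoin_def using subring_mem
    by (intro CollectI exI[of _ 1]) (auto simp: coeff_1)
  fix x y assume "x \<in> adjoin A t" "y \<in> adjoin A t"
  then obtain p q where p: "x = poly p t" "\<forall>i. coeff p i \<in> A" and q: "y = poly q t" "\<forall>i. coeff q i \<in> A"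
    unfolding adjoin_def by blast
  show "x + y \<in> adjoin A t" unfolding adjoin_def using p q subring_mem
    by (intro CollectI exI[of _ "p + q"]) auto
  show "- x \<in> adjoin A t" unfolding adjoin_def using p subring_mem
    by (intro CollectI exI[of _ "- p"]) auto
  have "\<forall>i. coeff (p * q) i \<in> A" unfolding coeff_mult using p q subring_mem by (intro allI subring_sum) auto
  then show "x * y \<in> adjoin A t" unfolding adjoin_def using p q
    by (intro CollectI exI[of _ "p * q"]) auto
qed

lemma adjoin_incl: "A \<subseteq> adjoin A t" "t \<in> adjoin A t"
proof -
  show "A \<subseteq> adjoin A t"
  proof
    fix a assume "a \<in> A"
    then show "a \<in> adjoin A t" unfolding adjoin_def using subring_mem
      by (intro CollectI exI[of _ "[:a:]"]) (auto simp: coeff_pCons split: nat.splits)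
  qed
  show "t \<in> adjoin A t" unfolding adjoin_def using subring_mem
    by (intro CollectI exI[of _ "[:0, 1:]"]) (auto simp: coeff_pCons split: nat.splits)
qed

end

text \<open>
  Given a sequence refuting the claim for \<open>A[t]\<close>, choose polynomials \<open>p n\<close> of least degree
  whose values lie in its ideal but not in the ideal of the values before. Their leading
  coefficients satisfy the chain condition in \<open>A\<close>, and cancelling a leading term contradicts
  minimality.
\<close>

theorem hilbert_basis:
  fixes A :: "'a::comm_ring_1 set"
  assumes A: "is_subring A" and noeth: "noetherian A"
  shows "noetherian (adjoin A t)"
  unfolding noetherian_def
proof (intro allI impI, rule ccontr)
  fix f assume fA: "\<forall>n. f n \<in> adjoin A t" and "\<nexists>n. f n \<in> combinations (adjoin A t) f n"
  then have nf: "\<And>n. f n \<notin> combinations (adjoin A t) f n" by blast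
  let ?R = "adjoin A t"
  note R = adjoin_subring[OF A, of t]
  define I where "I = (\<Union>n. combinations ?R f n)"
  let ?A = "\<lambda>p. \<forall>i. coeff p i \<in> A"
  let ?new = "\<lambda>p n q. ?A q \<and> poly q t \<in> I \<and> poly q t \<notin> combinations ?R (\<lambda>k. poly (p k) t) n"
  have bounded: "\<exists>m. \<forall>k<n. g k \<in> combinations ?R f m" if "\<And>k. k < n \<Longrightarrow> g k \<in> I" for g and n :: nat
    using that
  proof (induction n)
    case (Suc n)
    then obtain m where m: "\<forall>k<n. g k \<in> combinations ?R f m" by force
    obtain m' where m': "g n \<in> combinations ?R f m'" using Suc.prems[of n] by (auto simp: I_def)
    have "g k \<in> combinations ?R f (max m m')" if "k < Suc n" for k
      using that m m' combinations_mono[OF R, of m "max m m'" f] combinations_mono[OF R, of m' "max m m'" f]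
      by (auto simp: less_Suc_eq)
    then show ?case by blast
  qed simp
  have ex: "\<exists>q. ?new p n q" if "\<And>k. k < n \<Longrightarrow> poly (p k) t \<in> I" for p n
  proof -
    obtain m where "\<forall>k<n. poly (p k) t \<in> combinations ?R f m"
      using bounded[of n "\<lambda>k. poly (p k) t"] \<open>\<And>k. k < n \<Longrightarrow> poly (p k) t \<in> I\<close> by blast
    then have "combinations ?R (\<lambda>k. poly (p k) t) n \<subseteq> combinations ?R f m"
      by (intro combinations_subset[OF R]) auto
    then have "f m \<notin> combinations ?R (\<lambda>k. poly (p k) t) n" using nf by blast
    moreover have "f m \<in> I" using combinations_incl[OF R, of m "Suc m" f] by (auto simp: I_def)
    moreover obtain q where "?A q" "f m = poly q t" using fA unfolding adjoin_def by blast
    ultimately show ?thesis by metis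
  qed
  have "\<exists>p. \<forall>n. ?new p n (p n) \<and> (\<forall>q. ?new p n q \<longrightarrow> Polynomial.degree (p n) \<le> Polynomial.degree q)"
  proof (rule dependent_wellorder_choice[where
      P = "\<lambda>p n r. ?new p n r \<and> (\<forall>q. ?new p n q \<longrightarrow> Polynomial.degree r \<le> Polynomial.degree q)"])
    fix r :: "'a poly" and p g :: "nat \<Rightarrow> 'a poly" and n :: nat
    assume "\<And>k. k < n \<Longrightarrow> p k = g k"
    then have "combinations ?R (\<lambda>k. poly (p k) t) n = combinations ?R (\<lambda>k. poly (g k) t) n"
      unfolding combinations_def by simp
    then show "(?new p n r \<and> (\<forall>q. ?new p n q \<longrightarrow> Polynomial.degree r \<le> Polynomial.degree q)) =
      (?new g n r \<and> (\<forall>q. ?new g n q \<longrightarrow> Polynomial.degree r \<le> Polynomial.degree q))" by simp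
  next
    fix n p
    assume "\<And>k. k < n \<Longrightarrow> ?new p k (p k) \<and> (\<forall>q. ?new p k q \<longrightarrow> Polynomial.degree (p k) \<le> Polynomial.degree q)"
    then have "\<exists>q. ?new p n q" by (intro ex) blast
    then show "\<exists>r. ?new p n r \<and> (\<forall>q. ?new p n q \<longrightarrow> Polynomial.degree r \<le> Polynomial.degree q)"
      using ex_has_least_nat[of "?new p n" _ Polynomial.degree] by blast
  qed
  then obtain p where p: "\<And>n. ?new p n (p n)"
    and min: "\<And>n q. ?new p n q \<Longrightarrow> Polynomial.degree (p n) \<le> Polynomial.degree q" by blast
  obtain N where N: "Polynomial.lead_coeff (p N) \<in> combinations A (\<lambda>n. Polynomial.lead_coeff (p n)) N"
  proof -
    have "\<exists>n. Polynomial.lead_coeff (p n) \<in> combinations A (\<lambda>n. Polynomial.lead_coeff (p n)) n"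
    proof (rule noeth[unfolded noetherian_def, rule_format])
      show "Polynomial.lead_coeff (p n) \<in> A" for n using p[of n] by simp
    qed
    then show thesis using that by blast
  qed
  then obtain c where c: "Polynomial.lead_coeff (p N) = (\<Sum>k<N. c k * Polynomial.lead_coeff (p k))" "\<forall>k. c k \<in> A"
    unfolding combinations_def by blast
  define d where "d k = Polynomial.degree (p k)" for k
  define s where "s k = Polynomial.smult (c k) (monom 1 (d N - d k) * p k)" for k
  define q where "q = p N - (\<Sum>k<N. s k)"
  have dle: "d k \<le> d N" if "k < N" for k
  proof -
    have "combinations ?R (\<lambda>k. poly (p k) t) k \<subseteq> combinations ?R (\<lambda>k. poly (p k) t) N"
      using that by (intro combinations_mono[OF R]) simp
    then show ?thesis unfolding d_def using p[of N] by (intro min) blast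
  qed
  have sA: "?A (s k)" for k
  proof
    fix i
    have "coeff (p k) l \<in> A" "c k \<in> A" for l using p[of k] c(2) by blast+
    then show "coeff (s k) i \<in> A"
      using subring_mem(2)[OF A] by (auto simp: s_def coeff_monom_mult intro: subring_mem(4)[OF A])
  qed
  have sdeg: "Polynomial.degree (s k) \<le> d N" and slead: "coeff (s k) (d N) = c k * Polynomial.lead_coeff (p k)" if "k < N" for k
  proof -
    have "Polynomial.degree (s k) \<le> Polynomial.degree (monom (1::'a) (d N - d k) * p k)" unfolding s_def by (rule degree_smult_le)
    also have "\<dots> \<le> Polynomial.degree (monom (1::'a) (d N - d k)) + d k" unfolding d_def by (rule degree_mult_le)
    also have "\<dots> \<le> d N" using degree_monom_le[of "1::'a" "d N - d k"] dle[OF that] by simp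
    finally show "Polynomial.degree (s k) \<le> d N" .
    show "coeff (s k) (d N) = c k * Polynomial.lead_coeff (p k)"
      using dle[OF that] by (simp add: s_def coeff_monom_mult d_def)
  qed
  have qA: "?A q" unfolding q_def coeff_diff coeff_sum
    using p[of N] sA by (intro allI subring_mem[OF A] subring_sum[OF A]) auto
  have "Polynomial.degree q \<le> d N" unfolding q_def
    using sdeg by (intro degree_diff_le degree_sum_le) (auto simp: d_def)
  moreover have "coeff q (d N) = 0" unfolding q_def using slead c(1) by (simp add: coeff_sum d_def)
  ultimately have qdeg: "q = 0 \<or> Polynomial.degree q < d N"
    by (metis le_neq_implies_less leading_coeff_0_iff)
  let ?g = "\<lambda>k. poly (p k) t"
  have sg: "poly (s k) t \<in> combinations ?R ?g N" if "k < N" for k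
  proof -
    have "t ^ m \<in> ?R" for m
      by (induction m) (auto intro: subring_mem[OF R] adjoin_incl[OF A])
    then have "c k * t ^ (d N - d k) \<in> ?R" using c(2) adjoin_incl[OF A] by (intro subring_mem[OF R]) auto
    then have "(c k * t ^ (d N - d k)) * ?g k \<in> combinations ?R ?g N"
      using that by (intro combinations_mult[OF R] combinations_incl[OF R])
    then show ?thesis by (simp add: s_def poly_monom mult.assoc)
  qed
  then have Sg: "(\<Sum>k<N. poly (s k) t) \<in> combinations ?R ?g N" by (intro combinations_sum[OF R]) auto
  have qt: "poly q t = ?g N - (\<Sum>k<N. poly (s k) t)" by (simp add: q_def poly_sum)
  have nin: "poly q t \<notin> combinations ?R ?g N"
    using combinations_add[OF R _ Sg, of "poly q t"] p[of N] qt by auto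
  have "poly q t \<in> I"
  proof -
    obtain m where m: "\<forall>k<Suc N. ?g k \<in> combinations ?R f m" using bounded[of "Suc N" ?g] p by blast
    then have "combinations ?R ?g N \<subseteq> combinations ?R f m" by (intro combinations_subset[OF R]) auto
    then have "poly q t \<in> combinations ?R f m" unfolding qt using m Sg by (intro combinations_diff[OF R]) auto
    then show ?thesis by (auto simp: I_def)
  qed
  then have "d N \<le> Polynomial.degree q" unfolding d_def using qA nin by (intro min) blast
  then have "q = 0" using qdeg by simp
  then show False using nin combinations_zero[OF R] by simp
qed

text \<open>
  Only zeros of polynomials matter, so polynomial functions can be used instead of polynomials.
\<close>

lemma noetherian_function_ring:
  fixes C :: "'k::field set" and W :: "'v set"
  assumes C: "subfld C" and "finite W"
  shows "\<exists>A :: (('v \<Rightarrow> 'k) \<Rightarrow> 'k) set. is_subring A \<and> noetherian A \<and> (\<forall>c\<in>C. (\<lambda>_. c) \<in> A) \<and> (\<forall>v\<in>W. (\<lambda>x. x v) \<in> A)"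
  using assms(2)
proof induction
  case empty
  interpret C: subfld C by fact
  let ?A = "{(\<lambda>_. c) | c. c \<in> C} :: (('v \<Rightarrow> 'k) \<Rightarrow> 'k) set"
  have sub: "is_subring ?A"
    unfolding is_subring_def using C.mem by (auto simp: plus_fun_def times_fun_def one_fun_def fun_Compl_def)
  have "noetherian ?A"
    unfolding noetherian_def
  proof (intro allI impI)
    fix g :: "nat \<Rightarrow> ('v \<Rightarrow> 'k) \<Rightarrow> 'k" assume g: "\<forall>n. g n \<in> ?A"
    obtain a where a: "g 0 = (\<lambda>_. a)" "a \<in> C" using g by blast
    obtain b where b: "g 1 = (\<lambda>_. b)" "b \<in> C" using g by blast
    show "\<exists>n. g n \<in> combinations ?A g n"
    proof (cases "a = 0")
      case True
      then have "g 0 = 0" using a by (simp add: zero_fun_def)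
      then show ?thesis using combinations_zero[OF sub, of g 0] by (intro exI[of _ 0]) simp
    next
      case False
      then have "g 1 = (\<lambda>_. b / a) * g 0" using a b by (simp add: times_fun_def)
      moreover have "(\<lambda>_. b / a) \<in> ?A" using a b C.divide_mem by blast
      ultimately have "g 1 \<in> combinations ?A g 1"
        using combinations_mult[OF sub] combinations_incl[OF sub, of 0 1 g] by simp
      then show ?thesis by blast
    qed
  qed
  then show ?case using sub by (intro exI[of _ ?A]) auto
next
  case (insert v W)
  then obtain A :: "(('v \<Rightarrow> 'k) \<Rightarrow> 'k) set" where A: "is_subring A" "noetherian A"
    "\<forall>c\<in>C. (\<lambda>_. c) \<in> A" "\<forall>v\<in>W. (\<lambda>x. x v) \<in> A" by blast
  show ?case
    using adjoin_subring[OF A(1)] hilbert_basis[OF A(1,2)] adjoin_incl[OF A(1), of "\<lambda>x. x v"] A(3,4)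
    by (intro exI[of _ "adjoin A (\<lambda>x. x v)"]) auto
qed

text \<open>
  Otherwise some sequence in \<open>J\<close> has the property that no member vanishes at all common zeros
  of its predecessors; but some member is a combination of its predecessors.
\<close>

corollary finitely_many_equations:
  fixes C :: "'k::field set" and W :: "'v set"
  assumes "subfld C" "finite W" "J \<subseteq> pexps C W"
  shows "\<exists>J0. finite J0 \<and> J0 \<subseteq> J \<and> (\<forall>x. (\<forall>e\<in>J0. ev id x e = 0) \<longrightarrow> (\<forall>e\<in>J. ev id x e = 0))"
proof (rule ccontr)
  assume no: "\<not> ?thesis"
  obtain A :: "(('v \<Rightarrow> 'k) \<Rightarrow> 'k) set" where A: "is_subring A" "noetherian A"
    "\<forall>c\<in>C. (\<lambda>_. c) \<in> A" "\<forall>v\<in>W. (\<lambda>x. x v) \<in> A" using noetherian_function_ring[OF assms(1,2)] by blast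
  have "\<exists>g :: nat \<Rightarrow> ('k, 'v) pexp. \<forall>n. g n \<in> J \<and> (\<exists>x. (\<forall>k<n. ev id x (g k) = 0) \<and> ev id x (g n) \<noteq> 0)"
  proof (rule dependent_wellorder_choice[where
      P = "\<lambda>g n r. r \<in> J \<and> (\<exists>x. (\<forall>k<n. ev id x (g k) = 0) \<and> ev id x r \<noteq> 0)"])
    fix r and f g :: "nat \<Rightarrow> ('k, 'v) pexp" and n :: nat
    assume "\<And>k. k < n \<Longrightarrow> f k = g k"
    then show "(r \<in> J \<and> (\<exists>x. (\<forall>k<n. ev id x (f k) = 0) \<and> ev id x r \<noteq> 0)) =
      (r \<in> J \<and> (\<exists>x. (\<forall>k<n. ev id x (g k) = 0) \<and> ev id x r \<noteq> 0))" by simp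
  next
    fix n and g :: "nat \<Rightarrow> ('k, 'v) pexp"
    assume g: "\<And>k. k < n \<Longrightarrow> g k \<in> J \<and> (\<exists>x. (\<forall>l<k. ev id x (g l) = 0) \<and> ev id x (g k) \<noteq> 0)"
    then have gJ: "g ` {..<n} \<subseteq> J" by auto
    have "\<not> (\<forall>x. (\<forall>e\<in>g ` {..<n}. ev id x e = 0) \<longrightarrow> (\<forall>e\<in>J. ev id x e = 0))"
    proof
      assume "\<forall>x. (\<forall>e\<in>g ` {..<n}. ev id x e = 0) \<longrightarrow> (\<forall>e\<in>J. ev id x e = 0)"
      then have "\<exists>J0. finite J0 \<and> J0 \<subseteq> J \<and> (\<forall>x. (\<forall>e\<in>J0. ev id x e = 0) \<longrightarrow> (\<forall>e\<in>J. ev id x e = 0))"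
        using gJ by (intro exI[of _ "g ` {..<n}"]) simp
      then show False using no by contradiction
    qed
    then show "\<exists>r. r \<in> J \<and> (\<exists>x. (\<forall>k<n. ev id x (g k) = 0) \<and> ev id x r \<noteq> 0)" by auto
  qed
  then obtain g :: "nat \<Rightarrow> ('k, 'v) pexp"
    where g_all: "\<forall>n. g n \<in> J \<and> (\<exists>x. (\<forall>k<n. ev id x (g k) = 0) \<and> ev id x (g n) \<noteq> 0)" ..
  have g: "g n \<in> J" "\<exists>x. (\<forall>k<n. ev id x (g k) = 0) \<and> ev id x (g n) \<noteq> 0" for n
    using g_all[rule_format, of n] by (rule conjunct1, rule conjunct2)
  have "(\<lambda>x. ev id x e) \<in> A" if "e \<in> pexps C W" for e
    using that
  proof (induction e)
    case (Add a b)
    then have ab: "a \<in> pexps C W" "b \<in> pexps C W" by (simp_all only: pexps_simps)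
    from Add.IH(1)[OF ab(1)] Add.IH(2)[OF ab(2)]
    have "(\<lambda>x. ev id x a) \<in> A" "(\<lambda>x. ev id x b) \<in> A" by this
    from subring_mem(3)[OF A(1) this] show ?case by (simp only: plus_fun_def ev.simps)
  next
    case (Mult a b)
    then have ab: "a \<in> pexps C W" "b \<in> pexps C W" by (simp_all only: pexps_simps)
    from Mult.IH(1)[OF ab(1)] Mult.IH(2)[OF ab(2)]
    have "(\<lambda>x. ev id x a) \<in> A" "(\<lambda>x. ev id x b) \<in> A" by this
    from subring_mem(4)[OF A(1) this] show ?case by (simp only: times_fun_def ev.simps)
  qed (use A in auto)
  then have "\<forall>n. (\<lambda>x. ev id x (g n)) \<in> A" using g(1) assms(3) by blast
  then have "\<exists>n. (\<lambda>x. ev id x (g n)) \<in> combinations A (\<lambda>n x. ev id x (g n)) n"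
    by (rule A(2)[unfolded noetherian_def, THEN spec, THEN mp])
  then obtain n where "(\<lambda>x. ev id x (g n)) \<in> combinations A (\<lambda>n x. ev id x (g n)) n" ..
  then obtain c where c: "(\<lambda>x. ev id x (g n)) = (\<Sum>k<n. c k * (\<lambda>x. ev id x (g k)))"
    unfolding combinations_def by blast
  obtain x where x: "\<forall>k<n. ev id x (g k) = 0" "ev id x (g n) \<noteq> 0" using g(2) by blast
  have sumf: "(\<Sum>k<m. h k) x = (\<Sum>k<m. h k x)" for h :: "nat \<Rightarrow> ('v \<Rightarrow> 'k) \<Rightarrow> 'k" and m :: nat
    by (induction m) (auto simp: zero_fun_def plus_fun_def)
  have "ev id x (g n) = (\<Sum>k<n. c k * (\<lambda>x. ev id x (g k))) x" using c by metis
  also have "\<dots> = 0" unfolding sumf using x by (simp add: times_fun_def)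
  finally show False using x by simp
qed

section \<open>Differentiating polynomial expressions\<close>

primrec esum :: "(nat \<Rightarrow> ('c::zero, 'v) pexp) \<Rightarrow> nat \<Rightarrow> ('c, 'v) pexp" where
  "esum f 0 = Const 0"
| "esum f (Suc n) = Add (esum f n) (f n)"

lemma ev_esum: "h 0 = 0 \<Longrightarrow> ev h x (esum f n) = (\<Sum>k<n. ev h x (f k))"
  by (induction n) auto

lemma esum_pexps: "0 \<in> B \<Longrightarrow> (\<And>k. k < n \<Longrightarrow> f k \<in> pexps B W) \<Longrightarrow> esum f n \<in> pexps B W"
  by (induction n) auto

text \<open>
  The derivation of the polynomial ring that extends \<open>d\<close> and maps the variable \<open>v\<close> to \<open>t v\<close>.
\<close>

primrec ederiv :: "('c \<Rightarrow> 'c) \<Rightarrow> ('v \<Rightarrow> ('c, 'v) pexp) \<Rightarrow> ('c, 'v) pexp \<Rightarrow> ('c, 'v) pexp" where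
  "ederiv d t (Const c) = Const (d c)"
| "ederiv d t (Var v) = t v"
| "ederiv d t (Add a b) = Add (ederiv d t a) (ederiv d t b)"
| "ederiv d t (Mult a b) = Add (Mult (ederiv d t a) b) (Mult a (ederiv d t b))"

lemma ederiv_pexps: "e \<in> pexps UNIV W \<Longrightarrow> (\<And>v. v \<in> W \<Longrightarrow> t v \<in> pexps UNIV W) \<Longrightarrow> ederiv d t e \<in> pexps UNIV W"
  by (induction e) auto

lemma derivation_ev:
  assumes "derivation D" "\<And>c. D (h c) = h (d c)"
  shows "e \<in> pexps UNIV W \<Longrightarrow> (\<And>v. v \<in> W \<Longrightarrow> D (x v) = ev h x (t v)) \<Longrightarrow> D (ev h x e) = ev h x (ederiv d t e)"
  using assms by (induction e) (auto simp: derivation_def)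

lemma derivation_0: "derivation D \<Longrightarrow> D 0 = 0"
  unfolding derivation_def by (metis add_cancel_right_left)

lemma derivation_sum: "derivation D \<Longrightarrow> D (sum f I) = (\<Sum>i\<in>I. D (f i))"
  by (induction I rule: infinite_finite_induct) (auto simp: derivation_0, auto simp: derivation_def)

lemma derivation_mult: "derivation D \<Longrightarrow> D (x * y) = D x * y + x * D y"
  by (simp add: derivation_def)

lemma derivation_add: "derivation D \<Longrightarrow> D (x + y) = D x + D y"
  by (simp add: derivation_def)

lemma derivation_1: "derivation D \<Longrightarrow> D 1 = 0"
  using derivation_mult[of D 1 1] by (simp only: mult_1_left mult_1_right) (metis add_cancel_right_right)

lemma derivation_minus: "derivation D \<Longrightarrow> D (- x) = - D x"
  using derivation_add[of D x "- x"] derivation_0[of D] by (simp add: eq_neg_iff_add_eq_0 add.commute)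

lemma derivation_inverse:
  assumes "derivation D" "x \<noteq> 0"
  shows "D (inverse x) = - D x * (inverse x * inverse x)"
proof -
  have "0 = D (x * inverse x)" using assms derivation_1 by simp
  also have "\<dots> = D x * inverse x + x * D (inverse x)" by (rule derivation_mult[OF assms(1)])
  finally have "x * D (inverse x) = - (D x * inverse x)" by (simp add: add_eq_0_iff)
  then have "inverse x * (x * D (inverse x)) = inverse x * - (D x * inverse x)" by simp
  then show ?thesis using assms(2) by (simp add: mult.assoc[symmetric])
qed

lemma constants_subfld:
  assumes "differential_field m D"
  shows "subfld (constants m D)"
proof
  have der: "derivation (D j)" if "j \<in> {1..m}" for j using assms that by (simp add: differential_field_def)
  show "1 \<in> constants m D" by (simp add: constants_def derivation_1[OF der])
  show "x + y \<in> constants m D" if "x \<in> constants m D" "y \<in> constants m D" for x y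
    using that by (simp add: constants_def derivation_add[OF der])
  show "- x \<in> constants m D" if "x \<in> constants m D" for x
    using that by (simp add: constants_def derivation_minus[OF der])
  show "x * y \<in> constants m D" if "x \<in> constants m D" "y \<in> constants m D" for x y
    using that by (simp add: constants_def derivation_mult[OF der])
  show "inverse x \<in> constants m D" if "x \<in> constants m D" for x
    using that by (cases "x = 0") (simp_all add: constants_def derivation_inverse[OF der])
qed

section \<open>Polynomial functions vanishing on a grid\<close>

inductive polyfun :: "(('v \<Rightarrow> 'x::comm_ring_1) \<Rightarrow> 'x) \<Rightarrow> bool" where
  const: "polyfun (\<lambda>_. c)"
| var: "polyfun (\<lambda>y. y v)"
| add: "polyfun f \<Longrightarrow> polyfun g \<Longrightarrow> polyfun (\<lambda>y. f y + g y)"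
| mult: "polyfun f \<Longrightarrow> polyfun g \<Longrightarrow> polyfun (\<lambda>y. f y * g y)"

lemma polyfun_sum: "(\<And>i. i \<in> I \<Longrightarrow> polyfun (f i)) \<Longrightarrow> polyfun (\<lambda>y. \<Sum>i\<in>I. f i y)"
  by (induction I rule: infinite_finite_induct) (auto intro: polyfun.intros)

lemma polyfun_ev: "(\<And>v. polyfun (\<lambda>y. t y v)) \<Longrightarrow> polyfun (\<lambda>y. ev h (t y) e)"
  by (induction e) (auto intro: polyfun.intros)

lemma polyfun_one_variable: "polyfun f \<Longrightarrow> \<exists>p. \<forall>s. f (y(v := s)) = poly p s"
proof (induction rule: polyfun.induct)
  case (const c)
  show ?case by (intro exI[of _ "[:c:]"]) simp
next
  case (var w)
  show ?case
    by (cases "w = v") (auto intro: exI[of _ "[:0, 1:]"] exI[of _ "[:y w:]"])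
next
  case (add f g)
  then obtain p q where "\<forall>s. f (y(v := s)) = poly p s" "\<forall>s. g (y(v := s)) = poly q s" by blast
  then show ?case by (intro exI[of _ "p + q"]) (simp del: fun_upd_apply)
next
  case (mult f g)
  then obtain p q where "\<forall>s. f (y(v := s)) = poly p s" "\<forall>s. g (y(v := s)) = poly q s" by blast
  then show ?case by (intro exI[of _ "p * q"]) (simp del: fun_upd_apply)
qed

text \<open>
  The coordinates are released from \<open>C\<close> one at a time, as a polynomial in one variable has
  finitely many roots.
\<close>

lemma polyfun_vanishes:
  fixes f :: "('v \<Rightarrow> 'x::idom) \<Rightarrow> 'x"
  assumes f: "polyfun f" and C: "infinite C" and W: "finite W"
    and van: "\<And>y. (\<And>v. v \<in> W \<Longrightarrow> y v \<in> C) \<Longrightarrow> f y = 0"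
  shows "f y = 0"
proof -
  have "\<forall>y. (\<forall>v\<in>W - T. y v \<in> C) \<longrightarrow> f y = 0" if "finite T" for T
    using that
  proof induction
    case empty
    then show ?case using van by simp
  next
    case (insert v T)
    show ?case
    proof (intro allI impI)
      fix y assume y: "\<forall>w\<in>W - insert v T. y w \<in> C"
      obtain p where p: "\<forall>s. f (y(v := s)) = poly p s" using polyfun_one_variable[OF f] by blast
      have "poly p s = 0" if "s \<in> C" for s
      proof -
        have "\<forall>w\<in>W - T. (y(v := s)) w \<in> C" using y that by auto
        then show ?thesis using insert.IH p by metis
      qed
      then have "C \<subseteq> {s. poly p s = 0}" by blast
      then have "p = 0" using C poly_roots_finite[of p] finite_subset by blast
      then show "f y = 0" using p[rule_format, of "y v"] by simp
    qed
  qed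
  from this[OF W] show ?thesis by simp
qed

section \<open>Subspaces stable under derivations\<close>

text \<open>
  A nonzero vector of \<open>U\<close> of minimal support with an entry \<open>1\<close> is constant, because its
  derivatives lie in \<open>U\<close> and have smaller support. Subtracting a multiple of such a vector from
  \<open>u\<close> makes the support of \<open>u\<close> smaller.
\<close>

lemma spanned_by_constants:
  fixes D :: "nat \<Rightarrow> 'a::field \<Rightarrow> 'a" and U :: "(nat \<Rightarrow> 'a) set"
  assumes der: "\<And>j. j \<in> {1..m} \<Longrightarrow> derivation (D j)"
    and supp: "\<And>u k. u \<in> U \<Longrightarrow> k \<ge> n \<Longrightarrow> u k = 0"
    and add: "\<And>u v. u \<in> U \<Longrightarrow> v \<in> U \<Longrightarrow> (\<lambda>k. u k + v k) \<in> U"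
    and scale: "\<And>a u. u \<in> U \<Longrightarrow> (\<lambda>k. a * u k) \<in> U"
    and stable: "\<And>j u. j \<in> {1..m} \<Longrightarrow> u \<in> U \<Longrightarrow> (\<lambda>k. D j (u k)) \<in> U"
  shows "u \<in> U \<Longrightarrow> \<exists>(N::nat) a c. (\<forall>t<N. c t \<in> U \<and> (\<forall>k. c t k \<in> constants m D)) \<and> (\<forall>k. u k = (\<Sum>t<N. a t * c t k))"
proof (induction "card {k. u k \<noteq> 0}" arbitrary: u rule: less_induct)
  case less
  have fin: "finite {k. v k \<noteq> 0}" if "v \<in> U" for v
    by (rule finite_subset[of _ "{..<n}"]) (use supp[OF that] in \<open>auto simp: not_less[symmetric]\<close>)
  show ?case
  proof (cases "\<forall>k. u k = 0")
    case True
    then show ?thesis by (intro exI[of _ "0::nat"]) simp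
  next
    case False
    let ?Q = "\<lambda>w. w \<in> U \<and> (\<exists>k. w k \<noteq> 0) \<and> (\<forall>k. u k = 0 \<longrightarrow> w k = 0)"
    have "?Q u" using False less.prems by blast
    then obtain w where w: "?Q w" and min: "\<And>v. ?Q v \<Longrightarrow> card {k. w k \<noteq> 0} \<le> card {k. v k \<noteq> 0}"
      using ex_has_least_nat[of ?Q u "\<lambda>w. card {k. w k \<noteq> 0}"] by blast
    obtain i where i: "w i \<noteq> 0" using w by blast
    define v where "v k = inverse (w i) * w k" for k
    have vU: "v \<in> U" using scale[of w] w unfolding v_def by blast
    have vi: "v i = 1" using i by (simp add: v_def)
    have vs: "v k = 0 \<longleftrightarrow> w k = 0" for k using i by (simp add: v_def)
    have const: "D j (v k) = 0" if j: "j \<in> {1..m}" for j k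
    proof (rule ccontr)
      assume nz: "D j (v k) \<noteq> 0"
      define d where "d k = D j (v k)" for k
      have dU: "d \<in> U" unfolding d_def by (rule stable[OF j vU])
      have d0: "d k = 0" if "w k = 0" for k
      proof -
        have "v k = 0" using vs that by blast
        then show ?thesis using derivation_0[OF der[OF j]] by (simp add: d_def)
      qed
      then have "?Q d" using dU nz w by (auto simp: d_def)
      then have "card {k. w k \<noteq> 0} \<le> card {k. d k \<noteq> 0}" by (rule min)
      moreover have "d i = 0" using vi derivation_1[OF der[OF j]] by (simp add: d_def)
      then have "{k. d k \<noteq> 0} \<subset> {k. w k \<noteq> 0}" using d0 i by blast
      then have "card {k. d k \<noteq> 0} < card {k. w k \<noteq> 0}" using fin w by (intro psubset_card_mono) auto
      ultimately show False by simp
    qed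
    define u' where "u' k = u k + - u i * v k" for k
    have u'U: "u' \<in> U" unfolding u'_def by (intro add scale vU less.prems)
    have "{k. u' k \<noteq> 0} \<subset> {k. u k \<noteq> 0}"
    proof
      show "{k. u' k \<noteq> 0} \<subseteq> {k. u k \<noteq> 0}" using w vs by (auto simp: u'_def)
      have "u' i = 0" "u i \<noteq> 0" using vi i w by (auto simp: u'_def)
      then show "{k. u' k \<noteq> 0} \<noteq> {k. u k \<noteq> 0}" by blast
    qed
    then have "card {k. u' k \<noteq> 0} < card {k. u k \<noteq> 0}" using fin[OF less.prems] by (intro psubset_card_mono)
    from less.hyps[OF this u'U] obtain N :: nat and a c where c: "\<forall>t<N. c t \<in> U \<and> (\<forall>k. c t k \<in> constants m D)"
      "\<forall>k. u' k = (\<Sum>t<N. a t * c t k)" by blast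
    have "u k = (\<Sum>t<Suc N. (a(N := u i)) t * (c(N := v)) t k)" for k
    proof -
      have "(\<Sum>t<N. (a(N := u i)) t * (c(N := v)) t k) = (\<Sum>t<N. a t * c t k)" by (rule sum.cong) auto
      also have "\<dots> = u' k" using c(2) by simp
      finally show ?thesis by (simp add: u'_def)
    qed
    moreover have "(c(N := v)) t \<in> U \<and> (\<forall>k. (c(N := v)) t k \<in> constants m D)" if "t < Suc N" for t
      using c(1) that vU const by (auto simp: constants_def less_Suc_eq)
    ultimately show ?thesis by blast
  qed
qed

section \<open>Matrices of solutions\<close>

definition mprod :: "nat \<Rightarrow> (nat \<times> nat \<Rightarrow> 'x::comm_ring_1) \<Rightarrow> (nat \<times> nat \<Rightarrow> 'x) \<Rightarrow> nat \<times> nat \<Rightarrow> 'x" where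
  "mprod r x y = (\<lambda>(i, k). \<Sum>l<r. x (i, l) * y (l, k))"

definition idx :: "nat \<Rightarrow> (nat \<times> nat) set" where
  "idx r = {..<r} \<times> {..<r}"

definition mutually_inverse :: "nat \<Rightarrow> (nat \<times> nat \<Rightarrow> 'x::comm_ring_1) \<Rightarrow> (nat \<times> nat \<Rightarrow> 'x) \<Rightarrow> bool" where
  "mutually_inverse r x y \<longleftrightarrow> (\<forall>i<r. \<forall>k<r. mprod r x y (i, k) = (if i = k then 1 else 0) \<and>
     mprod r y x (i, k) = (if i = k then 1 else 0))"

lemma finite_idx: "finite (idx r)"
  by (simp add: idx_def)

lemma mprod_assoc: "mprod r (mprod r x y) z = mprod r x (mprod r y z)"
proof
  fix v :: "nat \<times> nat"
  obtain i k where v: "v = (i, k)" by (cases v)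
  have "(\<Sum>l<r. (\<Sum>l'<r. x (i, l') * y (l', l)) * z (l, k)) = (\<Sum>l<r. \<Sum>l'<r. x (i, l') * y (l', l) * z (l, k))"
    by (simp add: sum_distrib_right)
  also have "\<dots> = (\<Sum>l'<r. \<Sum>l<r. x (i, l') * y (l', l) * z (l, k))" by (rule sum.swap)
  also have "\<dots> = (\<Sum>l'<r. x (i, l') * (\<Sum>l<r. y (l', l) * z (l, k)))"
    by (simp add: sum_distrib_left mult.assoc)
  finally show "mprod r (mprod r x y) z v = mprod r x (mprod r y z) v" by (simp add: mprod_def v)
qed

lemma mprod_cong:
  "(\<And>v. v \<in> idx r \<Longrightarrow> x v = x' v) \<Longrightarrow> (\<And>v. v \<in> idx r \<Longrightarrow> y v = y' v) \<Longrightarrow> v \<in> idx r \<Longrightarrow> mprod r x y v = mprod r x' y' v"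
  by (cases v) (auto simp: mprod_def idx_def intro!: sum.cong)

lemma mprod_id_left:
  assumes "\<And>i k. i < r \<Longrightarrow> k < r \<Longrightarrow> x (i, k) = (if i = k then 1 else 0)" "v \<in> idx r"
  shows "mprod r x y v = y v"
proof -
  obtain i k where v: "v = (i, k)" "i < r" "k < r" using assms(2) by (auto simp: idx_def)
  have "mprod r x y v = (\<Sum>l<r. if i = l then y (l, k) else 0)"
    unfolding v(1) mprod_def prod.case by (rule sum.cong) (use assms(1) v in auto)
  then show ?thesis using v by simp
qed

lemma mprod_id_right:
  assumes "\<And>i k. i < r \<Longrightarrow> k < r \<Longrightarrow> x (i, k) = (if i = k then 1 else 0)" "v \<in> idx r"
  shows "mprod r y x v = y v"
proof -
  obtain i k where v: "v = (i, k)" "i < r" "k < r" using assms(2) by (auto simp: idx_def)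
  have "mprod r y x v = (\<Sum>l<r. if l = k then y (i, l) else 0)"
    unfolding v(1) mprod_def prod.case by (rule sum.cong) (use assms(1) v in auto)
  then show ?thesis using v by simp
qed

lemma mutually_inverse_sym: "mutually_inverse r x y \<Longrightarrow> mutually_inverse r y x"
  by (simp add: mutually_inverse_def)

lemma mprod_cancel_left:
  assumes "mutually_inverse r x y" "v \<in> idx r"
  shows "mprod r x (mprod r y z) v = z v"
  unfolding mprod_assoc[symmetric] using assms by (intro mprod_id_left) (auto simp: mutually_inverse_def)

lemma mprod_cancel_right:
  assumes "mutually_inverse r x y" "v \<in> idx r"
  shows "mprod r (mprod r z x) y v = z v"
  unfolding mprod_assoc using assms by (intro mprod_id_right) (auto simp: mutually_inverse_def)

lemma mutually_inverse_mprod: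
  assumes "mutually_inverse r x x'" "mutually_inverse r y y'"
  shows "mutually_inverse r (mprod r x y) (mprod r y' x')"
proof -
  have "mprod r (mprod r x y) (mprod r y' x') (i, k) = (if i = k then 1 else 0)" if "i < r" "k < r" for i k
  proof -
    have "mprod r (mprod r x y) (mprod r y' x') (i, k) = mprod r x (mprod r y (mprod r y' x')) (i, k)"
      by (simp add: mprod_assoc)
    also have "\<dots> = mprod r x x' (i, k)"
      using that by (intro mprod_cong mprod_cancel_left[OF assms(2)]) (auto simp: idx_def)
    finally show ?thesis using assms(1) that by (simp add: mutually_inverse_def)
  qed
  moreover have "mprod r (mprod r y' x') (mprod r x y) (i, k) = (if i = k then 1 else 0)" if "i < r" "k < r" for i k
  proof -
    have "mprod r (mprod r y' x') (mprod r x y) (i, k) = mprod r y' (mprod r x' (mprod r x y)) (i, k)"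
      by (simp add: mprod_assoc)
    also have "\<dots> = mprod r y' y (i, k)"
      using that by (intro mprod_cong mprod_cancel_left[OF mutually_inverse_sym[OF assms(1)]]) (auto simp: idx_def)
    finally show ?thesis using assms(2) that by (simp add: mutually_inverse_def)
  qed
  ultimately show ?thesis by (simp add: mutually_inverse_def)
qed

lemma (in comm_ring_hom) hom_mprod: "hom (mprod r x y v) = mprod r (hom \<circ> x) (hom \<circ> y) v"
  by (cases v) (simp add: mprod_def hom_sum hom_mult)

lemma (in comm_ring_hom) hom_mutually_inverse:
  "mutually_inverse r x y \<Longrightarrow> mutually_inverse r (hom \<circ> x) (hom \<circ> y)"
  unfolding mutually_inverse_def by (simp add: hom_mprod[symmetric])

lemma (in subfld) mprod_mem: "(\<And>v. x v \<in> F) \<Longrightarrow> (\<And>v. y v \<in> F) \<Longrightarrow> mprod r x y v \<in> F"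
  by (cases v) (auto simp: mprod_def intro!: sum_mem mult_mem)

section \<open>Specializing one fundamental matrix to a constant multiple of the other\<close>

lemma idx_cases: "v \<in> idx r \<Longrightarrow> (\<And>i k. v = (i, k) \<Longrightarrow> i < r \<Longrightarrow> k < r \<Longrightarrow> thesis) \<Longrightarrow> thesis"
  by (auto simp: idx_def)

definition sys_exp :: "nat \<Rightarrow> (nat \<times> nat \<Rightarrow> 'k::comm_ring_1) \<Rightarrow> nat \<times> nat \<Rightarrow> ('k, nat \<times> nat) pexp" where
  "sys_exp r a = (\<lambda>(i, k). esum (\<lambda>l. Mult (Const (a (i, l))) (Var (l, k))) r)"

lemma ev_sys_exp: "h 0 = 0 \<Longrightarrow> ev h x (sys_exp r a v) = mprod r (h \<circ> a) x v"
  by (cases v) (simp add: sys_exp_def ev_esum mprod_def)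

lemma sys_exp_pexps: "v \<in> idx r \<Longrightarrow> sys_exp r a v \<in> pexps UNIV (idx r)"
  by (auto simp: sys_exp_def idx_def intro!: esum_pexps)

text \<open>
  Invertibility as a system of equations without determinants: the rows \<open>r, \<dots>, 2 r - 1\<close> of
  variables hold the inverse matrix.
\<close>

definition inverse_eqs :: "nat \<Rightarrow> ('k::comm_ring_1, nat \<times> nat) pexp set" where
  "inverse_eqs r =
    (\<lambda>(i, k). Add (esum (\<lambda>l. Mult (Var (i, l)) (Var (r + l, k))) r) (Const (if i = k then - 1 else 0))) ` idx r \<union>
    (\<lambda>(i, k). Add (esum (\<lambda>l. Mult (Var (r + i, l)) (Var (l, k))) r) (Const (if i = k then - 1 else 0))) ` idx r"

lemma inverse_eqs_iff:
  assumes h: "h 0 = 0" "h (- 1) = - 1"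
  shows "(\<forall>e\<in>inverse_eqs r. ev h x e = 0) \<longleftrightarrow> mutually_inverse r x (\<lambda>(i, k). x (r + i, k))"
proof -
  have "(\<forall>e\<in>inverse_eqs r. ev h x e = 0) \<longleftrightarrow>
    (\<forall>i<r. \<forall>k<r. (\<Sum>l<r. x (i, l) * x (r + l, k)) + h (if i = k then - 1 else 0) = 0 \<and>
      (\<Sum>l<r. x (r + i, l) * x (l, k)) + h (if i = k then - 1 else 0) = 0)"
    unfolding inverse_eqs_def idx_def by (auto simp: ev_esum h ball_Un)
  also have "\<dots> \<longleftrightarrow> mutually_inverse r x (\<lambda>(i, k). x (r + i, k))"
    unfolding mutually_inverse_def mprod_def by (auto simp: h eq_neg_iff_add_eq_0)
  finally show ?thesis .
qed

lemma inverse_eqs_pexps: "0 \<in> B \<Longrightarrow> - 1 \<in> B \<Longrightarrow> inverse_eqs r \<subseteq> pexps B ({..<2 * r} \<times> {..<r})"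
  by (auto simp: inverse_eqs_def idx_def intro!: esum_pexps)

lemma idx_subset_double: "pexps B (idx r) \<subseteq> pexps B ({..<2 * r} \<times> {..<r})"
  by (auto simp: pexps_def idx_def)

lemma comm_ring_hom_comp: "comm_ring_hom f \<Longrightarrow> comm_ring_hom g \<Longrightarrow> comm_ring_hom (f \<circ> g)"
proof -
  assume "comm_ring_hom f" "comm_ring_hom g"
  then interpret f: comm_ring_hom f + g: comm_ring_hom g by simp_all
  show "comm_ring_hom (f \<circ> g)"
    by unfold_locales (simp_all add: g.hom_add f.hom_add g.hom_mult f.hom_mult)
qed

lemma comm_ring_hom_to_ac: "comm_ring_hom (to_ac :: 'a::field \<Rightarrow> 'a alg_closure)"
  by unfold_locales auto

locale solution_pair =
  fixes m r :: nat
    and DK :: "nat \<Rightarrow> 'k::field \<Rightarrow> 'k" and D1 :: "nat \<Rightarrow> 'a::field \<Rightarrow> 'a" and D2 :: "nat \<Rightarrow> 'b::field \<Rightarrow> 'b"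
    and e1 :: "'k \<Rightarrow> 'a" and e2 :: "'k \<Rightarrow> 'b" and a :: "nat \<Rightarrow> nat \<times> nat \<Rightarrow> 'k"
    and z1 w1 :: "nat \<times> nat \<Rightarrow> 'a" and z2 w2 :: "nat \<times> nat \<Rightarrow> 'b"
  assumes hom1: "field_hom e1" and hom2: "field_hom e2"
    and DK: "differential_field m DK"
    and der1: "j \<in> {1..m} \<Longrightarrow> derivation (D1 j)" and der2: "j \<in> {1..m} \<Longrightarrow> derivation (D2 j)"
    and comm1: "j \<in> {1..m} \<Longrightarrow> D1 j (e1 c) = e1 (DK j c)" and comm2: "j \<in> {1..m} \<Longrightarrow> D2 j (e2 c) = e2 (DK j c)"
    and const1: "constants m D1 = e1 ` constants m DK"
    and sol1: "j \<in> {1..m} \<Longrightarrow> v \<in> idx r \<Longrightarrow> D1 j (z1 v) = mprod r (e1 \<circ> a j) z1 v"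
    and sol2: "j \<in> {1..m} \<Longrightarrow> v \<in> idx r \<Longrightarrow> D2 j (z2 v) = mprod r (e2 \<circ> a j) z2 v"
    and inv1: "mutually_inverse r z1 w1" and inv2: "mutually_inverse r z2 w2"
    and infinite_constants: "infinite (constants m DK)"
begin

sublocale e1: field_hom e1 by (rule hom1)
sublocale e2: field_hom e2 by (rule hom2)

abbreviation C :: "'k set" where "C \<equiv> constants m DK"

sublocale C: subfld C by (rule constants_subfld[OF DK])

definition E :: "'k \<Rightarrow> 'a alg_closure" where "E = to_ac \<circ> e1"

lemma E_apply: "E b = to_ac (e1 b)"
  by (simp add: E_def)

definition Z :: "nat \<times> nat \<Rightarrow> 'a alg_closure" where "Z = to_ac \<circ> z1"

sublocale ac: comm_ring_hom "to_ac :: 'a \<Rightarrow> 'a alg_closure" by (rule comm_ring_hom_to_ac)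

sublocale E: comm_ring_hom E
  unfolding E_def by (rule comm_ring_hom_comp[OF comm_ring_hom_to_ac]) unfold_locales

lemma ev_E: "ev E (to_ac \<circ> x) e = to_ac (ev e1 x e)"
  by (simp add: E_def ac.hom_ev)

lemma ev_E_base: "ev E (E \<circ> c) e = to_ac (e1 (ev id c e))"
  unfolding E_def e1.hom_ev ac.hom_ev by (simp add: comp_assoc[symmetric])

definition relations2 :: "('k, nat \<times> nat) pexp set" where
  "relations2 = {e \<in> pexps UNIV (idx r). ev e2 z2 e = 0}"

lemma relations2_ederiv:
  assumes e: "e \<in> relations2" and j: "j \<in> {1..m}"
  shows "ederiv (DK j) (sys_exp r (a j)) e \<in> relations2"
proof -
  have "D2 j (ev e2 z2 e) = ev e2 z2 (ederiv (DK j) (sys_exp r (a j)) e)"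
    using e by (intro derivation_ev[of "D2 j" e2 "DK j" e "idx r"] der2 comm2 j)
      (auto simp: relations2_def ev_sys_exp sol2[OF j])
  then show ?thesis
    using e derivation_0[OF der2[OF j]] ederiv_pexps[of e "idx r" "sys_exp r (a j)" "DK j"] sys_exp_pexps[of _ r "a j"]
    by (auto simp: relations2_def)
qed

lemma solution_times_constant:
  assumes c: "\<And>v. c v \<in> C" and j: "j \<in> {1..m}" and v: "v \<in> idx r"
  shows "D1 j (mprod r z1 (e1 \<circ> c) v) = mprod r (e1 \<circ> a j) (mprod r z1 (e1 \<circ> c)) v"
proof -
  obtain i k where ik: "v = (i, k)" "i < r" "k < r" using v by (rule idx_cases)
  have "D1 j (e1 (c w)) = 0" for w
    unfolding comm1[OF j] using c[of w] j by (simp add: constants_def)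
  then have "D1 j (mprod r z1 (e1 \<circ> c) v) = (\<Sum>l<r. D1 j (z1 (i, l)) * e1 (c (l, k)))"
    by (simp add: mprod_def ik derivation_sum[OF der1[OF j]] derivation_mult[OF der1[OF j]])
  also have "\<dots> = mprod r (mprod r (e1 \<circ> a j) z1) (e1 \<circ> c) v"
    using ik sol1[OF j] by (auto simp: mprod_def idx_def)
  finally show ?thesis by (simp add: mprod_assoc)
qed

text \<open>
  Functions of a matrix \<open>y\<close>: the combinations over the first field of the relations of \<open>z2\<close>,
  evaluated at \<open>z1 y\<close>. For constant \<open>y\<close> this matrix is again a solution of the system, so that
  differentiating the coefficients does not lead out of the space (\<open>relation_span_derivative\<close>).
\<close>

inductive_set relation_span :: "((nat \<times> nat \<Rightarrow> 'a alg_closure) \<Rightarrow> 'a alg_closure) set" where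
  zero: "(\<lambda>_. 0) \<in> relation_span"
| step: "G \<in> relation_span \<Longrightarrow> p \<in> relations2 \<Longrightarrow> (\<lambda>y. G y + to_ac b * ev E (mprod r Z y) p) \<in> relation_span"

lemma relation_span_add: "G \<in> relation_span \<Longrightarrow> H \<in> relation_span \<Longrightarrow> (\<lambda>y. H y + G y) \<in> relation_span"
proof (induction rule: relation_span.induct)
  case (step G p b)
  then show ?case using relation_span.step[of "\<lambda>y. H y + G y" p b] by (simp add: add.assoc)
qed simp

lemma relation_span_scale: "G \<in> relation_span \<Longrightarrow> (\<lambda>y. to_ac c * G y) \<in> relation_span"
proof (induction rule: relation_span.induct)
  case (step G p b)
  then show ?case using relation_span.step[of "\<lambda>y. to_ac c * G y" p "c * b"] by (simp add: algebra_simps)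
qed (simp add: relation_span.zero)

lemma polyfun_mprod: "polyfun (\<lambda>y. mprod r x y v)"
  by (cases v) (auto simp: mprod_def intro!: polyfun_sum polyfun.intros)

lemma relation_span_polyfun: "G \<in> relation_span \<Longrightarrow> polyfun G"
  by (induction rule: relation_span.induct) (auto intro!: polyfun.intros polyfun_ev polyfun_mprod)

lemma relation_span_cong:
  assumes "G \<in> relation_span" "\<And>v. v \<in> idx r \<Longrightarrow> y v = y' v"
  shows "G y = G y'"
  using assms(1)
proof induction
  case (step G p b)
  have "ev E (mprod r Z y) p = ev E (mprod r Z y') p"
    using step.hyps assms(2) by (intro ev_cong[where W = "idx r" and B = UNIV] mprod_cong) (auto simp: relations2_def)
  then show ?case using step by simp
qed simp

lemma relation_span_derivative:
  assumes "G \<in> relation_span" and j: "j \<in> {1..m}"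
  shows "\<exists>G'\<in>relation_span. \<forall>c. (\<forall>v. c v \<in> C) \<longrightarrow> (\<exists>g. G (E \<circ> c) = to_ac g \<and> G' (E \<circ> c) = to_ac (D1 j g))"
  using assms(1)
proof induction
  case zero
  then show ?case using relation_span.zero derivation_0[OF der1[OF j]]
    by (intro bexI[of _ "\<lambda>_. 0"]) (auto intro!: exI[of _ 0])
next
  case (step G p b)
  then obtain G' where G': "G' \<in> relation_span"
    "\<And>c. (\<forall>v. c v \<in> C) \<Longrightarrow> \<exists>g. G (E \<circ> c) = to_ac g \<and> G' (E \<circ> c) = to_ac (D1 j g)" by blast
  define p' where "p' = ederiv (DK j) (sys_exp r (a j)) p"
  have p': "p' \<in> relations2" unfolding p'_def using step.hyps j by (intro relations2_ederiv)
  define H where "H = (\<lambda>y. G' y + to_ac (D1 j b) * ev E (mprod r Z y) p + to_ac b * ev E (mprod r Z y) p')"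
  have "H \<in> relation_span" unfolding H_def by (intro relation_span.step G'(1) step.hyps p')
  moreover have "\<exists>g. G (E \<circ> c) + to_ac b * ev E (mprod r Z (E \<circ> c)) p = to_ac g \<and> H (E \<circ> c) = to_ac (D1 j g)"
    if c: "\<forall>v. c v \<in> C" for c
  proof -
    obtain g where g: "G (E \<circ> c) = to_ac g" "G' (E \<circ> c) = to_ac (D1 j g)" using G'(2)[OF c] by blast
    define x where "x = mprod r z1 (e1 \<circ> c)"
    have Zx: "mprod r Z (E \<circ> c) = to_ac \<circ> x"
      unfolding x_def Z_def E_def by (rule ext) (simp add: ac.hom_mprod comp_assoc)
    have dx: "D1 j (ev e1 x p) = ev e1 x p'"
      unfolding p'_def
    proof (rule derivation_ev[of "D1 j" e1 "DK j" p "idx r", OF der1[OF j] comm1[OF j]])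
      show "p \<in> pexps UNIV (idx r)" using step.hyps by (simp add: relations2_def)
      show "D1 j (x v) = ev e1 x (sys_exp r (a j) v)" if "v \<in> idx r" for v
        unfolding x_def using solution_times_constant[of c j v] c j that by (simp add: ev_sys_exp)
    qed
    have "G (E \<circ> c) + to_ac b * ev E (mprod r Z (E \<circ> c)) p = to_ac (g + b * ev e1 x p)"
      unfolding Zx ev_E g by simp
    moreover have "H (E \<circ> c) = to_ac (D1 j (g + b * ev e1 x p))"
      unfolding H_def Zx ev_E g derivation_add[OF der1[OF j]] derivation_mult[OF der1[OF j]] dx by simp
    ultimately show ?thesis by blast
  qed
  ultimately show ?case by blast
qed

text \<open>
  Lists of pairs \<open>(l, q)\<close> stand for elements \<open>\<Sum> l q(y)\<close>, where the coefficients of \<open>q\<close> are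
  constants.
\<close>

abbreviation lin_val :: "(nat \<times> nat \<Rightarrow> 'a alg_closure) \<Rightarrow> ('a \<times> ('k, nat \<times> nat) pexp) list \<Rightarrow> 'a alg_closure" where
  "lin_val y ls \<equiv> sum_list (map (\<lambda>b. to_ac (fst b) * ev E y (snd b)) ls)"

lemma expansion_list:
  "e \<in> pexps UNIV (idx r) \<Longrightarrow> \<exists>ls. (\<forall>b\<in>set ls. snd b \<in> pexps C (idx r)) \<and> (\<forall>y. ev E (mprod r Z y) e = lin_val y ls)"
proof (induction e)
  case (Const c)
  show ?case using C.one_mem by (intro exI[of _ "[(e1 c, Const 1)]"]) (simp add: E_apply)
next
  case (Var v)
  then obtain i k where v: "v = (i, k)" "i < r" "k < r" by (auto simp: idx_def)
  show ?case
  proof (intro exI[of _ "map (\<lambda>l. (z1 (i, l), Var (l, k))) [0..<r]"] conjI ballI allI)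
    fix y
    show "ev E (mprod r Z y) (Var v) = lin_val y (map (\<lambda>l. (z1 (i, l), Var (l, k))) [0..<r])"
      by (simp add: v mprod_def Z_def interv_sum_list_conv_sum_set_nat comp_def atLeast0LessThan)
  qed (auto simp: v idx_def)
next
  case (Add f g)
  have fg: "f \<in> pexps UNIV (idx r)" "g \<in> pexps UNIV (idx r)" using Add.prems by simp_all
  from Add.IH(1)[OF fg(1)] obtain ls where
    ls: "(\<forall>b\<in>set ls. snd b \<in> pexps C (idx r)) \<and> (\<forall>y. ev E (mprod r Z y) f = lin_val y ls)" ..
  from Add.IH(2)[OF fg(2)] obtain ls' where
    ls': "(\<forall>b\<in>set ls'. snd b \<in> pexps C (idx r)) \<and> (\<forall>y. ev E (mprod r Z y) g = lin_val y ls')" ..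
  show ?case using ls ls' by (intro exI[of _ "ls @ ls'"]) auto
next
  case (Mult f g)
  have fg: "f \<in> pexps UNIV (idx r)" "g \<in> pexps UNIV (idx r)" using Mult.prems by simp_all
  from Mult.IH(1)[OF fg(1)] obtain ls where
    ls: "(\<forall>b\<in>set ls. snd b \<in> pexps C (idx r)) \<and> (\<forall>y. ev E (mprod r Z y) f = lin_val y ls)" ..
  from Mult.IH(2)[OF fg(2)] obtain ls' where
    ls': "(\<forall>b\<in>set ls'. snd b \<in> pexps C (idx r)) \<and> (\<forall>y. ev E (mprod r Z y) g = lin_val y ls')" ..
  define pr where "pr = concat (map (\<lambda>b. map (\<lambda>b'. (fst b * fst b', Mult (snd b) (snd b'))) ls') ls)"
  have inner: "lin_val y (map (\<lambda>b'. (fst b * fst b', Mult (snd b) (snd b'))) us) = (to_ac (fst b) * ev E y (snd b)) * lin_val y us"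
    for y b us by (induction us) (auto simp: algebra_simps)
  have "lin_val y (concat (map (\<lambda>b. map (\<lambda>b'. (fst b * fst b', Mult (snd b) (snd b'))) ls') us)) = lin_val y us * lin_val y ls'"
    for y us by (induction us) (simp_all only: list.map concat.simps map_append sum_list_append inner distrib_right sum_list.Cons sum_list.Nil mult_zero_left)
  then have "\<forall>y. ev E (mprod r Z y) (Mult f g) = lin_val y pr" using ls ls' by (simp add: pr_def)
  moreover have "\<forall>b\<in>set pr. snd b \<in> pexps C (idx r)" using ls ls' by (auto simp: pr_def)
  ultimately show ?case by blast
qed

lemma expansion:
  assumes "e \<in> pexps UNIV (idx r)"
  shows "\<exists>(n::nat) l q. (\<forall>k<n. q k \<in> pexps C (idx r)) \<and> (\<forall>y. ev E (mprod r Z y) e = (\<Sum>k<n. to_ac (l k) * ev E y (q k)))"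
proof -
  obtain ls where ls: "\<forall>b\<in>set ls. snd b \<in> pexps C (idx r)" "\<forall>y. ev E (mprod r Z y) e = lin_val y ls"
    using expansion_list[OF assms] by blast
  have "lin_val y ls = (\<Sum>k<length ls. to_ac (fst (ls ! k)) * ev E y (snd (ls ! k)))" for y
    by (simp add: sum_list_sum_nth atLeast0LessThan)
  then show ?thesis using ls
    by (intro exI[of _ "length ls"] exI[of _ "\<lambda>k. fst (ls ! k)"] exI[of _ "\<lambda>k. snd (ls ! k)"]) auto
qed

definition constant_relations :: "('k, nat \<times> nat) pexp set" where
  "constant_relations = {q \<in> pexps C (idx r). (\<lambda>y. ev E y q) \<in> relation_span}"

text \<open>
  Written in powers of \<open>y\<close>, the function \<open>e (z1 y)\<close> is given by a vector of coefficients, and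
  the vectors whose functions lie in \<open>relation_span\<close> form a subspace stable under the derivations, to
  which \<open>spanned_by_constants\<close> applies.
\<close>

lemma relation_from_constants:
  assumes e: "e \<in> relations2"
  shows "\<exists>(N::nat) co q. (\<forall>t<N. q t \<in> constant_relations) \<and>
    (\<forall>y. ev E (mprod r Z y) e = (\<Sum>t<N. to_ac (co t) * ev E y (q t)))"
proof -
  obtain n :: nat and l q where q: "\<And>k. k < n \<Longrightarrow> q k \<in> pexps C (idx r)"
    and ex: "\<And>y. ev E (mprod r Z y) e = (\<Sum>k<n. to_ac (l k) * ev E y (q k))"
    using expansion[of e] e by (auto simp: relations2_def)
  define fn where "fn u = (\<lambda>y. \<Sum>k<n. to_ac (u k) * ev E y (q k))" for u :: "nat \<Rightarrow> 'a"
  define U where "U = {u. (\<forall>k\<ge>n. u k = 0) \<and> fn u \<in> relation_span}"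
  have stable: "(\<lambda>k. D1 j (u k)) \<in> U" if j: "j \<in> {1..m}" and u: "u \<in> U" for j u
  proof -
    obtain G' where G': "G' \<in> relation_span"
      "\<And>c. (\<forall>v. c v \<in> C) \<Longrightarrow> \<exists>g. fn u (E \<circ> c) = to_ac g \<and> G' (E \<circ> c) = to_ac (D1 j g)"
      using relation_span_derivative[OF _ j, of "fn u"] u by (auto simp: U_def)
    define H where "H = fn (\<lambda>k. D1 j (u k))"
    \<comment> \<open>At constant points the membership of \<open>fn u\<close> in the span can be differentiated, and these points suffice.\<close>
    have "H y + (- 1) * G' y = 0" for y
    proof (rule polyfun_vanishes[where f = "\<lambda>y. H y + (- 1) * G' y" and C = "E ` C" and W = "idx r"])
      show "polyfun (\<lambda>y. H y + (- 1) * G' y)" unfolding H_def fn_def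
        by (intro polyfun.intros polyfun_sum polyfun_ev relation_span_polyfun G')
      have "inj E" by (rule injI) (simp add: E_apply)
      then show "infinite (E ` C)" using infinite_constants by (meson finite_imageD inj_on_subset subset_UNIV)
      show "finite (idx r)" by (rule finite_idx)
      fix y assume y: "\<And>v. v \<in> idx r \<Longrightarrow> y v \<in> E ` C"
      define c where "c v = (if v \<in> idx r then SOME b. b \<in> C \<and> y v = E b else 0)" for v
      have c: "c v \<in> C \<and> (v \<in> idx r \<longrightarrow> y v = E (c v))" for v
      proof (cases "v \<in> idx r")
        case True
        then have "\<exists>b. b \<in> C \<and> y v = E b" using y by blast
        then have "(SOME b. b \<in> C \<and> y v = E b) \<in> C \<and> y v = E (SOME b. b \<in> C \<and> y v = E b)" by (rule someI_ex)
        then show ?thesis using True unfolding c_def by simp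
      next
        case False
        then show ?thesis using C.zero_mem by (simp add: c_def)
      qed
      then have yc: "y v = (E \<circ> c) v" if "v \<in> idx r" for v using that by simp
      obtain g where g: "fn u (E \<circ> c) = to_ac g" "G' (E \<circ> c) = to_ac (D1 j g)" using G'(2) c by blast
      have cst: "D1 j (e1 (ev id c (q k))) = 0" if "k < n" for k
      proof -
        have "ev id c (q k) \<in> C" using q[OF that] c by (intro C.ev_mem) auto
        then show ?thesis unfolding comm1[OF j] using j by (simp add: constants_def)
      qed
      have fc: "fn w (E \<circ> c) = to_ac (\<Sum>k<n. w k * e1 (ev id c (q k)))" for w
        unfolding fn_def ev_E_base by (simp add: to_ac_sum)
      then have "g = (\<Sum>k<n. u k * e1 (ev id c (q k)))" using g(1) by simp
      then have "D1 j g = (\<Sum>k<n. D1 j (u k) * e1 (ev id c (q k)))"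
        by (simp add: derivation_sum[OF der1[OF j]] derivation_mult[OF der1[OF j]] cst)
      then have "H (E \<circ> c) = G' (E \<circ> c)" unfolding H_def fc g(2) by simp
      moreover have "G' y = G' (E \<circ> c)" by (rule relation_span_cong[OF G'(1) yc])
      moreover have "ev E y (q k) = ev E (E \<circ> c) (q k)" if "k < n" for k
        by (rule ev_cong[OF q[OF that] yc])
      then have "H y = H (E \<circ> c)" unfolding H_def fn_def by simp
      ultimately show "H y + (- 1) * G' y = 0" by simp
    qed
    then have "H = G'" by (intro ext) simp
    then show ?thesis using G'(1) u derivation_0[OF der1[OF j]] by (simp add: U_def H_def)
  qed
  have addU: "(\<lambda>k. u k + v k) \<in> U" if "u \<in> U" "v \<in> U" for u v
  proof -
    have "fn (\<lambda>k. u k + v k) = (\<lambda>y. fn u y + fn v y)" by (simp add: fn_def sum.distrib distrib_right)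
    then show ?thesis using that relation_span_add[of "fn v" "fn u"] by (simp add: U_def)
  qed
  have scaleU: "(\<lambda>k. b * u k) \<in> U" if "u \<in> U" for b u
  proof -
    have "fn (\<lambda>k. b * u k) = (\<lambda>y. to_ac b * fn u y)" by (simp add: fn_def sum_distrib_left mult.assoc)
    then show ?thesis using that relation_span_scale[of "fn u" b] by (simp add: U_def)
  qed
  define u where "u k = (if k < n then l k else 0)" for k
  have fu: "fn u y = ev E (mprod r Z y) e" for y unfolding ex fn_def by (simp add: u_def)
  have "(\<lambda>y. 0 + to_ac 1 * ev E (mprod r Z y) e) \<in> relation_span" by (intro relation_span.step relation_span.zero e)
  moreover have "fn u = (\<lambda>y. 0 + to_ac 1 * ev E (mprod r Z y) e)" by (rule ext) (simp add: fu)
  ultimately have "fn u \<in> relation_span" by (simp only:)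
  then have uU: "u \<in> U" by (simp add: U_def u_def)
  obtain N :: nat and co c where c: "\<forall>t<N. c t \<in> U \<and> (\<forall>k. c t k \<in> constants m D1)"
    "\<forall>k. u k = (\<Sum>t<N. co t * c t k)"
    using spanned_by_constants[of m D1 U n, OF der1 _ addU scaleU stable uU] by (auto simp: U_def)
  define d where "d t k = (SOME b. b \<in> C \<and> c t k = e1 b)" for t k
  have d: "d t k \<in> C \<and> c t k = e1 (d t k)" if "t < N" for t k
  proof -
    have "\<exists>b. b \<in> C \<and> c t k = e1 b" using c(1) that const1 by blast
    then show ?thesis unfolding d_def by (rule someI_ex)
  qed
  define q' where "q' t = esum (\<lambda>k. Mult (Const (d t k)) (q k)) n" for t
  have evq': "ev E y (q' t) = fn (c t) y" if "t < N" for t y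
    using d[OF that] by (simp add: q'_def ev_esum fn_def E_apply)
  have "q' t \<in> constant_relations" if t: "t < N" for t
  proof -
    have "q' t \<in> pexps C (idx r)" unfolding q'_def using q d[OF t] C.zero_mem by (intro esum_pexps) auto
    moreover have "(\<lambda>y. ev E y (q' t)) = fn (c t)" using evq'[OF t] by blast
    moreover have "fn (c t) \<in> relation_span" using c(1) t by (simp add: U_def)
    ultimately show ?thesis by (simp add: constant_relations_def)
  qed
  moreover have "ev E (mprod r Z y) e = (\<Sum>t<N. to_ac (co t) * ev E y (q' t))" for y
  proof -
    have "ev E (mprod r Z y) e = (\<Sum>k<n. to_ac (\<Sum>t<N. co t * c t k) * ev E y (q k))"
      using fu[of y] c(2) by (simp add: fn_def)
    also have "\<dots> = (\<Sum>k<n. \<Sum>t<N. to_ac (co t) * (to_ac (c t k) * ev E y (q k)))"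
      by (simp add: to_ac_sum sum_distrib_right mult.assoc)
    also have "\<dots> = (\<Sum>t<N. \<Sum>k<n. to_ac (co t) * (to_ac (c t k) * ev E y (q k)))" by (rule sum.swap)
    also have "\<dots> = (\<Sum>t<N. to_ac (co t) * ev E y (q' t))"
      by (rule sum.cong) (auto simp: evq' fn_def sum_distrib_left)
    finally show ?thesis .
  qed
  ultimately show ?thesis by blast
qed

lemma relation_span_witnesses:
  "G \<in> relation_span \<Longrightarrow> \<exists>S. finite S \<and> S \<subseteq> relations2 \<and> (\<forall>y. (\<forall>p\<in>S. ev E (mprod r Z y) p = 0) \<longrightarrow> G y = 0)"
proof (induction rule: relation_span.induct)
  case zero
  show ?case by (intro exI[of _ "{}"]) simp
next
  case (step G p b)
  then obtain S where "finite S" "S \<subseteq> relations2" "\<forall>y. (\<forall>p\<in>S. ev E (mprod r Z y) p = 0) \<longrightarrow> G y = 0" by blast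
  then show ?case using step.hyps by (intro exI[of _ "insert p S"]) auto
qed

text \<open>
  Finitely many equations over the constants decide whether a constant matrix \<open>y\<close> makes \<open>z1 y\<close>
  satisfy all relations of \<open>z2\<close>, and they follow from finitely many of these relations. The
  latter have the solution \<open>z2\<close>, hence by transfer a solution \<open>x\<close> in a real closed field around
  the first extension, so that \<open>z1\<^sup>-\<^sup>1 x\<close> solves the equations over the constants. A second
  transfer yields a constant solution.
\<close>

theorem constant_specialization:
  fixes P :: "'a alg_closure set" and Q :: "'b alg_closure set" and T :: "'k alg_closure set"
  assumes rc: "real_closed_cone P" "real_closed_cone Q" "real_closed_cone T"
    and T: "cone_field T = to_ac ` C" and P: "range to_ac \<subseteq> cone_field P" and Q: "range to_ac \<subseteq> cone_field Q"
    and sgn: "\<And>k. sg P (to_ac (e1 k)) = sg Q (to_ac (e2 k))"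
  shows "\<exists>M M'. (\<forall>v. M v \<in> C \<and> M' v \<in> C) \<and> mutually_inverse r M M' \<and>
    (\<forall>e\<in>relations2. ev e1 (mprod r z1 (e1 \<circ> M)) e = 0)"
proof -
  interpret P: real_closed_cone P by fact
  interpret Q: real_closed_cone Q by fact
  interpret T: real_closed_cone T by fact
  let ?W = "{..<2 * r} \<times> {..<r} :: (nat \<times> nat) set"
  obtain J0 where J0: "finite J0" "J0 \<subseteq> constant_relations" "\<And>x. (\<forall>e\<in>J0. ev id x e = 0) \<Longrightarrow> (\<forall>e\<in>constant_relations. ev id x e = 0)"
    using finitely_many_equations[OF C.subfld_axioms finite_idx[of r], of constant_relations] by (auto simp: constant_relations_def)
  have "\<exists>S. finite S \<and> S \<subseteq> relations2 \<and> (\<forall>y. (\<forall>p\<in>S. ev E (mprod r Z y) p = 0) \<longrightarrow> ev E y q = 0)" if "q \<in> J0" for q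
  proof -
    have "(\<lambda>y. ev E y q) \<in> relation_span" using J0(2) that unfolding constant_relations_def by blast
    then show ?thesis by (rule relation_span_witnesses)
  qed
  then have "\<forall>q\<in>J0. \<exists>S. finite S \<and> S \<subseteq> relations2 \<and> (\<forall>y. (\<forall>p\<in>S. ev E (mprod r Z y) p = 0) \<longrightarrow> ev E y q = 0)"
    by (intro ballI)
  from bchoice[OF this] obtain S where S_all:
    "\<forall>q\<in>J0. finite (S q) \<and> S q \<subseteq> relations2 \<and> (\<forall>y. (\<forall>p\<in>S q. ev E (mprod r Z y) p = 0) \<longrightarrow> ev E y q = 0)" ..
  then have S: "\<And>q. q \<in> J0 \<Longrightarrow> finite (S q) \<and> S q \<subseteq> relations2 \<and> (\<forall>y. (\<forall>p\<in>S q. ev E (mprod r Z y) p = 0) \<longrightarrow> ev E y q = 0)"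
    by (rule bspec)
  define E0 where "E0 = (\<Union>q\<in>J0. S q)"
  have E0: "finite E0" "E0 \<subseteq> relations2" unfolding E0_def using S J0(1) by auto
  have E0_J0: "ev E y q = 0" if "\<forall>p\<in>E0. ev E (mprod r Z y) p = 0" "q \<in> J0" for y q
    using S[OF that(2)] that by (auto simp: E0_def)
  \<comment> \<open>Rows \<open>r, \<dots>, 2 r - 1\<close> carry the inverse matrix.\<close>
  define y2 where "y2 = (\<lambda>(i, k). to_ac (if i < r then z2 (i, k) else w2 (i - r, k)))"
  have y2: "y2 v \<in> cone_field Q" for v using Q by (cases v) (auto simp: y2_def)
  interpret e2ac: comm_ring_hom "to_ac \<circ> e2"
    by (rule comm_ring_hom_comp[OF comm_ring_hom_to_ac]) unfold_locales
  interpret bac: comm_ring_hom "to_ac :: 'b \<Rightarrow> 'b alg_closure" by (rule comm_ring_hom_to_ac)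
  have fin: "finite (inverse_eqs r :: ('k, nat \<times> nat) pexp set)" by (simp add: inverse_eqs_def finite_idx)
  have sub1: "E0 \<union> inverse_eqs r \<subseteq> pexps UNIV ?W"
    using E0(2) idx_subset_double[of UNIV r] inverse_eqs_pexps[of "UNIV :: 'k set" r] by (auto simp: relations2_def)
  have UNIV_subfld: "subfld (UNIV :: 'k set)" by unfold_locales auto
  have "\<exists>x. (\<forall>w. x w \<in> cone_field P) \<and>
    (\<forall>e\<in>E0 \<union> inverse_eqs r. sg P (ev E x e) = sg Q (ev (to_ac \<circ> e2) y2 e))"
  proof (rule transfer_principle[OF rc(1,2) UNIV_subfld E.comm_ring_hom_axioms e2ac.comm_ring_hom_axioms _ _ _ _ _ sub1])
    show "E b \<in> cone_field P" "(to_ac \<circ> e2) b \<in> cone_field Q" "sg P (E b) = sg Q ((to_ac \<circ> e2) b)" for b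
      using P Q sgn by (auto simp: E_apply)
  qed (use fin E0(1) y2 in simp_all)
  then obtain x where x: "\<forall>w. x w \<in> cone_field P"
    "\<forall>e\<in>E0 \<union> inverse_eqs r. sg P (ev E x e) = sg Q (ev (to_ac \<circ> e2) y2 e)" by (elim exE conjE)
  have y2_z2: "ev (to_ac \<circ> e2) y2 e = to_ac (ev e2 z2 e)" if "e \<in> pexps UNIV (idx r)" for e
    unfolding bac.hom_ev using that by (rule ev_cong) (auto simp: y2_def idx_def)
  have zero1: "ev E x e = 0" if "e \<in> E0 \<union> inverse_eqs r" "ev (to_ac \<circ> e2) y2 e = 0" for e
  proof -
    have "ev E x e \<in> cone_field P" using sub1 that(1) P x(1) by (intro P.ev_mem[of e UNIV ?W]) (auto simp: E_apply)
    moreover have "sg P (ev E x e) = 0" using x(2) that by (simp add: Q.sg_0)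
    ultimately show ?thesis by (simp add: P.sg_eq_0_iff)
  qed
  have rel_x: "ev E x e = 0" if "e \<in> E0" for e
  proof (rule zero1)
    have "e \<in> relations2" using that E0(2) by blast
    then show "ev (to_ac \<circ> e2) y2 e = 0" using y2_z2[of e] by (simp add: relations2_def)
  qed (use that in simp)
  have "mutually_inverse r y2 (\<lambda>(i, k). y2 (r + i, k))"
  proof -
    have "mutually_inverse r (to_ac \<circ> z2) (to_ac \<circ> w2)" by (rule bac.hom_mutually_inverse[OF inv2])
    then show ?thesis by (simp add: mutually_inverse_def mprod_def y2_def)
  qed
  then have "\<forall>e\<in>inverse_eqs r. ev (to_ac \<circ> e2) y2 e = 0"
    by (subst inverse_eqs_iff) (simp_all add: e2.hom_uminus)
  then have "\<forall>e\<in>inverse_eqs r. ev E x e = 0" using zero1 by blast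
  moreover define x' where "x' = (\<lambda>(i, k). x (r + i, k))"
  ultimately have inv_x: "mutually_inverse r x x'" unfolding x'_def
    by (subst (asm) inverse_eqs_iff) (simp_all add: E.hom_uminus)
  define W where "W = to_ac \<circ> w1"
  have inv_Z: "mutually_inverse r Z W" unfolding Z_def W_def by (rule ac.hom_mutually_inverse[OF inv1])
  have ZF: "Z v \<in> cone_field P" "W v \<in> cone_field P" for v using P by (auto simp: Z_def W_def)
  define y0 y0' where "y0 = mprod r W x" and "y0' = mprod r x' Z"
  have y0F: "y0 v \<in> cone_field P" "y0' v \<in> cone_field P" for v
    unfolding y0_def y0'_def x'_def using ZF x(1) by (auto intro!: P.mprod_mem)
  have inv_y0: "mutually_inverse r y0 y0'" unfolding y0_def y0'_def
    by (rule mutually_inverse_mprod[OF mutually_inverse_sym[OF inv_Z] inv_x])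
  have J0_y0: "ev E y0 q = 0" if "q \<in> J0" for q
  proof (rule E0_J0[OF _ that], intro ballI)
    fix p assume p: "p \<in> E0"
    then have "p \<in> pexps UNIV (idx r)" using E0(2) by (auto simp: relations2_def)
    then have "ev E (mprod r Z y0) p = ev E x p"
      unfolding y0_def by (rule ev_cong) (rule mprod_cancel_left[OF inv_Z])
    then show "ev E (mprod r Z y0) p = 0" using rel_x[OF p] by simp
  qed
  \<comment> \<open>The ordering of a real closed field is determined by its squares.\<close>
  have sgnC: "sg T (to_ac c) = sg P (E c)" if c: "c \<in> C" for c
  proof -
    have pos: "E b \<in> P" if b: "to_ac b \<in> T" for b
    proof -
      obtain s where "s \<in> cone_field T" "s * s = to_ac b" using T.square_root_exists[OF b] by blast
      then obtain d where d: "to_ac (d * d) = to_ac b" using T by auto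
      then have bd: "b = d * d" by (simp del: to_ac_mult)
      then have "d \<noteq> 0" using b T.zero_not_pos by auto
      then have "E d * E d \<in> P" using P by (intro P.square_pos) (auto simp: E_apply)
      then show ?thesis by (simp add: bd E_apply e1.hom_mult)
    qed
    have "to_ac c \<in> cone_field T" using T c by simp
    then consider "c = 0" | "to_ac c \<in> T" | "to_ac (- c) \<in> T" using T.trichotomy[of "to_ac c"] by auto
    then show ?thesis
    proof cases
      case 3
      then have "sg T (to_ac c) = - 1" "sg P (E c) = - 1"
        using pos[OF 3] T.sg_eq_neg_iff P.sg_eq_neg_iff by (auto simp: E_apply e1.hom_uminus)
      then show ?thesis by simp
    qed (use pos in \<open>auto simp: sg_def P.zero_not_pos T.zero_not_pos\<close>)
  qed
  define y3 where "y3 = (\<lambda>(i, k). if i < r then y0 (i, k) else y0' (i - r, k))"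
  have y3: "y3 v \<in> cone_field P" for v using y0F by (cases v) (auto simp: y3_def)
  have sub2: "J0 \<union> inverse_eqs r \<subseteq> pexps C ?W"
    using J0(2) idx_subset_double[of C r] inverse_eqs_pexps[OF C.zero_mem C.uminus_mem[OF C.one_mem], of r]
    by (auto simp: constant_relations_def)
  have "\<exists>t. (\<forall>w. t w \<in> cone_field T) \<and> (\<forall>e\<in>J0 \<union> inverse_eqs r. sg T (ev to_ac t e) = sg P (ev E y3 e))"
  proof (rule transfer_principle[OF rc(3,1) C.subfld_axioms comm_ring_hom_to_ac E.comm_ring_hom_axioms _ _ _ _ _ sub2])
    show "to_ac b \<in> cone_field T" if "b \<in> C" for b using T that by simp
    show "E b \<in> cone_field P" for b using P by (auto simp: E_apply)
  qed (use fin J0(1) y3 sgnC in simp_all)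
  then obtain t where t: "\<forall>w. t w \<in> cone_field T"
    "\<forall>e\<in>J0 \<union> inverse_eqs r. sg T (ev to_ac t e) = sg P (ev E y3 e)" by (elim exE conjE)
  have zero2: "ev to_ac t e = 0" if "e \<in> J0 \<union> inverse_eqs r" "ev E y3 e = 0" for e
  proof -
    have "ev to_ac t e \<in> cone_field T" using sub2 that(1) T t(1) by (intro T.ev_mem[of e C ?W]) auto
    moreover have "sg T (ev to_ac t e) = 0" using t(2) that by (simp add: P.sg_0)
    ultimately show ?thesis by (simp add: T.sg_eq_0_iff)
  qed
  have "\<forall>v. \<exists>b. b \<in> C \<and> t v = to_ac b" using t(1) T by blast
  then obtain N where N: "\<And>v. N v \<in> C" "\<And>v. t v = to_ac (N v)" by metis
  interpret kac: comm_ring_hom "to_ac :: 'k \<Rightarrow> 'k alg_closure" by (rule comm_ring_hom_to_ac)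
  have tN: "ev to_ac t e = to_ac (ev id N e)" for e
  proof -
    have "t = to_ac \<circ> N" using N(2) by auto
    then show ?thesis by (simp add: kac.hom_ev)
  qed
  have "ev id N q = 0" if q: "q \<in> J0" for q
  proof -
    have "q \<in> pexps C (idx r)" using q J0(2) by (auto simp: constant_relations_def)
    then have "ev E y3 q = ev E y0 q" by (rule ev_cong) (auto simp: y3_def idx_def)
    then have "ev to_ac t q = 0" using zero2[of q] q J0_y0 by simp
    then show ?thesis using tN by simp
  qed
  then have relN: "ev id N q = 0" if "q \<in> constant_relations" for q using J0(3)[of N] that by blast
  have "mutually_inverse r y3 (\<lambda>(i, k). y3 (r + i, k))"
    using inv_y0 by (simp add: mutually_inverse_def mprod_def y3_def)
  then have "\<forall>e\<in>inverse_eqs r. ev E y3 e = 0"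
    by (subst inverse_eqs_iff) (simp_all add: E.hom_uminus)
  then have "\<forall>e\<in>inverse_eqs r. ev id N e = 0" using zero2 tN by (metis UnI2 to_ac_eq_0_iff)
  moreover define N' where "N' = (\<lambda>(i, k). N (r + i, k))"
  ultimately have inv_N: "mutually_inverse r N N'" unfolding N'_def
    by (subst (asm) inverse_eqs_iff) simp_all
  have "ev e1 (mprod r z1 (e1 \<circ> N)) e = 0" if e: "e \<in> relations2" for e
  proof -
    obtain n :: nat and co q where q: "\<forall>t<n. q t \<in> constant_relations" "\<forall>y. ev E (mprod r Z y) e = (\<Sum>t<n. to_ac (co t) * ev E y (q t))"
      using relation_from_constants[OF e] by blast
    have "mprod r Z (E \<circ> N) = to_ac \<circ> mprod r z1 (e1 \<circ> N)"
      unfolding Z_def E_def by (rule ext) (simp add: ac.hom_mprod comp_assoc)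
    then have "to_ac (ev e1 (mprod r z1 (e1 \<circ> N)) e) = ev E (mprod r Z (E \<circ> N)) e" by (simp only: ev_E)
    also have "\<dots> = (\<Sum>t<n. to_ac (co t) * ev E (E \<circ> N) (q t))" using q(2) by blast
    also have "\<dots> = 0" unfolding ev_E_base using q(1) relN by simp
    finally show ?thesis by simp
  qed
  moreover have "N' v \<in> C" for v using N(1) by (cases v) (simp add: N'_def)
  ultimately show ?thesis using N(1) inv_N by blast
qed

end

section \<open>Equality of the relations\<close>

definition psub :: "nat \<Rightarrow> (nat \<times> nat \<Rightarrow> 'k::comm_ring_1) \<Rightarrow> ('k, nat \<times> nat) pexp \<Rightarrow> ('k, nat \<times> nat) pexp" where
  "psub r M = rec_pexp Const (\<lambda>(i, k). esum (\<lambda>l. Mult (Var (i, l)) (Const (M (l, k)))) r) (\<lambda>_ _. Add) (\<lambda>_ _. Mult)"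

lemma psub_simps:
  "psub r M (Const c) = Const c" "psub r M (Var (i, k)) = esum (\<lambda>l. Mult (Var (i, l)) (Const (M (l, k)))) r"
  "psub r M (Add f g) = Add (psub r M f) (psub r M g)" "psub r M (Mult f g) = Mult (psub r M f) (psub r M g)"
  by (simp_all add: psub_def)

lemma ev_psub: "h 0 = 0 \<Longrightarrow> ev h x (psub r M e) = ev h (mprod r x (h \<circ> M)) e"
proof (induction e)
  case (Var v)
  then show ?case by (cases v) (simp add: psub_simps ev_esum mprod_def)
qed (simp_all add: psub_simps)

lemma psub_pexps: "e \<in> pexps UNIV (idx r) \<Longrightarrow> psub r M e \<in> pexps UNIV (idx r)"
proof (induction e)
  case (Var v)
  then show ?case by (cases v) (auto simp: psub_simps idx_def intro!: esum_pexps)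
qed (simp_all add: psub_simps)

context
  fixes e :: "'k::field \<Rightarrow> 'b::field"
  assumes hom: "field_hom e"
begin

interpretation e: field_hom e by (rule hom)

interpretation V: vector_space "\<lambda>k v. e k * v"
  by unfold_locales (simp_all add: algebra_simps e.hom_add e.hom_mult)

text \<open>
  Used for the points \<open>z N\<close> with \<open>N\<close> over the base field, whose entries are combinations of
  those of \<open>z\<close>.
\<close>

lemma values_finite_dimensional:
  assumes "finite B"
  shows "p \<in> pexps UNIV W \<Longrightarrow> \<exists>S. finite S \<and> (\<forall>x. (\<forall>v\<in>W. x v \<in> V.span B) \<longrightarrow> ev e x p \<in> V.span S)"
proof (induction p)
  case (Const c)
  have "e c * 1 \<in> V.span {1}" by (intro V.span_scale V.span_base) simp
  then show ?case by (intro exI[of _ "{1}"]) simp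
next
  case (Var v)
  then show ?case using assms by (intro exI[of _ B]) simp
next
  case (Add f g)
  have fg: "f \<in> pexps UNIV W" "g \<in> pexps UNIV W" using Add.prems by simp_all
  obtain S where S: "finite S" "\<And>x. \<forall>v\<in>W. x v \<in> V.span B \<Longrightarrow> ev e x f \<in> V.span S"
    using Add.IH(1)[OF fg(1)] by blast
  obtain T where T: "finite T" "\<And>x. \<forall>v\<in>W. x v \<in> V.span B \<Longrightarrow> ev e x g \<in> V.span T"
    using Add.IH(2)[OF fg(2)] by blast
  have "ev e x (Add f g) \<in> V.span (S \<union> T)" if "\<forall>v\<in>W. x v \<in> V.span B" for x
  proof -
    have "ev e x f \<in> V.span (S \<union> T)" using S(2)[OF that] V.span_mono[of S "S \<union> T"] by blast
    moreover have "ev e x g \<in> V.span (S \<union> T)" using T(2)[OF that] V.span_mono[of T "S \<union> T"] by blast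
    ultimately show ?thesis by (simp add: V.span_add)
  qed
  then show ?case using S(1) T(1) by (intro exI[of _ "S \<union> T"]) simp
next
  case (Mult f g)
  have fg: "f \<in> pexps UNIV W" "g \<in> pexps UNIV W" using Mult.prems by simp_all
  obtain S where S: "finite S" "\<And>x. \<forall>v\<in>W. x v \<in> V.span B \<Longrightarrow> ev e x f \<in> V.span S"
    using Mult.IH(1)[OF fg(1)] by blast
  obtain T where T: "finite T" "\<And>x. \<forall>v\<in>W. x v \<in> V.span B \<Longrightarrow> ev e x g \<in> V.span T"
    using Mult.IH(2)[OF fg(2)] by blast
  define ST where "ST = (\<lambda>(s, t). s * t) ` (S \<times> T)"
  have "s * t \<in> V.span ST" if s: "s \<in> V.span S" and t: "t \<in> V.span T" for s t
    using s
  proof (induction rule: V.span_induct_alt)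
    case base
    show ?case by (simp add: V.span_zero)
  next
    case (step c s0 s)
    have "s0 * t \<in> V.span ST" using t
    proof (induction rule: V.span_induct_alt)
      case base
      show ?case by (simp add: V.span_zero)
    next
      case (step d t0 t)
      have "s0 * t0 \<in> V.span ST" using \<open>s0 \<in> S\<close> step.hyps by (intro V.span_base) (auto simp: ST_def)
      then have "e d * (s0 * t0) + s0 * t \<in> V.span ST" using step by (intro V.span_add V.span_scale)
      then show ?case by (simp add: algebra_simps)
    qed
    then have "e c * (s0 * t) + s * t \<in> V.span ST" using step by (intro V.span_add V.span_scale)
    then show ?case by (simp add: algebra_simps)
  qed
  then show ?case using S T by (intro exI[of _ ST]) (auto simp: ST_def)
qed

text \<open>
  The values of \<open>p\<close> at the points \<open>z, z N\<^sup>-\<^sup>1, z N\<^sup>-\<^sup>2, \<dots>\<close> lie in a finite-dimensional space,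
  so there is a linear relation between them. By \<open>H\<close> the relation persists when \<open>z\<close> is replaced
  by \<open>z N\<close>; this moves every point one step back, and the first term \<open>p (z N)\<close> is \<open>0\<close>.
  Repeating this leaves the last coefficient times \<open>p (z)\<close>.
\<close>

lemma relations_preserved_reflected:
  assumes inv: "mutually_inverse r N N'"
    and H: "\<And>q. q \<in> pexps UNIV (idx r) \<Longrightarrow> ev e z q = 0 \<Longrightarrow> ev e (mprod r z (e \<circ> N)) q = 0"
    and p: "p \<in> pexps UNIV (idx r)" "ev e (mprod r z (e \<circ> N)) p = 0"
  shows "ev e z p = 0"
proof -
  define P where "P j = (psub r N' ^^ j) p" for j
  have P0: "P 0 = p" and PS: "P (Suc j) = psub r N' (P j)" for j by (simp_all add: P_def)
  have Pm: "P j \<in> pexps UNIV (idx r)" for j by (induction j) (auto simp: P0 PS p psub_pexps)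
  have shift: "ev e (mprod r z (e \<circ> N)) (P (Suc j)) = ev e z (P j)" for j
  proof -
    have "ev e (mprod r z (e \<circ> N)) (P (Suc j)) = ev e (mprod r (mprod r z (e \<circ> N)) (e \<circ> N')) (P j)"
      by (simp add: PS ev_psub)
    also have "\<dots> = ev e z (P j)"
      by (rule ev_cong[OF Pm]) (rule mprod_cancel_right[OF e.hom_mutually_inverse[OF inv]])
    finally show ?thesis .
  qed
  have descent: "e (c t) * ev e z p = 0" if "(\<Sum>j\<le>t. e (c j) * ev e z (P j)) = 0" for c and t :: nat
    using that
  proof (induction t arbitrary: c)
    case 0
    then show ?case by (simp add: P0)
  next
    case (Suc t)
    define q where "q = esum (\<lambda>j. Mult (Const (c j)) (P j)) (Suc (Suc t))"
    have evq: "ev e x q = (\<Sum>j\<le>Suc t. e (c j) * ev e x (P j))" for x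
      unfolding q_def ev_esum[of e, OF e.hom_zero] by (simp add: lessThan_Suc_atMost)
    have "ev e (mprod r z (e \<circ> N)) q = 0"
    proof (rule H)
      show "q \<in> pexps UNIV (idx r)" unfolding q_def using Pm by (intro esum_pexps) auto
      show "ev e z q = 0" unfolding evq by (rule Suc.prems)
    qed
    then have "(\<Sum>j\<le>t. e (c (Suc j)) * ev e z (P j)) = 0"
      unfolding evq sum.atMost_Suc_shift shift using p(2) by (simp add: P0)
    then show ?case by (rule Suc.IH)
  qed
  define B where "B = z ` idx r"
  have finB: "finite B" by (simp add: B_def finite_idx)
  obtain S where S: "finite S" "\<And>x. \<forall>v\<in>idx r. x v \<in> V.span B \<Longrightarrow> ev e x p \<in> V.span S"
    using values_finite_dimensional[OF finB p(1)] by blast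
  have inS: "\<forall>v\<in>idx r. x v \<in> V.span B \<Longrightarrow> ev e x (P j) \<in> V.span S" for x j
  proof (induction j arbitrary: x)
    case 0
    then show ?case using S(2) by (simp add: P0)
  next
    case (Suc j)
    have "mprod r x (e \<circ> N') v \<in> V.span B" if vidx: "v \<in> idx r" for v
    proof -
      obtain i k where v: "v = (i, k)" "i < r" "k < r" using vidx by (rule idx_cases)
      have "(\<Sum>l<r. e (N' (l, k)) * x (i, l)) \<in> V.span B"
        using Suc.prems v by (intro V.span_sum V.span_scale) (auto simp: idx_def)
      then show ?thesis by (simp add: v mprod_def mult.commute)
    qed
    then show ?case using Suc.IH by (simp add: PS ev_psub)
  qed
  have zB: "\<forall>v\<in>idx r. z v \<in> V.span B" by (auto simp: B_def intro: V.span_base)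
  define n where "n = card S"
  obtain mu where mu: "bij_betw mu {0..<n} S" using ex_bij_betw_nat_finite[OF S(1)] unfolding n_def by blast
  have "\<exists>u. ev e z (P j) = (\<Sum>i<n. e (u i) * mu i)" for j
  proof -
    obtain u where "ev e z (P j) = (\<Sum>s\<in>S. e (u s) * s)"
      using inS[OF zB, of j] unfolding V.span_finite[OF S(1)] by blast
    also have "\<dots> = (\<Sum>i\<in>{0..<n}. e (u (mu i)) * mu i)"
      by (rule sum.reindex_bij_betw[OF mu, symmetric])
    finally show ?thesis unfolding atLeast0LessThan by (intro exI[of _ "\<lambda>i. u (mu i)"])
  qed
  then obtain u where u: "\<And>j. ev e z (P j) = (\<Sum>i<n. e (u j i) * mu i)" by metis
  have "subfld (UNIV :: 'k set)" by unfold_locales auto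
  from subfld.linear_dependence[OF this, of "\<lambda>i j. u j i" n]
  obtain c where c: "\<exists>j\<le>n. c j \<noteq> 0" "\<And>i. i < n \<Longrightarrow> (\<Sum>j\<le>n. u j i * c j) = 0" by auto
  define t where "t = Max {j. j \<le> n \<and> c j \<noteq> 0}"
  have "t \<in> {j. j \<le> n \<and> c j \<noteq> 0}" unfolding t_def using c(1) by (intro Max_in) auto
  then have t: "t \<le> n" "c t \<noteq> 0" by auto
  have tmax: "c j = 0" if "j \<le> n" "t < j" for j
  proof (rule ccontr)
    assume "c j \<noteq> 0"
    then have "j \<le> t" unfolding t_def using that by (intro Max_ge) auto
    then show False using that by simp
  qed
  have "(\<Sum>j\<le>n. e (c j) * ev e z (P j)) = (\<Sum>j\<le>n. \<Sum>i<n. e (u j i * c j) * mu i)"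
    unfolding u by (simp add: sum_distrib_left e.hom_mult ac_simps)
  also have "\<dots> = (\<Sum>i<n. \<Sum>j\<le>n. e (u j i * c j) * mu i)" by (rule sum.swap)
  also have "\<dots> = (\<Sum>i<n. e (\<Sum>j\<le>n. u j i * c j) * mu i)" by (simp add: e.hom_sum sum_distrib_right)
  also have "\<dots> = 0" using c(2) by simp
  finally have "(\<Sum>j\<le>n. e (c j) * ev e z (P j)) = 0" .
  moreover have "(\<Sum>j\<le>t. e (c j) * ev e z (P j)) = (\<Sum>j\<le>n. e (c j) * ev e z (P j))"
    by (rule sum.mono_neutral_left) (use t tmax in auto)
  ultimately have "e (c t) * ev e z p = 0" using descent by simp
  then show ?thesis using t(2) by simp
qed

end

section \<open>The isomorphism\<close>

text \<open>The graph of the isomorphism to be constructed.\<close>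

definition quotient_graph ::
  "nat \<Rightarrow> ('k::field \<Rightarrow> 'a::field) \<Rightarrow> (nat \<times> nat \<Rightarrow> 'a) \<Rightarrow> ('k \<Rightarrow> 'b::field) \<Rightarrow> (nat \<times> nat \<Rightarrow> 'b) \<Rightarrow> ('a \<times> 'b) set" where
  "quotient_graph r e1 x1 e2 x2 = {(ev e1 x1 f / ev e1 x1 g, ev e2 x2 f / ev e2 x2 g) | f g.
     f \<in> pexps UNIV (idx r) \<and> g \<in> pexps UNIV (idx r) \<and> ev e1 x1 g \<noteq> 0}"

lemma generated_quotients:
  fixes e :: "'k::field \<Rightarrow> 'l::field"
  assumes hom: "field_hom e" and gen: "generate_field ring_of_type_algebra (range e \<union> S) = UNIV"
    and S: "\<And>s. s \<in> S \<Longrightarrow> \<exists>f\<in>pexps UNIV (idx r). ev e x f = s"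
  shows "\<exists>f\<in>pexps UNIV (idx r). \<exists>g\<in>pexps UNIV (idx r). ev e x g \<noteq> 0 \<and> s = ev e x f / ev e x g"
proof -
  interpret e: field_hom e by fact
  have "s \<in> generate_field ring_of_type_algebra (range e \<union> S)" using gen by simp
  then show ?thesis
  proof induction
    case one
    show ?case by (intro bexI[of _ "Const 1"]) (auto simp: ring_of_type_algebra_simps)
  next
    case (incl h)
    have "\<exists>f\<in>pexps UNIV (idx r). ev e x f = h"
    proof (cases "h \<in> S")
      case False
      then obtain c where "h = e c" using incl by blast
      then show ?thesis by (intro bexI[of _ "Const c"]) simp_all
    qed (rule S)
    then obtain f where "f \<in> pexps UNIV (idx r)" "ev e x f = h" by blast
    then show ?case by (intro bexI[of _ f] bexI[of _ "Const 1"]) auto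
  next
    case (a_inv h)
    then obtain f g where "f \<in> pexps UNIV (idx r)" "g \<in> pexps UNIV (idx r)" "ev e x g \<noteq> 0" "h = ev e x f / ev e x g" by blast
    then show ?case
      by (intro bexI[of _ "Mult (Const (- 1)) f"] bexI[of _ g]) (auto simp: ring_of_type_algebra_inverses e.hom_uminus)
  next
    case (m_inv h)
    then obtain f g where fg: "f \<in> pexps UNIV (idx r)" "g \<in> pexps UNIV (idx r)" "ev e x g \<noteq> 0" "h = ev e x f / ev e x g" by blast
    have "h \<noteq> 0" using m_inv by (simp add: ring_of_type_algebra_simps)
    then show ?case using fg
      by (intro bexI[of _ g] bexI[of _ f]) (auto simp: ring_of_type_algebra_inverses)
  next
    case (eng_add h1 h2)
    then obtain f g f' g' where fg: "f \<in> pexps UNIV (idx r)" "g \<in> pexps UNIV (idx r)" "ev e x g \<noteq> 0" "h1 = ev e x f / ev e x g"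
      "f' \<in> pexps UNIV (idx r)" "g' \<in> pexps UNIV (idx r)" "ev e x g' \<noteq> 0" "h2 = ev e x f' / ev e x g'" by blast
    then show ?case
      by (intro bexI[of _ "Add (Mult f g') (Mult f' g)"] bexI[of _ "Mult g g'"]) (auto simp: ring_of_type_algebra_simps add_frac_eq)
  next
    case (eng_mult h1 h2)
    then obtain f g f' g' where fg: "f \<in> pexps UNIV (idx r)" "g \<in> pexps UNIV (idx r)" "ev e x g \<noteq> 0" "h1 = ev e x f / ev e x g"
      "f' \<in> pexps UNIV (idx r)" "g' \<in> pexps UNIV (idx r)" "ev e x g' \<noteq> 0" "h2 = ev e x f' / ev e x g'" by blast
    then show ?case
      by (intro bexI[of _ "Mult f f'"] bexI[of _ "Mult g g'"]) (auto simp: ring_of_type_algebra_simps)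
  qed
qed

lemma derivation_divide:
  assumes "derivation D" "y \<noteq> 0"
  shows "D (x / y) = (D x * y - x * D y) / (y * y)"
proof -
  have "D (x / y) = D (x * inverse y)" by (simp add: field_class.field_divide_inverse)
  also have "\<dots> = D x * inverse y + x * (- D y * (inverse y * inverse y))"
    by (simp only: derivation_mult[OF assms(1)] derivation_inverse[OF assms])
  also have "\<dots> = (D x * y - x * D y) / (y * y)" using assms(2) by (simp add: field_simps)
  finally show ?thesis .
qed

text \<open>
  Equality of two quotients is a polynomial relation, so the graph is functional in both
  directions. It is stable under the derivations because these act on the polynomials in both
  matrices through the same derivation of the polynomial ring.
\<close>

theorem same_relations_isomorphic:
  fixes e1 :: "'k::field \<Rightarrow> 'a::field" and e2 :: "'k \<Rightarrow> 'b::field"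
  assumes hom: "field_hom e1" "field_hom e2"
    and rel: "\<And>p. p \<in> pexps UNIV (idx r) \<Longrightarrow> ev e1 x1 p = 0 \<longleftrightarrow> ev e2 x2 p = 0"
    and quot1: "\<And>s. \<exists>f\<in>pexps UNIV (idx r). \<exists>g\<in>pexps UNIV (idx r). ev e1 x1 g \<noteq> 0 \<and> s = ev e1 x1 f / ev e1 x1 g"
    and quot2: "\<And>s. \<exists>f\<in>pexps UNIV (idx r). \<exists>g\<in>pexps UNIV (idx r). ev e2 x2 g \<noteq> 0 \<and> s = ev e2 x2 f / ev e2 x2 g"
    and der: "\<And>j. j \<in> {1..m} \<Longrightarrow> derivation (D1 j)" "\<And>j. j \<in> {1..m} \<Longrightarrow> derivation (D2 j)"
    and comm: "\<And>j c. j \<in> {1..m} \<Longrightarrow> D1 j (e1 c) = e1 (DK j c)" "\<And>j c. j \<in> {1..m} \<Longrightarrow> D2 j (e2 c) = e2 (DK j c)"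
    and sol: "\<And>j v. j \<in> {1..m} \<Longrightarrow> v \<in> idx r \<Longrightarrow> D1 j (x1 v) = mprod r (e1 \<circ> a j) x1 v"
      "\<And>j v. j \<in> {1..m} \<Longrightarrow> v \<in> idx r \<Longrightarrow> D2 j (x2 v) = mprod r (e2 \<circ> a j) x2 v"
  shows "differentially_isomorphic m D1 e1 D2 e2"
proof -
  interpret e1: field_hom e1 by fact
  interpret e2: field_hom e2 by fact
  let ?P = "pexps UNIV (idx r) :: ('k, nat \<times> nat) pexp set"
  define \<Gamma> where "\<Gamma> = quotient_graph r e1 x1 e2 x2"
  have \<Gamma>I: "(s, t) \<in> \<Gamma>" if "f \<in> ?P" "g \<in> ?P" "ev e1 x1 g \<noteq> 0"
    "s = ev e1 x1 f / ev e1 x1 g" "t = ev e2 x2 f / ev e2 x2 g" for s t f g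
    using that unfolding \<Gamma>_def quotient_graph_def by blast
  have \<Gamma>E: "\<exists>f\<in>?P. \<exists>g\<in>?P. ev e1 x1 g \<noteq> 0 \<and> ev e2 x2 g \<noteq> 0 \<and> s = ev e1 x1 f / ev e1 x1 g \<and> t = ev e2 x2 f / ev e2 x2 g"
    if "(s, t) \<in> \<Gamma>" for s t
    using that rel unfolding \<Gamma>_def quotient_graph_def by blast
  have unique: "s = s' \<longleftrightarrow> t = t'" if st: "(s, t) \<in> \<Gamma>" "(s', t') \<in> \<Gamma>" for s t s' t'
  proof -
    obtain f g where f: "f \<in> ?P" "g \<in> ?P" "ev e1 x1 g \<noteq> 0" "ev e2 x2 g \<noteq> 0"
      "s = ev e1 x1 f / ev e1 x1 g" "t = ev e2 x2 f / ev e2 x2 g" using \<Gamma>E[OF st(1)] by blast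
    obtain f' g' where f': "f' \<in> ?P" "g' \<in> ?P" "ev e1 x1 g' \<noteq> 0" "ev e2 x2 g' \<noteq> 0"
      "s' = ev e1 x1 f' / ev e1 x1 g'" "t' = ev e2 x2 f' / ev e2 x2 g'" using \<Gamma>E[OF st(2)] by blast
    define q where "q = Add (Mult f g') (Mult (Const (- 1)) (Mult f' g))"
    have "q \<in> ?P" using f f' by (simp add: q_def)
    moreover have "ev e1 x1 q = ev e1 x1 f * ev e1 x1 g' - ev e1 x1 f' * ev e1 x1 g"
      "ev e2 x2 q = ev e2 x2 f * ev e2 x2 g' - ev e2 x2 f' * ev e2 x2 g"
      by (simp_all add: q_def e1.hom_uminus e2.hom_uminus)
    moreover have "s = s' \<longleftrightarrow> ev e1 x1 f * ev e1 x1 g' - ev e1 x1 f' * ev e1 x1 g = 0"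
      using f f' by (simp add: frac_eq_eq)
    moreover have "t = t' \<longleftrightarrow> ev e2 x2 f * ev e2 x2 g' - ev e2 x2 f' * ev e2 x2 g = 0"
      using f f' by (simp add: frac_eq_eq)
    ultimately show ?thesis using rel[of q] by simp
  qed
  have total1: "\<exists>t. (s, t) \<in> \<Gamma>" for s using quot1[of s] \<Gamma>I by blast
  have total2: "\<exists>s. (s, t) \<in> \<Gamma>" for t
  proof -
    obtain f g where f: "f \<in> ?P" "g \<in> ?P" "ev e2 x2 g \<noteq> 0" "t = ev e2 x2 f / ev e2 x2 g" using quot2[of t] by blast
    then have "ev e1 x1 g \<noteq> 0" using rel by blast
    then show ?thesis using \<Gamma>I[OF f(1,2)] f(4) by blast
  qed
  have \<Gamma>_base: "(e1 c, e2 c) \<in> \<Gamma>" for c by (rule \<Gamma>I[of "Const c" "Const 1"]) simp_all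
  have \<Gamma>_add: "(s + s', t + t') \<in> \<Gamma>" and \<Gamma>_mult: "(s * s', t * t') \<in> \<Gamma>"
    if st: "(s, t) \<in> \<Gamma>" "(s', t') \<in> \<Gamma>" for s t s' t'
  proof -
    obtain f g where f: "f \<in> ?P" "g \<in> ?P" "ev e1 x1 g \<noteq> 0" "ev e2 x2 g \<noteq> 0"
      "s = ev e1 x1 f / ev e1 x1 g" "t = ev e2 x2 f / ev e2 x2 g" using \<Gamma>E[OF st(1)] by blast
    obtain f' g' where f': "f' \<in> ?P" "g' \<in> ?P" "ev e1 x1 g' \<noteq> 0" "ev e2 x2 g' \<noteq> 0"
      "s' = ev e1 x1 f' / ev e1 x1 g'" "t' = ev e2 x2 f' / ev e2 x2 g'" using \<Gamma>E[OF st(2)] by blast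
    show "(s + s', t + t') \<in> \<Gamma>"
      using f f' by (intro \<Gamma>I[of "Add (Mult f g') (Mult f' g)" "Mult g g'"]) (auto simp: add_frac_eq)
    show "(s * s', t * t') \<in> \<Gamma>"
      using f f' by (intro \<Gamma>I[of "Mult f f'" "Mult g g'"]) auto
  qed
  have \<Gamma>_der: "(D1 j s, D2 j t) \<in> \<Gamma>" if st: "(s, t) \<in> \<Gamma>" and j: "j \<in> {1..m}" for s t j
  proof -
    obtain f g where f: "f \<in> ?P" "g \<in> ?P" "ev e1 x1 g \<noteq> 0" "ev e2 x2 g \<noteq> 0"
      "s = ev e1 x1 f / ev e1 x1 g" "t = ev e2 x2 f / ev e2 x2 g" using \<Gamma>E[OF st] by blast
    let ?d = "ederiv (DK j) (sys_exp r (a j))"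
    have dP: "?d p \<in> ?P" if "p \<in> ?P" for p using that sys_exp_pexps by (intro ederiv_pexps)
    have d1: "D1 j (ev e1 x1 p) = ev e1 x1 (?d p)" if "p \<in> ?P" for p
    proof (rule derivation_ev[of "D1 j" e1 "DK j" p "idx r", OF der(1)[OF j] comm(1)[OF j] that])
      show "D1 j (x1 v) = ev e1 x1 (sys_exp r (a j) v)" if "v \<in> idx r" for v
        using sol(1)[OF j that] by (simp add: ev_sys_exp)
    qed
    have d2: "D2 j (ev e2 x2 p) = ev e2 x2 (?d p)" if "p \<in> ?P" for p
    proof (rule derivation_ev[of "D2 j" e2 "DK j" p "idx r", OF der(2)[OF j] comm(2)[OF j] that])
      show "D2 j (x2 v) = ev e2 x2 (sys_exp r (a j) v)" if "v \<in> idx r" for v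
        using sol(2)[OF j that] by (simp add: ev_sys_exp)
    qed
    show ?thesis
    proof (rule \<Gamma>I[of "Add (Mult (?d f) g) (Mult (Const (- 1)) (Mult f (?d g)))" "Mult g g"])
      show "D1 j s = ev e1 x1 (Add (Mult (?d f) g) (Mult (Const (- 1)) (Mult f (?d g)))) / ev e1 x1 (Mult g g)"
        unfolding f(5) derivation_divide[OF der(1)[OF j] f(3)] d1[OF f(1)] d1[OF f(2)] by (simp add: e1.hom_uminus)
      show "D2 j t = ev e2 x2 (Add (Mult (?d f) g) (Mult (Const (- 1)) (Mult f (?d g)))) / ev e2 x2 (Mult g g)"
        unfolding f(6) derivation_divide[OF der(2)[OF j] f(4)] d2[OF f(1)] d2[OF f(2)] by (simp add: e2.hom_uminus)
    qed (use f dP in simp_all)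
  qed
  define \<phi> where "\<phi> s = (SOME t. (s, t) \<in> \<Gamma>)" for s
  have \<phi>: "(s, \<phi> s) \<in> \<Gamma>" for s unfolding \<phi>_def by (rule someI_ex[OF total1])
  have \<phi>_eq: "\<phi> s = t" if "(s, t) \<in> \<Gamma>" for s t using unique[OF \<phi>[of s] that] by simp
  have "field_hom \<phi>"
  proof
    show "\<phi> (s + s') = \<phi> s + \<phi> s'" for s s' by (rule \<phi>_eq[OF \<Gamma>_add[OF \<phi> \<phi>]])
    show "\<phi> (s * s') = \<phi> s * \<phi> s'" for s s' by (rule \<phi>_eq[OF \<Gamma>_mult[OF \<phi> \<phi>]])
    show "\<phi> 1 = 1" using \<phi>_eq[OF \<Gamma>_base[of 1]] by simp
    show "\<phi> 0 = 0" using \<phi>_eq[OF \<Gamma>_base[of 0]] by simp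
  qed
  moreover have "\<phi> (D1 j s) = D2 j (\<phi> s)" if "j \<in> {1..m}" for j s
    by (rule \<phi>_eq[OF \<Gamma>_der[OF \<phi> that]])
  moreover have "bij \<phi>"
  proof (rule bijI)
    show "inj \<phi>"
    proof (rule injI)
      fix s s' assume "\<phi> s = \<phi> s'"
      then show "s = s'" using unique[OF \<phi>[of s] \<phi>[of s']] by simp
    qed
    show "surj \<phi>" using total2 \<phi>_eq by (metis surjI)
  qed
  moreover have "\<phi> (e1 c) = e2 c" for c by (rule \<phi>_eq[OF \<Gamma>_base])
  ultimately show ?thesis unfolding differentially_isomorphic_def differential_hom_def by blast
qed

section \<open>Uniqueness of the formally real Picard--Vessiot extension\<close>

lemma (in pos_cone) infinite_F: "infinite F"
proof -
  have "inj (of_nat :: nat \<Rightarrow> 'a)"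
  proof (rule injI)
    fix i j :: nat assume ij: "(of_nat i :: 'a) = of_nat j"
    have "of_nat k \<noteq> (of_nat l :: 'a)" if "l < k" for k l
    proof -
      have "(of_nat (k - l) :: 'a) \<noteq> 0" using that by (intro of_nat_neq_0) simp
      then show ?thesis using that by (simp add: of_nat_diff)
    qed
    then show "i = j" using ij by (metis linorder_neqE_nat)
  qed
  then have "infinite (range (of_nat :: nat \<Rightarrow> 'a))" by (simp add: range_inj_infinite)
  moreover have "range of_nat \<subseteq> F" using of_nat_mem by blast
  ultimately show ?thesis using finite_subset by blast
qed

text \<open>A cone extending the given one induces no other ordering on the image of the field.\<close>

lemma real_closure_of_ordering:
  fixes R :: "'a::field rel"
  assumes "field_ordering_on UNIV R"
  shows "\<exists>P :: 'a alg_closure set. real_closed_cone P \<and> range to_ac \<subseteq> cone_field P \<and>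
    (\<forall>x. to_ac x \<in> P \<longleftrightarrow> x \<noteq> 0 \<and> (0, x) \<in> R)"
proof -
  define P0 where "P0 = {x \<in> UNIV. x \<noteq> 0 \<and> (0, x) \<in> R}"
  have "subfld (UNIV :: 'a set)" by unfold_locales auto
  then have P0: "pos_cone P0" "cone_field P0 = UNIV"
    unfolding P0_def using pos_cone_of_ordering assms by blast+
  obtain P where P: "to_ac ` P0 \<subseteq> P" "real_closed_cone P"
    using real_closure_exists[OF pos_cone_image(1)[OF P0(1) field_hom_to_ac]] by blast
  interpret real_closed_cone P by fact
  have pos: "to_ac x \<in> P" if "x \<in> P0" for x using P(1) that by blast
  have tri: "x = 0 \<or> x \<in> P0 \<or> - x \<in> P0" for x using P0(2) by (auto simp: cone_field_def)
  have "to_ac x \<in> P \<longleftrightarrow> x \<in> P0" for x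
    using tri[of x] pos[of x] pos[of "- x"] zero_not_pos not_both[of "to_ac x"] by auto
  moreover have "to_ac x \<in> F" for x
    using tri[of x] pos[of x] pos[of "- x"] by (auto simp: cone_field_def)
  ultimately show ?thesis using P(2) by (intro exI[of _ P]) (auto simp: P0_def)
qed

lemma fundamental_matrix_entries:
  assumes Z: "fundamental_matrix m DL e r A Z" and A: "\<And>j. j \<in> {1..m} \<Longrightarrow> A j \<in> carrier_mat r r"
  shows "\<exists>w. mutually_inverse r (\<lambda>v. Z $$ v) w"
    and "j \<in> {1..m} \<Longrightarrow> v \<in> idx r \<Longrightarrow> DL j (Z $$ v) = mprod r (e \<circ> (\<lambda>v. A j $$ v)) (\<lambda>v. Z $$ v) v"
    and "s \<in> elements_mat Z \<Longrightarrow> \<exists>v\<in>idx r. s = Z $$ v"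
proof -
  have Zc: "Z \<in> carrier_mat r r" using Z by (simp add: fundamental_matrix_def)
  obtain B where B: "Z * B = 1\<^sub>m r" "B * Z = 1\<^sub>m (dim_row B)"
    using Z Zc unfolding fundamental_matrix_def invertible_mat_def inverts_mat_def by auto
  have Bc: "B \<in> carrier_mat r r"
  proof
    show "dim_col B = r" using arg_cong[OF B(1), of dim_col] by simp
    show "dim_row B = r" using arg_cong[OF B(2), of dim_col] Zc by simp
  qed
  have prod: "(S * T) $$ (i, k) = mprod r (\<lambda>v. S $$ v) (\<lambda>v. T $$ v) (i, k)"
    if "S \<in> carrier_mat r r" "T \<in> carrier_mat r r" "i < r" "k < r" for S T and i k
    using that by (simp add: mprod_def scalar_prod_def atLeast0LessThan)
  have "mutually_inverse r (\<lambda>v. Z $$ v) (\<lambda>v. B $$ v)"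
    unfolding mutually_inverse_def
  proof (intro allI impI conjI)
    fix i k assume ik: "i < r" "k < r"
    show "mprod r (\<lambda>v. Z $$ v) (\<lambda>v. B $$ v) (i, k) = (if i = k then 1 else 0)"
      unfolding prod[OF Zc Bc ik, symmetric] B(1) using ik by simp
    show "mprod r (\<lambda>v. B $$ v) (\<lambda>v. Z $$ v) (i, k) = (if i = k then 1 else 0)"
      unfolding prod[OF Bc Zc ik, symmetric] B(2) using ik Bc by simp
  qed
  then show "\<exists>w. mutually_inverse r (\<lambda>v. Z $$ v) w" by blast
  show "DL j (Z $$ v) = mprod r (e \<circ> (\<lambda>v. A j $$ v)) (\<lambda>v. Z $$ v) v" if j: "j \<in> {1..m}" and v: "v \<in> idx r"
  proof -
    obtain i k where ik: "v = (i, k)" "i < r" "k < r" using v by (rule idx_cases)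
    have "map_mat (DL j) Z = map_mat e (A j) * Z" using Z j by (simp add: fundamental_matrix_def)
    then have "map_mat (DL j) Z $$ (i, k) = (map_mat e (A j) * Z) $$ (i, k)" by simp
    moreover have "map_mat e (A j) \<in> carrier_mat r r" using A[OF j] by simp
    ultimately show ?thesis using prod[OF _ Zc ik(2,3), of "map_mat e (A j)"] A[OF j] Zc ik
      by (simp add: mprod_def)
  qed
  show "\<exists>v\<in>idx r. s = Z $$ v" if "s \<in> elements_mat Z"
    using that Zc unfolding elements_mat_def by (fastforce simp: idx_def)
qed

theorem theorem3p3:
  fixes m r :: nat
    and DK :: "nat \<Rightarrow> 'k::field \<Rightarrow> 'k"
    and D1 :: "nat \<Rightarrow> 'a::field \<Rightarrow> 'a"
    and D2 :: "nat \<Rightarrow> 'b::field \<Rightarrow> 'b"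
    and e1 :: "'k \<Rightarrow> 'a"
    and e2 :: "'k \<Rightarrow> 'b"
    and A :: "nat \<Rightarrow> 'k mat"
  assumes "differential_field m DK"
    and "formally_real_on (UNIV :: 'k set)"
    and "real_closed_on (constants m DK)"
    and "integrable_system m DK r A"
    and "picard_vessiot m DK r A D1 e1"
    and "formally_real_on (UNIV :: 'a set)"
    and "picard_vessiot m DK r A D2 e2"
    and "formally_real_on (UNIV :: 'b set)"
    and "\<exists>R1 R2. field_ordering_on UNIV R1 \<and> field_ordering_on UNIV R2 \<and>
                 inv_image R1 e1 = inv_image R2 e2"
  shows "differentially_isomorphic m D1 e1 D2 e2"
proof -
  have A: "A j \<in> carrier_mat r r" if "j \<in> {1..m}" for j
    using assms(4) that by (simp add: integrable_system_def)
  define a where "a j v = A j $$ v" for j v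
  obtain R1 R2 where R: "field_ordering_on UNIV R1" "field_ordering_on UNIV R2" "inv_image R1 e1 = inv_image R2 e2"
    using assms(9) by blast
  obtain Z1 where Z1: "fundamental_matrix m D1 e1 r A Z1" "generate_field ring_of_type_algebra (range e1 \<union> elements_mat Z1) = UNIV"
    using assms(5) by (auto simp: picard_vessiot_def)
  obtain Z2 where Z2: "fundamental_matrix m D2 e2 r A Z2" "generate_field ring_of_type_algebra (range e2 \<union> elements_mat Z2) = UNIV"
    using assms(7) by (auto simp: picard_vessiot_def)
  have hom: "field_hom e1" "field_hom e2"
    and der: "\<And>j. j \<in> {1..m} \<Longrightarrow> derivation (D1 j)" "\<And>j. j \<in> {1..m} \<Longrightarrow> derivation (D2 j)"
    and comm: "\<And>j c. j \<in> {1..m} \<Longrightarrow> D1 j (e1 c) = e1 (DK j c)" "\<And>j c. j \<in> {1..m} \<Longrightarrow> D2 j (e2 c) = e2 (DK j c)"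
    and const: "constants m D1 = e1 ` constants m DK" "constants m D2 = e2 ` constants m DK"
    using assms(5,7) by (auto simp: picard_vessiot_def differential_extension_def differential_field_def differential_hom_def)
  interpret e1: field_hom e1 by fact
  interpret e2: field_hom e2 by fact
  define z1 where "z1 v = Z1 $$ v" for v
  define z2 where "z2 v = Z2 $$ v" for v
  note fm1 = fundamental_matrix_entries[OF Z1(1) A, folded z1_def a_def]
  note fm2 = fundamental_matrix_entries[OF Z2(1) A, folded z2_def a_def]
  obtain w1 where w1: "mutually_inverse r z1 w1" using fm1(1) by (auto simp: z1_def[abs_def])
  obtain w2 where w2: "mutually_inverse r z2 w2" using fm2(1) by (auto simp: z2_def[abs_def])
  have sol1: "D1 j (z1 v) = mprod r (e1 \<circ> a j) z1 v" if "j \<in> {1..m}" "v \<in> idx r" for j v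
    using fm1(2)[OF _ that] by (simp add: z1_def[abs_def] a_def[abs_def])
  have sol2: "D2 j (z2 v) = mprod r (e2 \<circ> a j) z2 v" if "j \<in> {1..m}" "v \<in> idx r" for j v
    using fm2(2)[OF _ that] by (simp add: z2_def[abs_def] a_def[abs_def])
  obtain T where T: "real_closed_cone T" "cone_field T = to_ac ` constants m DK"
    using real_closed_on_cone[OF assms(3)] by blast
  have inf: "infinite (constants m DK)"
  proof -
    interpret T: real_closed_cone T by (rule T(1))
    show ?thesis using T.infinite_F unfolding T(2) by blast
  qed
  obtain P where P: "real_closed_cone P" "range to_ac \<subseteq> cone_field P" "\<And>x. to_ac x \<in> P \<longleftrightarrow> x \<noteq> 0 \<and> (0, x) \<in> R1"
    using real_closure_of_ordering[OF R(1)] by blast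
  obtain Q where Q: "real_closed_cone Q" "range to_ac \<subseteq> cone_field Q" "\<And>x. to_ac x \<in> Q \<longleftrightarrow> x \<noteq> 0 \<and> (0, x) \<in> R2"
    using real_closure_of_ordering[OF R(2)] by blast
  have pos: "to_ac (e1 c) \<in> P \<longleftrightarrow> to_ac (e2 c) \<in> Q" for c
  proof -
    have "(0, e1 c) \<in> R1 \<longleftrightarrow> (0, e2 c) \<in> R2"
      using R(3) by (metis e1.hom_zero e2.hom_zero in_inv_image)
    then show ?thesis unfolding P(3) Q(3) by simp
  qed
  have sgn: "sg P (to_ac (e1 c)) = sg Q (to_ac (e2 c))" for c
    using pos[of c] pos[of "- c"] by (simp add: sg_def e1.hom_uminus e2.hom_uminus)
  interpret S12: solution_pair m r DK D1 D2 e1 e2 a z1 w1 z2 w2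
    by unfold_locales (use hom assms(1) der comm const sol1 sol2 w1 w2 inf in \<open>simp_all\<close>)
  interpret S21: solution_pair m r DK D2 D1 e2 e1 a z2 w2 z1 w1
    by unfold_locales (use hom assms(1) der comm const sol1 sol2 w1 w2 inf in \<open>simp_all\<close>)
  obtain M M' where M: "\<forall>v. M v \<in> constants m DK \<and> M' v \<in> constants m DK" "mutually_inverse r M M'"
    "\<forall>p\<in>S12.relations2. ev e1 (mprod r z1 (e1 \<circ> M)) p = 0"
    using S12.constant_specialization[OF P(1) Q(1) T P(2) Q(2) sgn] by blast
  obtain N N' where N: "mutually_inverse r N N'" "\<forall>p\<in>S21.relations2. ev e2 (mprod r z2 (e2 \<circ> N)) p = 0"
    using S21.constant_specialization[OF Q(1) P(1) T Q(2) P(2) sgn[symmetric]] by blast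
  define x1 where "x1 = mprod r z1 (e1 \<circ> M)"
  have rel12: "ev e1 x1 p = 0" if "p \<in> pexps UNIV (idx r)" "ev e2 z2 p = 0" for p
    using M(3) that by (simp add: S12.relations2_def x1_def)
  \<comment> \<open>Both specializations together multiply \<open>z2\<close> by \<open>N M\<close>.\<close>
  have rel21: "ev e2 (mprod r z2 (e2 \<circ> mprod r N M)) p = 0" if p: "p \<in> pexps UNIV (idx r)" "ev e1 x1 p = 0" for p
  proof -
    have "psub r M p \<in> S21.relations2"
      unfolding S21.relations2_def using p psub_pexps by (simp add: ev_psub x1_def)
    then have "ev e2 (mprod r z2 (e2 \<circ> N)) (psub r M p) = 0" using N(2) by blast
    moreover have "mprod r (mprod r z2 (e2 \<circ> N)) (e2 \<circ> M) = mprod r z2 (e2 \<circ> mprod r N M)"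
    proof -
      have "e2 \<circ> mprod r N M = mprod r (e2 \<circ> N) (e2 \<circ> M)" by (rule ext) (simp add: e2.hom_mprod)
      then show ?thesis by (simp add: mprod_assoc)
    qed
    ultimately show ?thesis by (simp add: ev_psub)
  qed
  have rel: "ev e1 x1 p = 0 \<longleftrightarrow> ev e2 z2 p = 0" if p: "p \<in> pexps UNIV (idx r)" for p
    using relations_preserved_reflected[OF hom(2) mutually_inverse_mprod[OF N(1) M(2)], of z2 p] rel12 rel21 p by blast
  have sol_x1: "D1 j (x1 v) = mprod r (e1 \<circ> a j) x1 v" if "j \<in> {1..m}" "v \<in> idx r" for j v
    unfolding x1_def using S12.solution_times_constant[of M j v] M(1) that by blast
  have "\<exists>f\<in>pexps UNIV (idx r). ev e1 x1 f = s" if s: "s \<in> elements_mat Z1" for s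
  proof -
    obtain v where v: "v \<in> idx r" "s = z1 v" using fm1(3)[OF _ s] by auto
    have "ev e1 x1 (psub r M' (Var v)) = mprod r x1 (e1 \<circ> M') v" by (simp add: ev_psub)
    also have "\<dots> = s" unfolding x1_def v(2)
      by (rule mprod_cancel_right[OF e1.hom_mutually_inverse[OF M(2)] v(1)])
    finally show ?thesis using psub_pexps[of "Var v" r M'] v(1) by (intro bexI[of _ "psub r M' (Var v)"]) auto
  qed
  then have quot1: "\<exists>f\<in>pexps UNIV (idx r). \<exists>g\<in>pexps UNIV (idx r). ev e1 x1 g \<noteq> 0 \<and> s = ev e1 x1 f / ev e1 x1 g" for s
    by (rule generated_quotients[OF hom(1) Z1(2)])
  have "\<exists>f\<in>pexps UNIV (idx r). ev e2 z2 f = s" if s: "s \<in> elements_mat Z2" for s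
  proof -
    obtain v where v: "v \<in> idx r" "s = z2 v" using fm2(3)[OF _ s] by auto
    then show ?thesis by (intro bexI[of _ "Var v"]) auto
  qed
  then have quot2: "\<exists>f\<in>pexps UNIV (idx r). \<exists>g\<in>pexps UNIV (idx r). ev e2 z2 g \<noteq> 0 \<and> s = ev e2 z2 f / ev e2 z2 g" for s
    by (rule generated_quotients[OF hom(2) Z2(2)])
  show ?thesis
    by (rule same_relations_isomorphic[OF hom rel quot1 quot2 der comm sol_x1 sol2])
qed

end
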